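(* Let $R$ be an associative ring with unity, let $n>0$ be an integer, and let $\kappa$ be an infinite regular cardinal with $\kappa>\mathrm{Card}(R)$. Then every complex $X\in\mathrm{ex}\widetilde{\mathcal{P}_n}$ has an $\mathrm{ex}\widetilde{\mathcal{P}_n(\kappa)}$-filtration.
   Context: Chain complexes are $\mathbb{Z}$-graded complexes of left $R$-modules. For a class $\mathcal{A}$ of left $R$-modules, $\mathrm{ex}\widetilde{\mathcal{A}}$ is the class of exact chain complexes $X$ with $X_m\in\mathcal{A}$ for every $m\in\mathbb{Z}$. $\mathcal{P}_n$ is the class of left $R$-modules of projective dimension at most $n$. $\mathcal{P}_n(\kappa)$ is the class of left $R$-modules $M$ having an exact sequence $0\to\bigoplus_{i\in I_n}P_n^i\to\cdots\to\bigoplus_{i\in I_1}P_1^i\to\bigoplus_{i\in I_0}P_0^i\to M\to 0$ in which every $P_k^i$ is a countably generated projective module and $\mathrm{Card}(I_k)\leq\kappa$ for every $0\leq k\leq n$. Given a class $\mathcal{S}$ of objects of a cocomplete Abelian category, an $\mathcal{S}$-filtration of an object $X$ is a family $(X_\alpha:\alpha<\lambda)$, $\lambda$ an ordinal, forming a colimit-preserving functor on $\lambda$ (so $X_\beta=\mathrm{CoLim}_{\alpha<\beta}X_\alpha$ for limit ordinals $\beta<\lambda$), with $X=\mathrm{CoLim}_{\alpha<\lambda}X_\alpha$, such that $X_0\in\mathcal{S}$ and for each $\alpha+1<\lambda$ the map $X_\alpha\to X_{\alpha+1}$ is a monomorphism with cokernel in $\mathcal{S}$. *)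

theory Defs
  imports "HOL-Algebra.Module" "HOL-Library.FuncSet" "HOL-Library.Countable_Set"
begin

unbundle cardinal_syntax

section \<open>Left modules over an associative ring with unity\<close>

text \<open>
  The library locale \<^locale>\<open>module\<close> demands a commutative ring. Here are the same axioms over an
  arbitrary unital ring. The fields \<^const>\<open>mult\<close> and \<^const>\<open>one\<close> of the record are irrelevant.
\<close>

locale left_module = R?: ring R + M?: abelian_group M for R (structure) and M (structure) +
  assumes smult_closed [simp, intro]:
      "\<lbrakk> a \<in> carrier R; x \<in> carrier M \<rbrakk> \<Longrightarrow> a \<odot>\<^bsub>M\<^esub> x \<in> carrier M"
    and smult_l_distr:
      "\<lbrakk> a \<in> carrier R; b \<in> carrier R; x \<in> carrier M \<rbrakk> \<Longrightarrow>
      (a \<oplus> b) \<odot>\<^bsub>M\<^esub> x = a \<odot>\<^bsub>M\<^esub> x \<oplus>\<^bsub>M\<^esub> b \<odot>\<^bsub>M\<^esub> x"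
    and smult_r_distr:
      "\<lbrakk> a \<in> carrier R; x \<in> carrier M; y \<in> carrier M \<rbrakk> \<Longrightarrow>
      a \<odot>\<^bsub>M\<^esub> (x \<oplus>\<^bsub>M\<^esub> y) = a \<odot>\<^bsub>M\<^esub> x \<oplus>\<^bsub>M\<^esub> a \<odot>\<^bsub>M\<^esub> y"
    and smult_assoc1:
      "\<lbrakk> a \<in> carrier R; b \<in> carrier R; x \<in> carrier M \<rbrakk> \<Longrightarrow>
      (a \<otimes> b) \<odot>\<^bsub>M\<^esub> x = a \<odot>\<^bsub>M\<^esub> (b \<odot>\<^bsub>M\<^esub> x)"
    and smult_one [simp]:
      "x \<in> carrier M \<Longrightarrow> \<one> \<odot>\<^bsub>M\<^esub> x = x"

text \<open>
  Homomorphisms are total functions whose values outside the carrier are irrelevant; equality of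
  homomorphisms always means equality on the carrier.
\<close>

definition lmod_hom ::
  "('r, 'z) ring_scheme \<Rightarrow> ('r, 'a) module \<Rightarrow> ('r, 'b) module \<Rightarrow> ('a \<Rightarrow> 'b) set" where
  "lmod_hom R M N = {f. f \<in> carrier M \<rightarrow> carrier N \<and>
     (\<forall>x\<in>carrier M. \<forall>y\<in>carrier M. f (x \<oplus>\<^bsub>M\<^esub> y) = f x \<oplus>\<^bsub>N\<^esub> f y) \<and>
     (\<forall>a\<in>carrier R. \<forall>x\<in>carrier M. f (a \<odot>\<^bsub>M\<^esub> x) = a \<odot>\<^bsub>N\<^esub> f x)}"

definition lmod_kernel :: "('r, 'a) module \<Rightarrow> ('r, 'b) module \<Rightarrow> ('a \<Rightarrow> 'b) \<Rightarrow> 'a set" where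
  "lmod_kernel M N f = {x \<in> carrier M. f x = \<zero>\<^bsub>N\<^esub>}"

text \<open>
  Projectivity is the lifting property along epimorphisms. A HOL definition cannot quantify over
  the types carrying the test modules. The two types chosen here (they accommodate the canonical
  epimorphism from the free module on \<open>carrier P\<close> onto \<open>P\<close>) give the full notion: the lemma
  \<open>projective_lift\<close> below derives the lifting property for test modules over all types.
\<close>

definition projective :: "('r, 'z) ring_scheme \<Rightarrow> ('r, 'p) module \<Rightarrow> bool" where
  "projective R P \<longleftrightarrow> left_module R P \<and>
     (\<forall>(M :: ('r, 'p \<Rightarrow> 'r) module) (N :: ('r, 'p) module) g f.
        left_module R M \<and> left_module R N \<and>
        g \<in> lmod_hom R M N \<and> g ` carrier M = carrier N \<and> f \<in> lmod_hom R P N \<longrightarrow>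
        (\<exists>h\<in>lmod_hom R P M. \<forall>x\<in>carrier P. g (h x) = f x))"

definition countably_generated :: "('r, 'z) ring_scheme \<Rightarrow> ('r, 'p) module \<Rightarrow> bool" where
  "countably_generated R P \<longleftrightarrow> left_module R P \<and>
     (\<exists>S. countable S \<and> S \<subseteq> carrier P \<and> (\<forall>H. submodule H R P \<and> S \<subseteq> H \<longrightarrow> H = carrier P))"

definition direct_sum :: "'i set \<Rightarrow> ('i \<Rightarrow> ('r, 'p) module) \<Rightarrow> ('r, 'i \<Rightarrow> 'p) module" where
  "direct_sum I P =
     \<lparr>carrier = {x \<in> (\<Pi>\<^sub>E i\<in>I. carrier (P i)). finite {i \<in> I. x i \<noteq> \<zero>\<^bsub>P i\<^esub>}},
      mult = undefined, one = undefined,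
      zero = (\<lambda>i\<in>I. \<zero>\<^bsub>P i\<^esub>),
      add = (\<lambda>x y. \<lambda>i\<in>I. x i \<oplus>\<^bsub>P i\<^esub> y i),
      smult = (\<lambda>a x. \<lambda>i\<in>I. a \<odot>\<^bsub>P i\<^esub> x i)\<rparr>"

text \<open>
  Exactness of \<open>0 \<rightarrow> Q n \<rightarrow> \<dots> \<rightarrow> Q 1 \<rightarrow> Q 0 \<rightarrow> M \<rightarrow> 0\<close> with maps \<open>d k : Q (k + 1) \<rightarrow> Q k\<close> and
  \<open>e : Q 0 \<rightarrow> M\<close>.
\<close>

definition exact_resolution ::
  "('r, 'z) ring_scheme \<Rightarrow> nat \<Rightarrow> (nat \<Rightarrow> ('r, 'q) module) \<Rightarrow> (nat \<Rightarrow> 'q \<Rightarrow> 'q) \<Rightarrow>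
   ('q \<Rightarrow> 'm) \<Rightarrow> ('r, 'm) module \<Rightarrow> bool" where
  "exact_resolution R n Q d e M \<longleftrightarrow>
     left_module R M \<and> (\<forall>k\<le>n. left_module R (Q k)) \<and>
     e \<in> lmod_hom R (Q 0) M \<and> (\<forall>k<n. d k \<in> lmod_hom R (Q (Suc k)) (Q k)) \<and>
     e ` carrier (Q 0) = carrier M \<and>
     lmod_kernel (Q 0) M e = (if n = 0 then {\<zero>\<^bsub>Q 0\<^esub>} else d 0 ` carrier (Q 1)) \<and>
     (\<forall>k<n. lmod_kernel (Q (Suc k)) (Q k) (d k) =
        (if Suc k = n then {\<zero>\<^bsub>Q n\<^esub>} else d (Suc k) ` carrier (Q (Suc (Suc k)))))"

text \<open>
  The class of modules of projective dimension at most \<open>n\<close>. The type of the modules in the projective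
  resolution is a parameter: a theorem with a hypothesis \<open>M \<in> Proj_dim TYPE('p) R n\<close>, being
  polymorphic in \<open>'p\<close>, covers resolutions by modules over arbitrary types.
\<close>

definition Proj_dim ::
  "'p itself \<Rightarrow> ('r, 'z) ring_scheme \<Rightarrow> nat \<Rightarrow> ('r, 'm) module set" where
  "Proj_dim _ R n = {M. \<exists>(Q :: nat \<Rightarrow> ('r, 'p) module) d e.
     exact_resolution R n Q d e M \<and> (\<forall>k\<le>n. projective R (Q k))}"

text \<open>
  In the class \<open>\<P>\<^sub>n(\<kappa>)\<close> the index sets may be taken inside the type carrying \<open>\<kappa>\<close>, as \<open>|Field \<kappa>| =o \<kappa>\<close>, and
  the countably generated modules over the type \<^typ>\<open>nat \<Rightarrow> 'r\<close>, as each of them is a quotient of the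
  free module of finitely supported sequences in \<open>R\<close>; both are no restriction up to isomorphism.
\<close>

definition Proj_dim_card ::
  "('r, 'z) ring_scheme \<Rightarrow> nat \<Rightarrow> 'k rel \<Rightarrow> ('r, 'm) module set" where
  "Proj_dim_card R n \<kappa> =
     {M. \<exists>(I :: nat \<Rightarrow> 'k set) (P :: nat \<Rightarrow> 'k \<Rightarrow> ('r, nat \<Rightarrow> 'r) module) d e.
        exact_resolution R n (\<lambda>k. direct_sum (I k) (P k)) d e M \<and>
        (\<forall>k\<le>n. |I k| \<le>o \<kappa> \<and>
           (\<forall>i\<in>I k. countably_generated R (P k i) \<and> projective R (P k i)))}"

lemma left_moduleI:
  fixes R (structure) and M (structure)
  assumes "ring R" "abelian_group M"
    and "\<And>a x. \<lbrakk> a \<in> carrier R; x \<in> carrier M \<rbrakk> \<Longrightarrow> a \<odot>\<^bsub>M\<^esub> x \<in> carrier M"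
    and "\<And>a b x. \<lbrakk> a \<in> carrier R; b \<in> carrier R; x \<in> carrier M \<rbrakk> \<Longrightarrow>
      (a \<oplus> b) \<odot>\<^bsub>M\<^esub> x = (a \<odot>\<^bsub>M\<^esub> x) \<oplus>\<^bsub>M\<^esub> (b \<odot>\<^bsub>M\<^esub> x)"
    and "\<And>a x y. \<lbrakk> a \<in> carrier R; x \<in> carrier M; y \<in> carrier M \<rbrakk> \<Longrightarrow>
      a \<odot>\<^bsub>M\<^esub> (x \<oplus>\<^bsub>M\<^esub> y) = (a \<odot>\<^bsub>M\<^esub> x) \<oplus>\<^bsub>M\<^esub> (a \<odot>\<^bsub>M\<^esub> y)"
    and "\<And>a b x. \<lbrakk> a \<in> carrier R; b \<in> carrier R; x \<in> carrier M \<rbrakk> \<Longrightarrow>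
      (a \<otimes> b) \<odot>\<^bsub>M\<^esub> x = a \<odot>\<^bsub>M\<^esub> (b \<odot>\<^bsub>M\<^esub> x)"
    and "\<And>x. x \<in> carrier M \<Longrightarrow> \<one> \<odot>\<^bsub>M\<^esub> x = x"
  shows "left_module R M"
  using assms by (auto intro!: left_module.intro left_module_axioms.intro)

lemma (in left_module) smult_l_null [simp]:
  assumes x: "x \<in> carrier M" shows "\<zero> \<odot>\<^bsub>M\<^esub> x = \<zero>\<^bsub>M\<^esub>"
proof -
  have "\<zero> \<odot>\<^bsub>M\<^esub> x \<oplus>\<^bsub>M\<^esub> \<zero> \<odot>\<^bsub>M\<^esub> x = \<zero> \<odot>\<^bsub>M\<^esub> x"
    using smult_l_distr[of \<zero> \<zero> x] x by simp
  then show ?thesis using x M.add.r_cancel_one' by (metis R.zero_closed smult_closed)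
qed

lemma (in left_module) smult_r_null [simp]:
  assumes a: "a \<in> carrier R" shows "a \<odot>\<^bsub>M\<^esub> \<zero>\<^bsub>M\<^esub> = \<zero>\<^bsub>M\<^esub>"
proof -
  have "a \<odot>\<^bsub>M\<^esub> \<zero>\<^bsub>M\<^esub> \<oplus>\<^bsub>M\<^esub> a \<odot>\<^bsub>M\<^esub> \<zero>\<^bsub>M\<^esub> = a \<odot>\<^bsub>M\<^esub> \<zero>\<^bsub>M\<^esub>"
    using smult_r_distr[of a "\<zero>\<^bsub>M\<^esub>" "\<zero>\<^bsub>M\<^esub>"] a by simp
  then show ?thesis using a M.add.r_cancel_one' by (metis M.zero_closed smult_closed)
qed

lemma (in left_module) finsum_smult_ldistr:
  assumes "finite A" "a \<in> carrier R" "f \<in> A \<rightarrow> carrier M"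
  shows "a \<odot>\<^bsub>M\<^esub> (\<Oplus>\<^bsub>M\<^esub> i \<in> A. f i) = (\<Oplus>\<^bsub>M\<^esub> i \<in> A. a \<odot>\<^bsub>M\<^esub> f i)"
  using assms
proof (induction A rule: finite_induct)
  case (insert x F) then show ?case by (simp add: Pi_def smult_r_distr)
qed simp

lemma lmod_homD:
  assumes "f \<in> lmod_hom R M N"
  shows "x \<in> carrier M \<Longrightarrow> f x \<in> carrier N"
    and "x \<in> carrier M \<Longrightarrow> y \<in> carrier M \<Longrightarrow> f (x \<oplus>\<^bsub>M\<^esub> y) = f x \<oplus>\<^bsub>N\<^esub> f y"
    and "a \<in> carrier R \<Longrightarrow> x \<in> carrier M \<Longrightarrow> f (a \<odot>\<^bsub>M\<^esub> x) = a \<odot>\<^bsub>N\<^esub> f x"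
  using assms by (auto simp: lmod_hom_def)

lemma lmod_homI:
  assumes "\<And>x. x \<in> carrier M \<Longrightarrow> f x \<in> carrier N"
    and "\<And>x y. x \<in> carrier M \<Longrightarrow> y \<in> carrier M \<Longrightarrow> f (x \<oplus>\<^bsub>M\<^esub> y) = f x \<oplus>\<^bsub>N\<^esub> f y"
    and "\<And>a x. a \<in> carrier R \<Longrightarrow> x \<in> carrier M \<Longrightarrow> f (a \<odot>\<^bsub>M\<^esub> x) = a \<odot>\<^bsub>N\<^esub> f x"
  shows "f \<in> lmod_hom R M N"
  using assms by (auto simp: lmod_hom_def)

lemma lmod_hom_zero:
  assumes "left_module R M" "left_module R N" "f \<in> lmod_hom R M N"
  shows "f \<zero>\<^bsub>M\<^esub> = \<zero>\<^bsub>N\<^esub>"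
proof -
  interpret M: left_module R M by fact
  interpret N: left_module R N by fact
  have "f (\<zero>\<^bsub>R\<^esub> \<odot>\<^bsub>M\<^esub> \<zero>\<^bsub>M\<^esub>) = \<zero>\<^bsub>R\<^esub> \<odot>\<^bsub>N\<^esub> f \<zero>\<^bsub>M\<^esub>"
    using lmod_homD(3)[OF assms(3)] by blast
  then show ?thesis using lmod_homD(1)[OF assms(3)] by simp
qed

lemma lmod_hom_finsum:
  assumes "left_module R M" "left_module R N" "f \<in> lmod_hom R M N" "finite A" "b \<in> A \<rightarrow> carrier M"
  shows "f (finsum M b A) = finsum N (\<lambda>i. f (b i)) A"
proof -
  interpret M: left_module R M by fact
  interpret N: left_module R N by fact
  show ?thesis using assms(4,5)
  proof (induction A rule: finite_induct)
    case empty show ?case using lmod_hom_zero[OF assms(1-3)] by simp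
  next
    case (insert x F)
    then show ?case
      using lmod_homD(1,2)[OF assms(3)] by (simp add: Pi_def)
  qed
qed

lemma direct_sum_left_module:
  assumes R: "ring R" and P: "\<And>i. i \<in> I \<Longrightarrow> left_module R (P i)"
  shows "left_module R (direct_sum I P)"
proof -
  interpret R: ring R by fact
  have [simp]: "x \<oplus>\<^bsub>P i\<^esub> y \<in> carrier (P i)" "x \<oplus>\<^bsub>P i\<^esub> y = y \<oplus>\<^bsub>P i\<^esub> x"
    if "i \<in> I" "x \<in> carrier (P i)" "y \<in> carrier (P i)" for i x y
  proof -
    interpret left_module R "P i" using P that by blast
    show "x \<oplus>\<^bsub>P i\<^esub> y \<in> carrier (P i)" "x \<oplus>\<^bsub>P i\<^esub> y = y \<oplus>\<^bsub>P i\<^esub> x"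
      using that by (auto simp: M.a_comm)
  qed
  have z: "\<zero>\<^bsub>P i\<^esub> \<in> carrier (P i)" "\<zero>\<^bsub>P i\<^esub> \<oplus>\<^bsub>P i\<^esub> \<zero>\<^bsub>P i\<^esub> = \<zero>\<^bsub>P i\<^esub>"
    "a \<in> carrier R \<Longrightarrow> a \<odot>\<^bsub>P i\<^esub> \<zero>\<^bsub>P i\<^esub> = \<zero>\<^bsub>P i\<^esub>"
    if "i \<in> I" for i a
  proof -
    interpret left_module R "P i" using P that by blast
    show "\<zero>\<^bsub>P i\<^esub> \<in> carrier (P i)" "\<zero>\<^bsub>P i\<^esub> \<oplus>\<^bsub>P i\<^esub> \<zero>\<^bsub>P i\<^esub> = \<zero>\<^bsub>P i\<^esub>"
      "a \<in> carrier R \<Longrightarrow> a \<odot>\<^bsub>P i\<^esub> \<zero>\<^bsub>P i\<^esub> = \<zero>\<^bsub>P i\<^esub>" by auto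
  qed
  let ?D = "direct_sum I P"
  have cl: "x \<oplus>\<^bsub>?D\<^esub> y \<in> carrier ?D" if "x \<in> carrier ?D" "y \<in> carrier ?D" for x y
  proof -
    have "{i \<in> I. x i \<oplus>\<^bsub>P i\<^esub> y i \<noteq> \<zero>\<^bsub>P i\<^esub>} \<subseteq> {i \<in> I. x i \<noteq> \<zero>\<^bsub>P i\<^esub>} \<union> {i \<in> I. y i \<noteq> \<zero>\<^bsub>P i\<^esub>}"
      using z by auto
    then have "finite {i \<in> I. x i \<oplus>\<^bsub>P i\<^esub> y i \<noteq> \<zero>\<^bsub>P i\<^esub>}"
      by (rule finite_subset) (use that in \<open>auto simp: direct_sum_def\<close>)
    then show ?thesis using that
      by (auto simp: direct_sum_def PiE_iff cong: conj_cong)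
  qed
  have sc: "a \<odot>\<^bsub>?D\<^esub> x \<in> carrier ?D" if "a \<in> carrier R" "x \<in> carrier ?D" for a x
  proof -
    have "{i \<in> I. a \<odot>\<^bsub>P i\<^esub> x i \<noteq> \<zero>\<^bsub>P i\<^esub>} \<subseteq> {i \<in> I. x i \<noteq> \<zero>\<^bsub>P i\<^esub>}"
      using z that by auto
    then have "finite {i \<in> I. a \<odot>\<^bsub>P i\<^esub> x i \<noteq> \<zero>\<^bsub>P i\<^esub>}"
      by (rule finite_subset) (use that in \<open>auto simp: direct_sum_def\<close>)
    then show ?thesis using that left_module.smult_closed[OF P]
      by (auto simp: direct_sum_def PiE_iff cong: conj_cong)
  qed
  have ext: "x = y" if "x \<in> carrier ?D" "y \<in> carrier ?D" "\<And>i. i \<in> I \<Longrightarrow> x i = y i" for x y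
    using that by (auto simp: direct_sum_def intro: PiE_ext)
  have el: "x i \<in> carrier (P i)" if "x \<in> carrier ?D" "i \<in> I" for x i
    using that by (auto simp: direct_sum_def)
  have ad: "(x \<oplus>\<^bsub>?D\<^esub> y) i = x i \<oplus>\<^bsub>P i\<^esub> y i" "(a \<odot>\<^bsub>?D\<^esub> x) i = a \<odot>\<^bsub>P i\<^esub> x i"
    "\<zero>\<^bsub>?D\<^esub> i = \<zero>\<^bsub>P i\<^esub>" if "i \<in> I" for x y a i
    using that by (auto simp: direct_sum_def)
  have zc: "\<zero>\<^bsub>?D\<^esub> \<in> carrier ?D"
    using z by (auto simp: direct_sum_def cong: conj_cong)
  have ab: "abelian_group ?D"
  proof (rule abelian_groupI)
    fix x assume x: "x \<in> carrier ?D"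
    have "\<ominus>\<^bsub>R\<^esub> \<one>\<^bsub>R\<^esub> \<odot>\<^bsub>?D\<^esub> x \<oplus>\<^bsub>?D\<^esub> x = \<zero>\<^bsub>?D\<^esub>"
    proof (rule ext)
      fix i assume i: "i \<in> I"
      interpret left_module R "P i" using P i by blast
      have "\<ominus>\<^bsub>R\<^esub> \<one>\<^bsub>R\<^esub> \<odot>\<^bsub>P i\<^esub> x i \<oplus>\<^bsub>P i\<^esub> x i = (\<ominus>\<^bsub>R\<^esub> \<one>\<^bsub>R\<^esub> \<oplus>\<^bsub>R\<^esub> \<one>\<^bsub>R\<^esub>) \<odot>\<^bsub>P i\<^esub> x i"
        using el[OF x i] by (subst smult_l_distr) auto
      then show "(\<ominus>\<^bsub>R\<^esub> \<one>\<^bsub>R\<^esub> \<odot>\<^bsub>?D\<^esub> x \<oplus>\<^bsub>?D\<^esub> x) i = \<zero>\<^bsub>?D\<^esub> i"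
        using el[OF x i] i by (simp add: ad R.l_neg)
    qed (use x cl sc zc in auto)
    then show "\<exists>y\<in>carrier ?D. y \<oplus>\<^bsub>?D\<^esub> x = \<zero>\<^bsub>?D\<^esub>" using x sc by blast
  next
    fix x y w assume h: "x \<in> carrier ?D" "y \<in> carrier ?D" "w \<in> carrier ?D"
    show "x \<oplus>\<^bsub>?D\<^esub> y \<oplus>\<^bsub>?D\<^esub> w = x \<oplus>\<^bsub>?D\<^esub> (y \<oplus>\<^bsub>?D\<^esub> w)"
    proof (rule ext)
      fix i assume i: "i \<in> I"
      interpret left_module R "P i" using P i by blast
      show "(x \<oplus>\<^bsub>?D\<^esub> y \<oplus>\<^bsub>?D\<^esub> w) i = (x \<oplus>\<^bsub>?D\<^esub> (y \<oplus>\<^bsub>?D\<^esub> w)) i"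
        using h i by (simp add: ad el M.a_assoc del: \<open>\<And>i x y. _ \<Longrightarrow> _ \<Longrightarrow> _ \<Longrightarrow> x \<oplus>\<^bsub>P i\<^esub> y = y \<oplus>\<^bsub>P i\<^esub> x\<close>)
    qed (use h cl in auto)
  next
    fix x y assume h: "x \<in> carrier ?D" "y \<in> carrier ?D"
    show "x \<oplus>\<^bsub>?D\<^esub> y = y \<oplus>\<^bsub>?D\<^esub> x"
      by (rule ext) (use h cl el in \<open>auto simp: ad\<close>)
  next
    fix x assume x: "x \<in> carrier ?D"
    show "\<zero>\<^bsub>?D\<^esub> \<oplus>\<^bsub>?D\<^esub> x = x"
    proof (rule ext)
      fix i assume i: "i \<in> I"
      interpret left_module R "P i" using P i by blast
      show "(\<zero>\<^bsub>?D\<^esub> \<oplus>\<^bsub>?D\<^esub> x) i = x i" using x i by (simp add: ad el)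
    qed (use x cl zc in auto)
  qed (use cl zc in auto)
  show ?thesis
  proof (rule left_moduleI[OF R ab sc])
    fix a b x assume h: "a \<in> carrier R" "b \<in> carrier R" "x \<in> carrier ?D"
    show "(a \<oplus>\<^bsub>R\<^esub> b) \<odot>\<^bsub>?D\<^esub> x = a \<odot>\<^bsub>?D\<^esub> x \<oplus>\<^bsub>?D\<^esub> b \<odot>\<^bsub>?D\<^esub> x"
      by (rule ext) (use h cl sc left_module.smult_l_distr[OF P] el in \<open>auto simp: ad\<close>)
    show "(a \<otimes>\<^bsub>R\<^esub> b) \<odot>\<^bsub>?D\<^esub> x = a \<odot>\<^bsub>?D\<^esub> (b \<odot>\<^bsub>?D\<^esub> x)"
      by (rule ext) (use h sc left_module.smult_assoc1[OF P] el in \<open>auto simp: ad\<close>)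
  next
    fix a x y assume h: "a \<in> carrier R" "x \<in> carrier ?D" "y \<in> carrier ?D"
    show "a \<odot>\<^bsub>?D\<^esub> (x \<oplus>\<^bsub>?D\<^esub> y) = a \<odot>\<^bsub>?D\<^esub> x \<oplus>\<^bsub>?D\<^esub> a \<odot>\<^bsub>?D\<^esub> y"
    proof (rule ext)
      fix i assume i: "i \<in> I"
      show "(a \<odot>\<^bsub>?D\<^esub> (x \<oplus>\<^bsub>?D\<^esub> y)) i = (a \<odot>\<^bsub>?D\<^esub> x \<oplus>\<^bsub>?D\<^esub> a \<odot>\<^bsub>?D\<^esub> y) i"
        using h i left_module.smult_r_distr[OF P[OF i], of a "x i" "y i"] el by (simp only: ad)
    qed (use h cl sc in auto)
  next
    fix x assume h: "x \<in> carrier ?D"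
    show "\<one>\<^bsub>R\<^esub> \<odot>\<^bsub>?D\<^esub> x = x"
      by (rule ext) (use h sc left_module.smult_one[OF P] el in \<open>auto simp: ad\<close>)
  qed auto
qed

definition regular_module :: "('r, 'z) ring_scheme \<Rightarrow> ('r, 'r) module" where
  "regular_module R = \<lparr>carrier = carrier R, mult = undefined, one = undefined,
     zero = \<zero>\<^bsub>R\<^esub>, add = (\<oplus>\<^bsub>R\<^esub>), smult = (\<otimes>\<^bsub>R\<^esub>)\<rparr>"

lemma regular_module_left_module:
  assumes "ring R" shows "left_module R (regular_module R)"
proof -
  interpret ring R by fact
  have "abelian_group (regular_module R)"
    by (rule abelian_groupI) (auto simp: regular_module_def a_ac intro: l_neg bexI[of _ "\<ominus>\<^bsub>R\<^esub> _"])
  then show ?thesis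
    by (intro left_moduleI[OF assms]) (auto simp: regular_module_def l_distr r_distr m_assoc)
qed

abbreviation free_module :: "('r, 'z) ring_scheme \<Rightarrow> 'i set \<Rightarrow> ('r, 'i \<Rightarrow> 'r) module" where
  "free_module R B \<equiv> direct_sum B (\<lambda>_. regular_module R)"

definition lin_comb ::
  "('r, 'z) ring_scheme \<Rightarrow> ('r, 'm) module \<Rightarrow> 'i set \<Rightarrow> ('i \<Rightarrow> 'm) \<Rightarrow> ('i \<Rightarrow> 'r) \<Rightarrow> 'm" where
  "lin_comb R N B b c = finsum N (\<lambda>i. c i \<odot>\<^bsub>N\<^esub> b i) {i \<in> B. c i \<noteq> \<zero>\<^bsub>R\<^esub>}"

lemma free_module_simps:
  "carrier (free_module R B) = {c \<in> B \<rightarrow>\<^sub>E carrier R. finite {i \<in> B. c i \<noteq> \<zero>\<^bsub>R\<^esub>}}"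
  "c \<oplus>\<^bsub>free_module R B\<^esub> c' = (\<lambda>i\<in>B. c i \<oplus>\<^bsub>R\<^esub> c' i)"
  "a \<odot>\<^bsub>free_module R B\<^esub> c = (\<lambda>i\<in>B. a \<otimes>\<^bsub>R\<^esub> c i)"
  by (auto simp: direct_sum_def regular_module_def)

lemma lin_comb_superset:
  assumes "left_module R N" "b \<in> B \<rightarrow> carrier N" "c \<in> B \<rightarrow> carrier R" "finite A" "A \<subseteq> B"
    and "{i \<in> B. c i \<noteq> \<zero>\<^bsub>R\<^esub>} \<subseteq> A"
  shows "lin_comb R N B b c = finsum N (\<lambda>i. c i \<odot>\<^bsub>N\<^esub> b i) A"
proof -
  interpret left_module R N by fact
  show ?thesis unfolding lin_comb_def
    by (rule M.add.finprod_mono_neutral_cong_left) (use assms in \<open>auto simp: Pi_iff\<close>)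
qed

lemma lin_comb_hom:
  assumes N: "left_module R N" and b: "b \<in> B \<rightarrow> carrier N"
  shows "lin_comb R N B b \<in> lmod_hom R (free_module R B) N"
proof (rule lmod_homI)
  interpret left_module R N by fact
  have ev: "lin_comb R N B b c = finsum N (\<lambda>i. c i \<odot>\<^bsub>N\<^esub> b i) A"
    if "c \<in> B \<rightarrow> carrier R" "finite A" "A \<subseteq> B" "{i \<in> B. c i \<noteq> \<zero>\<^bsub>R\<^esub>} \<subseteq> A" for c A
    using lin_comb_superset[OF N b] that by blast
  fix c assume c: "c \<in> carrier (free_module R B)"
  show "lin_comb R N B b c \<in> carrier N"
    unfolding lin_comb_def using b c by (intro M.finsum_closed) (auto simp: free_module_simps Pi_iff PiE_iff)
  let ?A = "{i \<in> B. c i \<noteq> \<zero>\<^bsub>R\<^esub>}"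
  {
    fix c' assume c': "c' \<in> carrier (free_module R B)"
    let ?C = "?A \<union> {i \<in> B. c' i \<noteq> \<zero>\<^bsub>R\<^esub>}"
    have f: "finite ?C" "?C \<subseteq> B" using c c' by (auto simp: free_module_simps)
    have m: "c \<in> B \<rightarrow> carrier R" "c' \<in> B \<rightarrow> carrier R" "(\<lambda>i\<in>B. c i \<oplus>\<^bsub>R\<^esub> c' i) \<in> B \<rightarrow> carrier R"
      using c c' by (auto simp: free_module_simps PiE_iff Pi_iff)
    have "lin_comb R N B b (c \<oplus>\<^bsub>free_module R B\<^esub> c') = finsum N (\<lambda>i. (\<lambda>i\<in>B. c i \<oplus>\<^bsub>R\<^esub> c' i) i \<odot>\<^bsub>N\<^esub> b i) ?C"
      unfolding free_module_simps by (rule ev) (use f m in auto)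
    also have "\<dots> = finsum N (\<lambda>i. c i \<odot>\<^bsub>N\<^esub> b i \<oplus>\<^bsub>N\<^esub> c' i \<odot>\<^bsub>N\<^esub> b i) ?C"
      by (rule M.finsum_cong') (use m b in \<open>auto simp: Pi_iff smult_l_distr\<close>)
    also have "\<dots> = finsum N (\<lambda>i. c i \<odot>\<^bsub>N\<^esub> b i) ?C \<oplus>\<^bsub>N\<^esub> finsum N (\<lambda>i. c' i \<odot>\<^bsub>N\<^esub> b i) ?C"
      by (rule M.finsum_addf) (use m b in \<open>auto simp: Pi_iff\<close>)
    also have "\<dots> = lin_comb R N B b c \<oplus>\<^bsub>N\<^esub> lin_comb R N B b c'"
      using f m by (subst (1 2) ev[of _ ?C]) auto
    finally show "lin_comb R N B b (c \<oplus>\<^bsub>free_module R B\<^esub> c') = lin_comb R N B b c \<oplus>\<^bsub>N\<^esub> lin_comb R N B b c'" .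
  }
  fix a assume a: "a \<in> carrier R"
  have f: "finite ?A" "?A \<subseteq> B" using c by (auto simp: free_module_simps)
  have m: "c \<in> B \<rightarrow> carrier R" "(\<lambda>i\<in>B. a \<otimes>\<^bsub>R\<^esub> c i) \<in> B \<rightarrow> carrier R"
    using c a by (auto simp: free_module_simps PiE_iff Pi_iff)
  have "lin_comb R N B b (a \<odot>\<^bsub>free_module R B\<^esub> c) = finsum N (\<lambda>i. (\<lambda>i\<in>B. a \<otimes>\<^bsub>R\<^esub> c i) i \<odot>\<^bsub>N\<^esub> b i) ?A"
    unfolding free_module_simps by (rule ev) (use f m a in auto)
  also have "\<dots> = finsum N (\<lambda>i. a \<odot>\<^bsub>N\<^esub> (c i \<odot>\<^bsub>N\<^esub> b i)) ?A"
    by (rule M.finsum_cong') (use m b a in \<open>auto simp: Pi_iff smult_assoc1\<close>)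
  also have "\<dots> = a \<odot>\<^bsub>N\<^esub> finsum N (\<lambda>i. c i \<odot>\<^bsub>N\<^esub> b i) ?A"
    by (rule finsum_smult_ldistr[symmetric]) (use f m b a in \<open>auto simp: Pi_iff\<close>)
  finally show "lin_comb R N B b (a \<odot>\<^bsub>free_module R B\<^esub> c) = a \<odot>\<^bsub>N\<^esub> lin_comb R N B b c"
    by (simp add: lin_comb_def)
qed

lemma hom_lin_comb:
  assumes "left_module R M" "left_module R N" "g \<in> lmod_hom R M N" "b \<in> B \<rightarrow> carrier M"
    and c: "c \<in> carrier (free_module R B)"
  shows "g (lin_comb R M B b c) = lin_comb R N B (\<lambda>i. g (b i)) c"
proof -
  interpret M: left_module R M by fact
  interpret N: left_module R N by fact
  have m: "c \<in> B \<rightarrow> carrier R" "finite {i \<in> B. c i \<noteq> \<zero>\<^bsub>R\<^esub>}"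
    using c by (auto simp: free_module_simps)
  have "g (lin_comb R M B b c) = finsum N (\<lambda>i. g (c i \<odot>\<^bsub>M\<^esub> b i)) {i \<in> B. c i \<noteq> \<zero>\<^bsub>R\<^esub>}"
    unfolding lin_comb_def
    by (rule lmod_hom_finsum[OF assms(1-3)]) (use m assms(4) in \<open>auto simp: Pi_iff\<close>)
  also have "\<dots> = lin_comb R N B (\<lambda>i. g (b i)) c"
    unfolding lin_comb_def
    by (rule N.M.finsum_cong') (use m assms(4) lmod_homD[OF assms(3)] in \<open>auto simp: Pi_iff\<close>)
  finally show ?thesis .
qed

lemma projective_lift:
  fixes M :: "('r, 'a) module" and N :: "('r, 'b) module" and P :: "('r, 'p) module"
  assumes P: "projective R P" and M: "left_module R M" and N: "left_module R N"
    and g: "g \<in> lmod_hom R M N" and sur: "g ` carrier M = carrier N" and f: "f \<in> lmod_hom R P N"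
  shows "\<exists>h\<in>lmod_hom R P M. \<forall>x\<in>carrier P. g (h x) = f x"
proof -
  have PM: "left_module R P" using P by (simp add: projective_def)
  interpret P: left_module R P by fact
  let ?B = "carrier P"
  let ?F = "free_module R ?B"
  let ?e = "lin_comb R P ?B (\<lambda>x. x)"
  have F: "left_module R ?F"
    by (intro direct_sum_left_module regular_module_left_module P.R.ring_axioms)
  have e: "?e \<in> lmod_hom R ?F P" by (rule lin_comb_hom[OF PM]) auto
  have "x \<in> ?e ` carrier ?F" if x: "x \<in> ?B" for x
  proof -
    let ?c = "\<lambda>i\<in>?B. if i = x then \<one>\<^bsub>R\<^esub> else \<zero>\<^bsub>R\<^esub>"
    have "{i \<in> ?B. ?c i \<noteq> \<zero>\<^bsub>R\<^esub>} \<subseteq> {x}" by auto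
    then have "finite {i \<in> ?B. ?c i \<noteq> \<zero>\<^bsub>R\<^esub>}" by (rule finite_subset) simp
    then have c: "?c \<in> carrier ?F" unfolding free_module_simps by simp
    have "?e ?c = finsum P (\<lambda>i. ?c i \<odot>\<^bsub>P\<^esub> i) {x}"
      by (rule lin_comb_superset[OF PM]) (use x in auto)
    also have "\<dots> = x" using x by simp
    finally show ?thesis by (rule image_eqI[OF sym c])
  qed
  then have es: "?e ` carrier ?F = carrier P" using lmod_homD(1)[OF e] by blast
  have "(\<lambda>x. x) \<in> lmod_hom R P P" by (rule lmod_homI) auto
  then obtain s where s: "s \<in> lmod_hom R P ?F" "\<And>x. x \<in> carrier P \<Longrightarrow> ?e (s x) = x"
    using P[unfolded projective_def, THEN conjunct2, rule_format, of ?F P ?e "\<lambda>x. x"] F PM e es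
    by blast
  have "\<forall>x\<in>?B. \<exists>y\<in>carrier M. g y = f x" using sur lmod_homD(1)[OF f] by (metis imageE)
  then obtain b where b: "\<And>x. x \<in> ?B \<Longrightarrow> b x \<in> carrier M" "\<And>x. x \<in> ?B \<Longrightarrow> g (b x) = f x"
    by metis
  let ?h = "\<lambda>x. lin_comb R M ?B b (s x)"
  have t: "lin_comb R M ?B b \<in> lmod_hom R ?F M" by (rule lin_comb_hom[OF M]) (use b in auto)
  have hh: "?h \<in> lmod_hom R P M"
    using lmod_homD[OF s(1)] lmod_homD[OF t] by (intro lmod_homI) auto
  have gh: "g (?h x) = f x" if x: "x \<in> ?B" for x
  proof -
    interpret N: left_module R N by fact
    have sx: "s x \<in> carrier ?F" using lmod_homD(1)[OF s(1)] x by blast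
    then have m: "s x \<in> ?B \<rightarrow> carrier R" by (auto simp: free_module_simps)
    have "g (?h x) = lin_comb R N ?B (\<lambda>i. g (b i)) (s x)"
      by (rule hom_lin_comb[OF M N g _ sx]) (use b in auto)
    also have "\<dots> = lin_comb R N ?B f (s x)"
      unfolding lin_comb_def
      by (rule N.M.finsum_cong') (use m b lmod_homD(1)[OF f] in \<open>auto simp: Pi_iff\<close>)
    also have "\<dots> = f (?e (s x))"
      by (rule hom_lin_comb[OF PM N f _ sx, symmetric]) auto
    finally show ?thesis using s(2) x by simp
  qed
  show ?thesis by (intro bexI[OF _ hh] ballI gh)
qed

section \<open>Chain complexes\<close>

record ('r, 'm) cplx =
  ob :: "int \<Rightarrow> ('r, 'm) module"
  bd :: "int \<Rightarrow> 'm \<Rightarrow> 'm"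

definition chain_complex :: "('r, 'z) ring_scheme \<Rightarrow> ('r, 'm) cplx \<Rightarrow> bool" where
  "chain_complex R X \<longleftrightarrow> (\<forall>m. left_module R (ob X m) \<and>
     bd X m \<in> lmod_hom R (ob X m) (ob X (m - 1)) \<and>
     (\<forall>x\<in>carrier (ob X m). bd X (m - 1) (bd X m x) = \<zero>\<^bsub>ob X (m - 2)\<^esub>))"

definition exact_complex :: "('r, 'm) cplx \<Rightarrow> bool" where
  "exact_complex X \<longleftrightarrow>
     (\<forall>m. lmod_kernel (ob X m) (ob X (m - 1)) (bd X m) = bd X (m + 1) ` carrier (ob X (m + 1)))"

definition ex_tilde ::
  "('r, 'z) ring_scheme \<Rightarrow> ('r, 'm) module set \<Rightarrow> ('r, 'm) cplx set" where
  "ex_tilde R \<A> = {X. chain_complex R X \<and> exact_complex X \<and> (\<forall>m. ob X m \<in> \<A>)}"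

definition chain_map ::
  "('r, 'z) ring_scheme \<Rightarrow> ('r, 'a) cplx \<Rightarrow> ('r, 'b) cplx \<Rightarrow> (int \<Rightarrow> 'a \<Rightarrow> 'b) \<Rightarrow> bool" where
  "chain_map R X Y f \<longleftrightarrow> (\<forall>m. f m \<in> lmod_hom R (ob X m) (ob Y m) \<and>
     (\<forall>x\<in>carrier (ob X m). f (m - 1) (bd X m x) = bd Y m (f m x)))"

definition mono_with_cokernel ::
  "('r, 'z) ring_scheme \<Rightarrow> ('r, 'a) cplx \<Rightarrow> (int \<Rightarrow> 'a \<Rightarrow> 'b) \<Rightarrow> ('r, 'b) cplx \<Rightarrow> (int \<Rightarrow> 'b \<Rightarrow> 'c) \<Rightarrow>
   ('r, 'c) cplx \<Rightarrow> bool" where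
  "mono_with_cokernel R X f Y q C \<longleftrightarrow>
     chain_map R X Y f \<and> chain_map R Y C q \<and>
     (\<forall>m. inj_on (f m) (carrier (ob X m)) \<and>
          q m ` carrier (ob Y m) = carrier (ob C m) \<and>
          lmod_kernel (ob Y m) (ob C m) (q m) = f m ` carrier (ob X m))"

section \<open>Filtrations\<close>

text \<open>
  Ordinals are well-orders \<open>r\<close>, elements of \<open>Field r\<close> being the smaller ordinals. A functor
  on \<open>r\<close> to complexes consists of objects \<open>F \<alpha>\<close> and transition maps \<open>t \<alpha> \<beta> : F \<alpha> \<rightarrow> F \<beta>\<close>
  for \<open>(\<alpha>, \<beta>) \<in> r\<close>.
\<close>

definition cplx_functor ::
  "('r, 'z) ring_scheme \<Rightarrow> 'i rel \<Rightarrow> ('i \<Rightarrow> ('r, 'm) cplx) \<Rightarrow> ('i \<Rightarrow> 'i \<Rightarrow> int \<Rightarrow> 'm \<Rightarrow> 'm) \<Rightarrow> bool"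
where
  "cplx_functor R r F t \<longleftrightarrow>
     (\<forall>\<alpha>\<in>Field r. chain_complex R (F \<alpha>)) \<and>
     (\<forall>(\<alpha>, \<beta>)\<in>r. chain_map R (F \<alpha>) (F \<beta>) (t \<alpha> \<beta>)) \<and>
     (\<forall>\<alpha>\<in>Field r. \<forall>m. \<forall>x\<in>carrier (ob (F \<alpha>) m). t \<alpha> \<alpha> m x = x) \<and>
     (\<forall>\<alpha> \<beta> \<gamma>. (\<alpha>, \<beta>) \<in> r \<and> (\<beta>, \<gamma>) \<in> r \<longrightarrow>
        (\<forall>m. \<forall>x\<in>carrier (ob (F \<alpha>) m). t \<beta> \<gamma> m (t \<alpha> \<beta> m x) = t \<alpha> \<gamma> m x))"

definition cocone ::
  "('r, 'z) ring_scheme \<Rightarrow> 'i rel \<Rightarrow> 'i set \<Rightarrow> ('i \<Rightarrow> ('r, 'm) cplx) \<Rightarrow>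
   ('i \<Rightarrow> 'i \<Rightarrow> int \<Rightarrow> 'm \<Rightarrow> 'm) \<Rightarrow> ('r, 'y) cplx \<Rightarrow> ('i \<Rightarrow> int \<Rightarrow> 'm \<Rightarrow> 'y) \<Rightarrow> bool" where
  "cocone R r J F t Y g \<longleftrightarrow>
     (\<forall>\<alpha>\<in>J. chain_map R (F \<alpha>) Y (g \<alpha>)) \<and>
     (\<forall>\<alpha>\<in>J. \<forall>\<beta>\<in>J. (\<alpha>, \<beta>) \<in> r \<longrightarrow>
        (\<forall>m. \<forall>x\<in>carrier (ob (F \<alpha>) m). g \<beta> m (t \<alpha> \<beta> m x) = g \<alpha> m x))"

definition factors_uniquely ::
  "('r, 'z) ring_scheme \<Rightarrow> 'i set \<Rightarrow> ('i \<Rightarrow> ('r, 'm) cplx) \<Rightarrow>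
   ('r, 'l) cplx \<Rightarrow> ('i \<Rightarrow> int \<Rightarrow> 'm \<Rightarrow> 'l) \<Rightarrow> ('r, 'y) cplx \<Rightarrow> ('i \<Rightarrow> int \<Rightarrow> 'm \<Rightarrow> 'y) \<Rightarrow> bool" where
  "factors_uniquely R J F L g Y h \<longleftrightarrow>
     (let fact = (\<lambda>u. chain_map R L Y u \<and>
            (\<forall>\<alpha>\<in>J. \<forall>m. \<forall>x\<in>carrier (ob (F \<alpha>) m). u m (g \<alpha> m x) = h \<alpha> m x))
      in (\<exists>u. fact u) \<and>
         (\<forall>u u'. fact u \<and> fact u' \<longrightarrow> (\<forall>m. \<forall>x\<in>carrier (ob L m). u m x = u' m x)))"

text \<open>
  The colimit of the restriction of a functor to \<open>J \<subseteq> Field r\<close>, by its universal property. Again the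
  type of the test objects \<open>Y\<close> has to be fixed; the type chosen carries the standard construction of
  the colimit as a quotient of the disjoint union. The lemma \<open>is_colimit_universal\<close> below derives
  the universal property with respect to test objects over all types, for nonempty \<open>J\<close>.
\<close>

definition is_colimit ::
  "('r, 'z) ring_scheme \<Rightarrow> 'i rel \<Rightarrow> 'i set \<Rightarrow> ('i \<Rightarrow> ('r, 'm) cplx) \<Rightarrow>
   ('i \<Rightarrow> 'i \<Rightarrow> int \<Rightarrow> 'm \<Rightarrow> 'm) \<Rightarrow> ('r, 'm) cplx \<Rightarrow> ('i \<Rightarrow> int \<Rightarrow> 'm \<Rightarrow> 'm) \<Rightarrow> bool" where
  "is_colimit R r J F t L g \<longleftrightarrow> chain_complex R L \<and> cocone R r J F t L g \<and>
     (\<forall>(Y :: ('r, ('i \<times> 'm) set) cplx) h.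
        chain_complex R Y \<and> cocone R r J F t Y h \<longrightarrow> factors_uniquely R J F L g Y h)"

lemma chain_complexD:
  assumes "chain_complex R X"
  shows "left_module R (ob X m)" "bd X m \<in> lmod_hom R (ob X m) (ob X (m - 1))"
    "x \<in> carrier (ob X m) \<Longrightarrow> bd X (m - 1) (bd X m x) = \<zero>\<^bsub>ob X (m - 2)\<^esub>"
  using assms by (auto simp: chain_complex_def)

lemma chain_mapD:
  assumes "chain_map R X Y f"
  shows "f m \<in> lmod_hom R (ob X m) (ob Y m)"
    "x \<in> carrier (ob X m) \<Longrightarrow> f (m - 1) (bd X m x) = bd Y m (f m x)"
  using assms by (auto simp: chain_map_def)

lemma chain_map_comp:
  assumes f: "chain_map R X Y f" and g: "chain_map R Y Z g" and X: "chain_complex R X"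
  shows "chain_map R X Z (\<lambda>m x. g m (f m x))"
  unfolding chain_map_def
proof (intro allI conjI ballI)
  fix m
  note F = lmod_homD[OF chain_mapD(1)[OF f, of m]]
  note G = lmod_homD[OF chain_mapD(1)[OF g, of m]]
  show "(\<lambda>x. g m (f m x)) \<in> lmod_hom R (ob X m) (ob Z m)"
    by (rule lmod_homI) (use F G in auto)
  fix x assume "x \<in> carrier (ob X m)"
  then show "g (m - 1) (f (m - 1) (bd X m x)) = bd Z m (g m (f m x))"
    using chain_mapD(2)[OF f] chain_mapD(2)[OF g] F(1) by simp
qed

text \<open>A subcomplex with carriers \<open>U m\<close>, transported along maps injective on \<open>U m\<close>.\<close>

definition transport_cplx ::
  "('r, 'y) cplx \<Rightarrow> (int \<Rightarrow> 'y set) \<Rightarrow> (int \<Rightarrow> 'y \<Rightarrow> 'c) \<Rightarrow> ('r, 'c) cplx" where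
  "transport_cplx Y U p =
     \<lparr>ob = (\<lambda>m. let q = inv_into (U m) (p m) in
        \<lparr>carrier = p m ` U m, mult = undefined, one = undefined, zero = p m \<zero>\<^bsub>ob Y m\<^esub>,
         add = (\<lambda>x y. p m (q x \<oplus>\<^bsub>ob Y m\<^esub> q y)), smult = (\<lambda>a x. p m (a \<odot>\<^bsub>ob Y m\<^esub> q x))\<rparr>),
      bd = (\<lambda>m x. p (m - 1) (bd Y m (inv_into (U m) (p m) x)))\<rparr>"

locale transport =
  fixes R :: "('r, 'z) ring_scheme" and Y :: "('r, 'y) cplx" and U :: "int \<Rightarrow> 'y set"
    and p :: "int \<Rightarrow> 'y \<Rightarrow> 'c"
  assumes Y: "chain_complex R Y"
    and sub: "\<And>m x. x \<in> U m \<Longrightarrow> x \<in> carrier (ob Y m)"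
    and zero: "\<And>m. \<zero>\<^bsub>ob Y m\<^esub> \<in> U m"
    and add: "\<And>m x y. x \<in> U m \<Longrightarrow> y \<in> U m \<Longrightarrow> x \<oplus>\<^bsub>ob Y m\<^esub> y \<in> U m"
    and smult: "\<And>m a x. a \<in> carrier R \<Longrightarrow> x \<in> U m \<Longrightarrow> a \<odot>\<^bsub>ob Y m\<^esub> x \<in> U m"
    and bd: "\<And>m x. x \<in> U m \<Longrightarrow> bd Y m x \<in> U (m - 1)"
    and inj: "\<And>m. inj_on (p m) (U m)"
begin

abbreviation "T \<equiv> transport_cplx Y U p"

lemma q [simp]: "x \<in> U m \<Longrightarrow> inv_into (U m) (p m) (p m x) = x"
  using inj by (rule inv_into_f_f)

lemma T_simps:
  "carrier (ob T m) = p m ` U m" "\<zero>\<^bsub>ob T m\<^esub> = p m \<zero>\<^bsub>ob Y m\<^esub>"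
  "x \<in> U m \<Longrightarrow> y \<in> U m \<Longrightarrow> p m x \<oplus>\<^bsub>ob T m\<^esub> p m y = p m (x \<oplus>\<^bsub>ob Y m\<^esub> y)"
  "x \<in> U m \<Longrightarrow> a \<odot>\<^bsub>ob T m\<^esub> p m x = p m (a \<odot>\<^bsub>ob Y m\<^esub> x)"
  "x \<in> U m \<Longrightarrow> bd T m (p m x) = p (m - 1) (bd Y m x)"
  by (auto simp: transport_cplx_def Let_def)

lemma T_complex: "chain_complex R T"
  unfolding chain_complex_def
proof (intro allI conjI ballI)
  fix m
  interpret left_module R "ob Y m" using chain_complexD(1)[OF Y] .
  have "abelian_group (ob T m)"
  proof (rule abelian_groupI)
    fix x assume "x \<in> carrier (ob T m)"
    then obtain u where u: "u \<in> U m" "x = p m u" by (auto simp: T_simps)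
    let ?v = "\<ominus>\<^bsub>R\<^esub> \<one>\<^bsub>R\<^esub> \<odot>\<^bsub>ob Y m\<^esub> u"
    have v: "?v \<in> U m" using u smult by simp
    have "?v \<oplus>\<^bsub>ob Y m\<^esub> u = (\<ominus>\<^bsub>R\<^esub> \<one>\<^bsub>R\<^esub> \<oplus>\<^bsub>R\<^esub> \<one>\<^bsub>R\<^esub>) \<odot>\<^bsub>ob Y m\<^esub> u"
      using sub[OF u(1)] by (subst smult_l_distr) auto
    then have "?v \<oplus>\<^bsub>ob Y m\<^esub> u = \<zero>\<^bsub>ob Y m\<^esub>" using sub[OF u(1)] by (simp add: R.l_neg)
    then show "\<exists>y\<in>carrier (ob T m). y \<oplus>\<^bsub>ob T m\<^esub> x = \<zero>\<^bsub>ob T m\<^esub>"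
      using u v by (intro bexI[of _ "p m ?v"]) (auto simp: T_simps)
  qed (use zero add sub in \<open>auto simp: T_simps M.a_ac\<close>)
  then show "left_module R (ob T m)"
    by (intro left_moduleI[OF R.ring_axioms])
       (use add smult sub in \<open>auto simp: T_simps smult_l_distr smult_r_distr smult_assoc1\<close>)
  note B = lmod_homD[OF chain_complexD(2)[OF Y, of m]]
  show "bd T m \<in> lmod_hom R (ob T m) (ob T (m - 1))"
    by (rule lmod_homI) (use B add smult bd sub in \<open>auto simp: T_simps\<close>)
  fix x assume "x \<in> carrier (ob T m)"
  then obtain u where u: "u \<in> U m" "x = p m u" by (auto simp: T_simps)
  have "bd T (m - 1) (bd T m x) = p (m - 1 - 1) (bd Y (m - 1) (bd Y m u))"
    using u bd by (simp only: T_simps)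
  also have "\<dots> = \<zero>\<^bsub>ob T (m - 2)\<^esub>"
    using chain_complexD(3)[OF Y sub[OF u(1)]] by (simp add: T_simps)
  finally show "bd T (m - 1) (bd T m x) = \<zero>\<^bsub>ob T (m - 2)\<^esub>" .
qed

lemma into_T:
  assumes f: "chain_map R Z Y f" and Z: "chain_complex R Z"
    and U: "\<And>m x. x \<in> carrier (ob Z m) \<Longrightarrow> f m x \<in> U m"
  shows "chain_map R Z T (\<lambda>m x. p m (f m x))"
  unfolding chain_map_def
proof (intro allI conjI ballI)
  fix m
  note F = lmod_homD[OF chain_mapD(1)[OF f, of m]]
  show "(\<lambda>x. p m (f m x)) \<in> lmod_hom R (ob Z m) (ob T m)"
    by (rule lmod_homI) (use F U in \<open>auto simp: T_simps\<close>)
  fix x assume x: "x \<in> carrier (ob Z m)"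
  show "p (m - 1) (f (m - 1) (bd Z m x)) = bd T m (p m (f m x))"
    using chain_mapD(2)[OF f x] U[OF x] by (simp add: T_simps)
qed

lemma from_T: "chain_map R T Y (\<lambda>m. inv_into (U m) (p m))"
  unfolding chain_map_def
proof (intro allI conjI ballI)
  fix m
  show "inv_into (U m) (p m) \<in> lmod_hom R (ob T m) (ob Y m)"
    by (rule lmod_homI) (use add smult sub in \<open>auto simp: T_simps\<close>)
  fix x assume "x \<in> carrier (ob T m)"
  then show "inv_into (U (m - 1)) (p (m - 1)) (bd T m x) = bd Y m (inv_into (U m) (p m) x)"
    using bd by (auto simp: T_simps)
qed

end

lemma chain_map_diff:
  assumes f: "chain_map R X Y f" and g: "chain_map R X Y g" and X: "chain_complex R X"
    and Y: "chain_complex R Y"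
  shows "chain_map R X Y (\<lambda>m x. f m x \<oplus>\<^bsub>ob Y m\<^esub> (\<ominus>\<^bsub>R\<^esub> \<one>\<^bsub>R\<^esub>) \<odot>\<^bsub>ob Y m\<^esub> g m x)"
  unfolding chain_map_def
proof (intro allI conjI ballI)
  fix m
  interpret left_module R "ob Y m" using chain_complexD(1)[OF Y] .
  note F = lmod_homD[OF chain_mapD(1)[OF f, of m]]
  note G = lmod_homD[OF chain_mapD(1)[OF g, of m]]
  let ?e = "\<ominus>\<^bsub>R\<^esub> \<one>\<^bsub>R\<^esub>"
  have e: "?e \<in> carrier R" by simp
  show "(\<lambda>x. f m x \<oplus>\<^bsub>ob Y m\<^esub> ?e \<odot>\<^bsub>ob Y m\<^esub> g m x) \<in> lmod_hom R (ob X m) (ob Y m)"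
  proof (rule lmod_homI)
    fix x y assume h: "x \<in> carrier (ob X m)" "y \<in> carrier (ob X m)"
    show "f m (x \<oplus>\<^bsub>ob X m\<^esub> y) \<oplus>\<^bsub>ob Y m\<^esub> ?e \<odot>\<^bsub>ob Y m\<^esub> g m (x \<oplus>\<^bsub>ob X m\<^esub> y) =
      f m x \<oplus>\<^bsub>ob Y m\<^esub> ?e \<odot>\<^bsub>ob Y m\<^esub> g m x \<oplus>\<^bsub>ob Y m\<^esub> (f m y \<oplus>\<^bsub>ob Y m\<^esub> ?e \<odot>\<^bsub>ob Y m\<^esub> g m y)"
      using h F G e by (simp add: smult_r_distr M.a_ac)
  next
    fix a x assume h: "a \<in> carrier R" "x \<in> carrier (ob X m)"
    have "?e \<odot>\<^bsub>ob Y m\<^esub> (a \<odot>\<^bsub>ob Y m\<^esub> g m x) = a \<odot>\<^bsub>ob Y m\<^esub> (?e \<odot>\<^bsub>ob Y m\<^esub> g m x)"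
      using h G(1)[OF h(2)] e by (simp add: smult_assoc1[symmetric] R.l_minus R.r_minus)
    then show "f m (a \<odot>\<^bsub>ob X m\<^esub> x) \<oplus>\<^bsub>ob Y m\<^esub> ?e \<odot>\<^bsub>ob Y m\<^esub> g m (a \<odot>\<^bsub>ob X m\<^esub> x) =
      a \<odot>\<^bsub>ob Y m\<^esub> (f m x \<oplus>\<^bsub>ob Y m\<^esub> ?e \<odot>\<^bsub>ob Y m\<^esub> g m x)"
      using h F G e by (simp add: smult_r_distr)
  qed (use F G e in auto)
  fix x assume x: "x \<in> carrier (ob X m)"
  note B = lmod_homD[OF chain_complexD(2)[OF Y, of m]]
  show "f (m - 1) (bd X m x) \<oplus>\<^bsub>ob Y (m - 1)\<^esub> ?e \<odot>\<^bsub>ob Y (m - 1)\<^esub> g (m - 1) (bd X m x) =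
    bd Y m (f m x \<oplus>\<^bsub>ob Y m\<^esub> ?e \<odot>\<^bsub>ob Y m\<^esub> g m x)"
    using chain_mapD(2)[OF f x] chain_mapD(2)[OF g x] B F(1)[OF x] G(1)[OF x] e by simp
qed

lemma (in left_module) diff_eq_zero_iff:
  assumes "x \<in> carrier M" "y \<in> carrier M"
  shows "x \<oplus>\<^bsub>M\<^esub> (\<ominus>\<^bsub>R\<^esub> \<one>\<^bsub>R\<^esub>) \<odot>\<^bsub>M\<^esub> y = \<zero>\<^bsub>M\<^esub> \<longleftrightarrow> x = y"
proof -
  have "(\<ominus>\<^bsub>R\<^esub> \<one>\<^bsub>R\<^esub>) \<odot>\<^bsub>M\<^esub> y \<oplus>\<^bsub>M\<^esub> y = (\<ominus>\<^bsub>R\<^esub> \<one>\<^bsub>R\<^esub> \<oplus>\<^bsub>R\<^esub> \<one>\<^bsub>R\<^esub>) \<odot>\<^bsub>M\<^esub> y"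
    using assms by (subst smult_l_distr) auto
  then have *: "(\<ominus>\<^bsub>R\<^esub> \<one>\<^bsub>R\<^esub>) \<odot>\<^bsub>M\<^esub> y \<oplus>\<^bsub>M\<^esub> y = \<zero>\<^bsub>M\<^esub>" using assms by (simp add: R.l_neg)
  then have "(\<ominus>\<^bsub>R\<^esub> \<one>\<^bsub>R\<^esub>) \<odot>\<^bsub>M\<^esub> y = \<ominus>\<^bsub>M\<^esub> y"
    using assms M.minus_equality by simp
  then show ?thesis using assms by (metis M.a_inv_closed M.minus_equality M.minus_minus M.r_neg)
qed

lemma factors_uniquelyD:
  assumes "factors_uniquely R J F L g Y h"
  shows "\<exists>u. chain_map R L Y u \<and>
      (\<forall>\<alpha>\<in>J. \<forall>m. \<forall>x\<in>carrier (ob (F \<alpha>) m). u m (g \<alpha> m x) = h \<alpha> m x)"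
    and "chain_map R L Y u \<Longrightarrow>
      \<forall>\<alpha>\<in>J. \<forall>m. \<forall>x\<in>carrier (ob (F \<alpha>) m). u m (g \<alpha> m x) = h \<alpha> m x \<Longrightarrow>
      chain_map R L Y u' \<Longrightarrow>
      \<forall>\<alpha>\<in>J. \<forall>m. \<forall>x\<in>carrier (ob (F \<alpha>) m). u' m (g \<alpha> m x) = h \<alpha> m x \<Longrightarrow>
      x \<in> carrier (ob L m) \<Longrightarrow> u m x = u' m x"
proof -
  note * = assms[unfolded factors_uniquely_def Let_def]
  show "\<exists>u. chain_map R L Y u \<and>
      (\<forall>\<alpha>\<in>J. \<forall>m. \<forall>x\<in>carrier (ob (F \<alpha>) m). u m (g \<alpha> m x) = h \<alpha> m x)"
    by (rule conjunct1[OF *])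
  assume "chain_map R L Y u" "\<forall>\<alpha>\<in>J. \<forall>m. \<forall>x\<in>carrier (ob (F \<alpha>) m). u m (g \<alpha> m x) = h \<alpha> m x"
    and "chain_map R L Y u'" "\<forall>\<alpha>\<in>J. \<forall>m. \<forall>x\<in>carrier (ob (F \<alpha>) m). u' m (g \<alpha> m x) = h \<alpha> m x"
    and x: "x \<in> carrier (ob L m)"
  then have "\<forall>m. \<forall>x\<in>carrier (ob L m). u m x = u' m x"
    by (intro conjunct2[OF *, THEN spec, THEN spec, THEN mp] conjI)
  with x show "u m x = u' m x" by blast
qed

lemma is_colimit_universal:
  fixes F :: "'i \<Rightarrow> ('r, 'm) cplx" and Y :: "('r, 'y) cplx"
  assumes r: "Well_order r" and J: "J \<subseteq> Field r" "J \<noteq> {}" and Fu: "cplx_functor R r F t"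
    and col: "is_colimit R r J F t L g"
    and Y: "chain_complex R Y" and h: "cocone R r J F t Y h"
  shows "factors_uniquely R J F L g Y h"
proof -
  have L: "chain_complex R L" and g: "\<And>\<alpha>. \<alpha> \<in> J \<Longrightarrow> chain_map R (F \<alpha>) L (g \<alpha>)"
    using col by (auto simp: is_colimit_def cocone_def)
  have up: "\<And>(Z :: ('r, ('i \<times> 'm) set) cplx) k. chain_complex R Z \<Longrightarrow> cocone R r J F t Z k \<Longrightarrow>
      factors_uniquely R J F L g Z k"
    using col by (auto simp: is_colimit_def)
  have Fc: "chain_complex R (F \<alpha>)" if "\<alpha> \<in> J" for \<alpha>
    using Fu J that by (auto simp: cplx_functor_def)
  have hm: "\<And>\<alpha>. \<alpha> \<in> J \<Longrightarrow> chain_map R (F \<alpha>) Y (h \<alpha>)"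
    and hc: "\<And>\<alpha> \<beta> m x. \<alpha> \<in> J \<Longrightarrow> \<beta> \<in> J \<Longrightarrow> (\<alpha>, \<beta>) \<in> r \<Longrightarrow> x \<in> carrier (ob (F \<alpha>) m) \<Longrightarrow>
      h \<beta> m (t \<alpha> \<beta> m x) = h \<alpha> m x"
    using h by (auto simp: cocone_def)
  have tm: "t \<alpha> \<beta> m x \<in> carrier (ob (F \<beta>) m)" if "(\<alpha>, \<beta>) \<in> r" "x \<in> carrier (ob (F \<alpha>) m)" for \<alpha> \<beta> m x
  proof -
    have "chain_map R (F \<alpha>) (F \<beta>) (t \<alpha> \<beta>)" using Fu that(1) by (auto simp: cplx_functor_def)
    then show ?thesis using lmod_homD(1) chain_mapD(1) that(2) by fast
  qed
  have hh: "h \<alpha> m x \<in> carrier (ob Y m)" "a \<in> carrier R \<Longrightarrow> h \<alpha> m (a \<odot>\<^bsub>ob (F \<alpha>) m\<^esub> x) = a \<odot>\<^bsub>ob Y m\<^esub> h \<alpha> m x"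
    "y \<in> carrier (ob (F \<alpha>) m) \<Longrightarrow> h \<alpha> m (x \<oplus>\<^bsub>ob (F \<alpha>) m\<^esub> y) = h \<alpha> m x \<oplus>\<^bsub>ob Y m\<^esub> h \<alpha> m y"
    if "\<alpha> \<in> J" "x \<in> carrier (ob (F \<alpha>) m)" for \<alpha> m x y a
    using lmod_homD[OF chain_mapD(1)[OF hm[OF that(1)], of m]] that(2) by blast+
  obtain \<alpha>0 where \<alpha>0: "\<alpha>0 \<in> J" using J by blast
  define U where "U m = (\<Union>\<alpha>\<in>J. h \<alpha> m ` carrier (ob (F \<alpha>) m))" for m
  define p where "p m y = {(\<alpha>, x). \<alpha> \<in> J \<and> x \<in> carrier (ob (F \<alpha>) m) \<and> h \<alpha> m x = y}" for m y
  have UI: "\<alpha> \<in> J \<Longrightarrow> x \<in> carrier (ob (F \<alpha>) m) \<Longrightarrow> h \<alpha> m x \<in> U m" for \<alpha> x m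
    by (auto simp: U_def)
  have "transport R Y U p"
  proof
    show "chain_complex R Y" by fact
  next
    fix m x assume "x \<in> U m" then show "x \<in> carrier (ob Y m)" using hh(1) by (auto simp: U_def)
  next
    fix m
    have l: "left_module R (ob (F \<alpha>0) m)" "left_module R (ob Y m)"
      using chain_complexD(1) Fc[OF \<alpha>0] Y by auto
    then have "\<zero>\<^bsub>ob (F \<alpha>0) m\<^esub> \<in> carrier (ob (F \<alpha>0) m)"
      by (meson abelian_group.axioms(1) abelian_monoid.zero_closed left_module.axioms(2))
    then show "\<zero>\<^bsub>ob Y m\<^esub> \<in> U m"
      using UI[OF \<alpha>0, of "\<zero>\<^bsub>ob (F \<alpha>0) m\<^esub>" m]
        lmod_hom_zero[OF l chain_mapD(1)[OF hm[OF \<alpha>0]]] by simp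
  next
    fix m x y assume "x \<in> U m" "y \<in> U m"
    then obtain \<alpha> a \<beta> b where *: "\<alpha> \<in> J" "a \<in> carrier (ob (F \<alpha>) m)" "x = h \<alpha> m a"
      "\<beta> \<in> J" "b \<in> carrier (ob (F \<beta>) m)" "y = h \<beta> m b" by (auto simp: U_def)
    have "\<exists>\<gamma>\<in>J. (\<alpha>, \<gamma>) \<in> r \<and> (\<beta>, \<gamma>) \<in> r"
    proof -
      have "(\<alpha>, \<alpha>) \<in> r" "(\<beta>, \<beta>) \<in> r" "(\<alpha>, \<beta>) \<in> r \<or> (\<beta>, \<alpha>) \<in> r"
        using r J(1) *(1,4) wo_rel.REFL[of r] wo_rel.TOTALS[of r]
        by (auto simp: wo_rel_def refl_on_def)
      then show ?thesis using *(1,4) by blast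
    qed
    then obtain \<gamma> where \<gamma>: "\<gamma> \<in> J" "(\<alpha>, \<gamma>) \<in> r" "(\<beta>, \<gamma>) \<in> r" by blast
    let ?a = "t \<alpha> \<gamma> m a" and ?b = "t \<beta> \<gamma> m b"
    have ab: "?a \<in> carrier (ob (F \<gamma>) m)" "?b \<in> carrier (ob (F \<gamma>) m)" using tm \<gamma> * by auto
    interpret G: left_module R "ob (F \<gamma>) m" using chain_complexD(1)[OF Fc[OF \<gamma>(1)]] .
    have "x \<oplus>\<^bsub>ob Y m\<^esub> y = h \<gamma> m (?a \<oplus>\<^bsub>ob (F \<gamma>) m\<^esub> ?b)"
      using hh(3)[OF \<gamma>(1) ab] hc * \<gamma> by simp
    then show "x \<oplus>\<^bsub>ob Y m\<^esub> y \<in> U m" using UI[OF \<gamma>(1)] ab by simp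
  next
    fix m a x assume a: "a \<in> carrier R" and "x \<in> U m"
    then obtain \<alpha> b where *: "\<alpha> \<in> J" "b \<in> carrier (ob (F \<alpha>) m)" "x = h \<alpha> m b" by (auto simp: U_def)
    interpret G: left_module R "ob (F \<alpha>) m" using chain_complexD(1)[OF Fc[OF *(1)]] .
    show "a \<odot>\<^bsub>ob Y m\<^esub> x \<in> U m"
      using hh(2)[OF *(1,2) a] UI[OF *(1) G.smult_closed[OF a *(2)]] *(3) by simp
  next
    fix m x assume "x \<in> U m"
    then obtain \<alpha> b where *: "\<alpha> \<in> J" "b \<in> carrier (ob (F \<alpha>) m)" "x = h \<alpha> m b" by (auto simp: U_def)
    show "bd Y m x \<in> U (m - 1)"
      using chain_mapD(2)[OF hm[OF *(1)] *(2)] *(3)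
        UI[OF *(1) lmod_homD(1)[OF chain_complexD(2)[OF Fc[OF *(1)]] *(2)]] by simp
  next
    fix m
    show "inj_on (p m) (U m)"
    proof (rule inj_onI)
      fix x y assume "x \<in> U m" and eq: "p m x = p m y"
      then obtain \<alpha> a where "\<alpha> \<in> J" "a \<in> carrier (ob (F \<alpha>) m)" "h \<alpha> m a = x"
        by (auto simp: U_def)
      then have "(\<alpha>, a) \<in> p m x" by (simp add: p_def)
      then show "x = y" unfolding eq by (simp add: p_def \<open>h \<alpha> m a = x\<close>)
    qed
  qed
  then interpret T: transport R Y U p .
  have "cocone R r J F t T.T (\<lambda>\<alpha> m x. p m (h \<alpha> m x))"
    unfolding cocone_def using T.into_T[OF hm Fc UI] hc by auto
  from factors_uniquelyD(1)[OF up[OF T.T_complex this]]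
  obtain u where u1: "chain_map R L T.T u \<and>
      (\<forall>\<alpha>\<in>J. \<forall>m. \<forall>x\<in>carrier (ob (F \<alpha>) m). u m (g \<alpha> m x) = p m (h \<alpha> m x))" ..
  then have u: "chain_map R L T.T u"
    "\<And>\<alpha> m x. \<alpha> \<in> J \<Longrightarrow> x \<in> carrier (ob (F \<alpha>) m) \<Longrightarrow> u m (g \<alpha> m x) = p m (h \<alpha> m x)"
    by simp_all
  let ?w = "\<lambda>m x. inv_into (U m) (p m) (u m x)"
  have ex: "chain_map R L Y ?w"
    by (rule chain_map_comp[OF u(1) T.from_T L])
  have ex': "?w m (g \<alpha> m x) = h \<alpha> m x" if "\<alpha> \<in> J" "x \<in> carrier (ob (F \<alpha>) m)" for \<alpha> m x
    using u(2)[OF that] T.q[OF UI[OF that]] by simp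
  have uniq: "v m x = v' m x"
    if v: "chain_map R L Y v" "\<And>\<alpha> m x. \<alpha> \<in> J \<Longrightarrow> x \<in> carrier (ob (F \<alpha>) m) \<Longrightarrow> v m (g \<alpha> m x) = h \<alpha> m x"
      and v': "chain_map R L Y v'" "\<And>\<alpha> m x. \<alpha> \<in> J \<Longrightarrow> x \<in> carrier (ob (F \<alpha>) m) \<Longrightarrow> v' m (g \<alpha> m x) = h \<alpha> m x"
      and x: "x \<in> carrier (ob L m)" for v v' m x
  proof -
    define d where "d m x = v m x \<oplus>\<^bsub>ob Y m\<^esub> (\<ominus>\<^bsub>R\<^esub> \<one>\<^bsub>R\<^esub>) \<odot>\<^bsub>ob Y m\<^esub> v' m x" for m x
    have d: "chain_map R L Y d"
      unfolding d_def by (rule chain_map_diff[OF v(1) v'(1) L Y])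
    note dh = lmod_homD[OF chain_mapD(1)[OF d]]
    have d0: "d m (g \<alpha> m x) = \<zero>\<^bsub>ob Y m\<^esub>" if "\<alpha> \<in> J" "x \<in> carrier (ob (F \<alpha>) m)" for \<alpha> m x
    proof -
      interpret left_module R "ob Y m" using chain_complexD(1)[OF Y] .
      have "v m (g \<alpha> m x) = h \<alpha> m x" "v' m (g \<alpha> m x) = h \<alpha> m x" "h \<alpha> m x \<in> carrier (ob Y m)"
        using v(2)[OF that] v'(2)[OF that] hh(1)[OF that] by auto
      then show ?thesis unfolding d_def using diff_eq_zero_iff by simp
    qed
    define V where "V m = d m ` carrier (ob L m)" for m
    define s where "s m y = {(\<alpha>, x). \<alpha> = \<alpha>0 \<and> x \<in> carrier (ob L m) \<and> d m x = y}" for m y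
    have VI: "x \<in> carrier (ob L m) \<Longrightarrow> d m x \<in> V m" for x m by (auto simp: V_def)
    have "transport R Y V s"
    proof
      show "chain_complex R Y" by fact
    next
      fix m x assume "x \<in> V m" then show "x \<in> carrier (ob Y m)" using dh(1) by (auto simp: V_def)
    next
      fix m
      have l: "left_module R (ob L m)" "left_module R (ob Y m)"
        using chain_complexD(1) L Y by auto
      then have "\<zero>\<^bsub>ob L m\<^esub> \<in> carrier (ob L m)"
        by (meson abelian_group.axioms(1) abelian_monoid.zero_closed left_module.axioms(2))
      then show "\<zero>\<^bsub>ob Y m\<^esub> \<in> V m"
        using VI[of "\<zero>\<^bsub>ob L m\<^esub>" m] lmod_hom_zero[OF l chain_mapD(1)[OF d]] by simp
    next
      fix m x y assume "x \<in> V m" "y \<in> V m"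
      then obtain a b where *: "a \<in> carrier (ob L m)" "x = d m a" "b \<in> carrier (ob L m)" "y = d m b"
        by (auto simp: V_def)
      interpret G: left_module R "ob L m" using chain_complexD(1)[OF L] .
      show "x \<oplus>\<^bsub>ob Y m\<^esub> y \<in> V m"
        using dh(2)[OF *(1,3)] VI[of "a \<oplus>\<^bsub>ob L m\<^esub> b" m] * by simp
    next
      fix m a x assume a: "a \<in> carrier R" and "x \<in> V m"
      then obtain b where *: "b \<in> carrier (ob L m)" "x = d m b" by (auto simp: V_def)
      interpret G: left_module R "ob L m" using chain_complexD(1)[OF L] .
      show "a \<odot>\<^bsub>ob Y m\<^esub> x \<in> V m"
        using dh(3)[OF a *(1)] VI[OF G.smult_closed[OF a *(1)]] *(2) by simp
    next
      fix m x assume "x \<in> V m"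
      then obtain b where *: "b \<in> carrier (ob L m)" "x = d m b" by (auto simp: V_def)
      show "bd Y m x \<in> V (m - 1)"
        using chain_mapD(2)[OF d *(1)] *(2) VI[OF lmod_homD(1)[OF chain_complexD(2)[OF L] *(1)]]
        by simp
    next
      fix m
      show "inj_on (s m) (V m)"
      proof (rule inj_onI)
        fix x y assume "x \<in> V m" and eq: "s m x = s m y"
        then obtain a where "a \<in> carrier (ob L m)" "d m a = x" by (auto simp: V_def)
        then have "(\<alpha>0, a) \<in> s m x" by (simp add: s_def)
        then show "x = y" unfolding eq by (simp add: s_def \<open>d m a = x\<close>)
      qed
    qed
    then interpret S: transport R Y V s .
    have zm: "chain_map R L Y (\<lambda>m x. \<zero>\<^bsub>ob Y m\<^esub>)"
      unfolding chain_map_def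
    proof (intro allI conjI ballI)
      fix m
      interpret A: left_module R "ob Y m" using chain_complexD(1)[OF Y] .
      show "(\<lambda>x. \<zero>\<^bsub>ob Y m\<^esub>) \<in> lmod_hom R (ob L m) (ob Y m)" by (rule lmod_homI) auto
      show "\<zero>\<^bsub>ob Y (m - 1)\<^esub> = bd Y m \<zero>\<^bsub>ob Y m\<^esub>"
        using lmod_hom_zero[OF chain_complexD(1)[OF Y] chain_complexD(1)[OF Y] chain_complexD(2)[OF Y]]
        by (rule sym)
    qed
    have sd: "chain_map R L S.T (\<lambda>m x. s m (d m x))"
      by (rule S.into_T[OF d L VI])
    have sz: "chain_map R L S.T (\<lambda>m x. s m \<zero>\<^bsub>ob Y m\<^esub>)"
      by (rule S.into_T[OF zm L S.zero])
    have "cocone R r J F t S.T (\<lambda>\<alpha> m x. s m \<zero>\<^bsub>ob Y m\<^esub>)"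
      unfolding cocone_def using chain_map_comp[OF g sz Fc] by auto
    note eq = factors_uniquelyD(2)[OF up[OF S.T_complex this]]
    have "s m (d m x) = s m \<zero>\<^bsub>ob Y m\<^esub>"
      by (rule eq[OF sd _ sz _ x]) (simp_all add: d0)
    then have "d m x = \<zero>\<^bsub>ob Y m\<^esub>"
      using inj_onD[OF S.inj _ VI[OF x] S.zero] by blast
    moreover have "v m x \<in> carrier (ob Y m)" "v' m x \<in> carrier (ob Y m)"
      using lmod_homD(1)[OF chain_mapD(1)[OF v(1)] x] lmod_homD(1)[OF chain_mapD(1)[OF v'(1)] x] by auto
    ultimately show ?thesis
      unfolding d_def using left_module.diff_eq_zero_iff[OF chain_complexD(1)[OF Y]] by blast
  qed
  show ?thesis unfolding factors_uniquely_def Let_def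
  proof (intro conjI allI impI ballI)
    show "\<exists>u. chain_map R L Y u \<and>
        (\<forall>\<alpha>\<in>J. \<forall>m. \<forall>x\<in>carrier (ob (F \<alpha>) m). u m (g \<alpha> m x) = h \<alpha> m x)"
      using ex ex' by (intro exI[of _ ?w]) auto
  next
    fix v v' m x
    let ?P = "\<lambda>v. chain_map R L Y v \<and>
        (\<forall>\<alpha>\<in>J. \<forall>m. \<forall>x\<in>carrier (ob (F \<alpha>) m). v m (g \<alpha> m x) = h \<alpha> m x)"
    assume a: "?P v \<and> ?P v'" and x: "x \<in> carrier (ob L m)"
    show "v m x = v' m x"
      by (rule uniq[OF _ _ _ _ x]) (use a in simp_all)
  qed
qed

definition succ_in :: "'i rel \<Rightarrow> 'i \<Rightarrow> 'i \<Rightarrow> bool" where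
  "succ_in r \<alpha> \<beta> \<longleftrightarrow> \<alpha> \<in> Field r \<and> \<beta> \<in> Field r \<and> underS r \<beta> = under r \<alpha>"

definition limit_in :: "'i rel \<Rightarrow> 'i \<Rightarrow> bool" where
  "limit_in r \<beta> \<longleftrightarrow> \<beta> \<in> Field r \<and> underS r \<beta> \<noteq> {} \<and> \<not> (\<exists>\<alpha>. succ_in r \<alpha> \<beta>)"

definition is_filtration ::
  "('r, 'z) ring_scheme \<Rightarrow> ('r, 'm) cplx set \<Rightarrow> ('r, 'm) cplx \<Rightarrow> 'i rel \<Rightarrow> ('i \<Rightarrow> ('r, 'm) cplx) \<Rightarrow>
   ('i \<Rightarrow> 'i \<Rightarrow> int \<Rightarrow> 'm \<Rightarrow> 'm) \<Rightarrow> ('i \<Rightarrow> int \<Rightarrow> 'm \<Rightarrow> 'm) \<Rightarrow> bool" where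
  "is_filtration R \<S> X r F t g \<longleftrightarrow>
     Well_order r \<and> Field r \<noteq> {} \<and> cplx_functor R r F t \<and>
     (\<forall>\<beta>. limit_in r \<beta> \<longrightarrow> is_colimit R r (underS r \<beta>) F t (F \<beta>) (\<lambda>\<alpha>. t \<alpha> \<beta>)) \<and>
     is_colimit R r (Field r) F t X g \<and>
     (\<forall>\<alpha>\<in>Field r. underS r \<alpha> = {} \<longrightarrow> F \<alpha> \<in> \<S>) \<and>
     (\<forall>\<alpha> \<beta>. succ_in r \<alpha> \<beta> \<longrightarrow> (\<exists>C\<in>\<S>. \<exists>q. mono_with_cokernel R (F \<alpha>) (t \<alpha> \<beta>) (F \<beta>) q C))"

text \<open>
  The length of the filtration is an ordinal of cardinality at most that of the type \<^typ>\<open>int \<times> 'm\<close>.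
  For a complex over \<open>'m\<close> this is enough: distinct indices \<open>\<alpha>\<close> whose map to the successor
  is not onto contribute distinct elements to the disjoint union of the modules of the complex.
\<close>

definition has_filtration ::
  "('r, 'z) ring_scheme \<Rightarrow> ('r, 'm) cplx set \<Rightarrow> ('r, 'm) cplx \<Rightarrow> bool" where
  "has_filtration R \<S> X \<longleftrightarrow> (\<exists>(r :: (int \<times> 'm) rel) F t g. is_filtration R \<S> X r F t g)"

end

theory Submission
  imports Defs
begin

text \<open>
  Since \<open>n > 0\<close>, the Eilenberg swindle replaces the projective resolutions of the modules \<open>X\<^sub>m\<close> by free
  resolutions \<open>F\<^bsub>m,n\<^esub> \<rightarrow> \<dots> \<rightarrow> F\<^bsub>m,0\<^esub> \<rightarrow> X\<^sub>m\<close> of the same length. A family \<open>S\<close> of subsets of their bases is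
  called good if its spans intersect the image of every differential of the resolutions in the image of
  the span one degree higher, and likewise for the images \<open>Y S\<close> of the spans in \<open>X\<close> and the
  differential of \<open>X\<close>. For good \<open>S \<subseteq> S'\<close> the complex \<open>Y S' / Y S\<close> is then exact, and
  its modules are resolved by the free modules on the families of basis elements in \<open>S' - S\<close>. Good
  families are closed under unions of chains, and closing up under witnesses modulo \<open>S\<close> enlarges a good
  \<open>S\<close> by at most \<open>\<kappa>\<close> basis elements to a good family whose span reaches a prescribed element of \<open>X\<close>.
  Transfinite recursion along a well-order of the elements of \<open>X\<close> gives the filtration.
\<close>

section \<open>Left modules and finitely supported functions\<close>

text \<open>Free modules are wanted because their bases make complements canonical: for good
  \<open>S\<close> inside \<open>S'\<close> the span of \<open>S'\<close> modulo the span of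
  \<open>S\<close> is read off in the coordinates \<open>S' - S\<close>, and every summand of the
  new resolutions is a copy of \<open>R\<close>. A projective module has no such coordinates; the
  swindle supplies them and thereby takes the place of Kaplansky's theorem on direct sums of
  countably generated projectives. The obstacle is size. Along the filtration \<open>S\<close> may
  outgrow \<kappa>, while each step may add only \<kappa> basis elements, so the elements of the
  span of \<open>S\<close> cannot each be given a fresh witness. What helps is that all conditions
  are relations closed under differences: two witnesses for elements of one coset of the span of
  \<open>S\<close> differ by a witness for an element of that span, and goodness of \<open>S\<close>
  replaces this difference by one inside the span. One witness per coset is enough, and the bound on
  \<open>R\<close> limits how many are called for. The differential of \<open>X\<close> is not
  lifted to maps between the resolutions; a relation between representatives takes its
  place.\<close>

lemma left_module_restrict:
  assumes "left_module R M" "H \<subseteq> carrier M" "\<zero>\<^bsub>M\<^esub> \<in> H"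
    and add: "\<And>x y. x \<in> H \<Longrightarrow> y \<in> H \<Longrightarrow> x \<oplus>\<^bsub>M\<^esub> y \<in> H"
    and smult: "\<And>a x. a \<in> carrier R \<Longrightarrow> x \<in> H \<Longrightarrow> a \<odot>\<^bsub>M\<^esub> x \<in> H"
  shows "left_module R (M\<lparr>carrier := H\<rparr>)"
proof -
  interpret left_module R M by fact
  have H: "x \<in> H \<Longrightarrow> x \<in> carrier M" for x using assms(2) by blast
  have "abelian_group (M\<lparr>carrier := H\<rparr>)"
  proof (rule abelian_groupI)
    \<comment> \<open>The inverse of \<open>x\<close> is \<open>(-1) x\<close>, so closure under
      scalars already provides it.\<close>
    fix x assume "x \<in> carrier (M\<lparr>carrier := H\<rparr>)"
    then have x: "x \<in> H" by simp
    have "(\<ominus>\<^bsub>R\<^esub> \<one>\<^bsub>R\<^esub>) \<odot>\<^bsub>M\<^esub> x \<oplus>\<^bsub>M\<^esub> x = (\<ominus>\<^bsub>R\<^esub> \<one>\<^bsub>R\<^esub> \<oplus>\<^bsub>R\<^esub> \<one>\<^bsub>R\<^esub>) \<odot>\<^bsub>M\<^esub> x"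
      using H[OF x] by (subst smult_l_distr) auto
    then have "(\<ominus>\<^bsub>R\<^esub> \<one>\<^bsub>R\<^esub>) \<odot>\<^bsub>M\<^esub> x \<oplus>\<^bsub>M\<^esub> x = \<zero>\<^bsub>M\<^esub>" using H[OF x] by (simp add: R.l_neg)
    then show "\<exists>y\<in>carrier (M\<lparr>carrier := H\<rparr>). y \<oplus>\<^bsub>M\<lparr>carrier := H\<rparr>\<^esub> x = \<zero>\<^bsub>M\<lparr>carrier := H\<rparr>\<^esub>"
      using smult[OF _ x, of "\<ominus>\<^bsub>R\<^esub> \<one>\<^bsub>R\<^esub>"] by auto
  qed (use assms(3) add H in \<open>auto simp: M.a_ac\<close>)
  then show ?thesis
    by (rule left_moduleI[OF R.ring_axioms])
      (use smult H in \<open>auto simp: smult_l_distr smult_r_distr smult_assoc1\<close>)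
qed

text \<open>Subtraction through \<open>add\<close> and \<open>smult\<close> alone. The operator
  \<open>\<ominus>\<close> refers to inverses inside the carrier, whereas this term is literally the
  same in a submodule with restricted carrier, and homomorphisms preserve it by linearity.\<close>

definition mdiff :: "('r, 'z) ring_scheme \<Rightarrow> ('r, 'm, 'y) module_scheme \<Rightarrow> 'm \<Rightarrow> 'm \<Rightarrow> 'm" where
  "mdiff R M x y = x \<oplus>\<^bsub>M\<^esub> (\<ominus>\<^bsub>R\<^esub> \<one>\<^bsub>R\<^esub>) \<odot>\<^bsub>M\<^esub> y"

lemma mdiff_restrict [simp]: "mdiff R (M\<lparr>carrier := H\<rparr>) = mdiff R M"
  by (simp add: mdiff_def fun_eq_iff)

context left_module
begin

lemma mdiff_closed [simp]: "x \<in> carrier M \<Longrightarrow> y \<in> carrier M \<Longrightarrow> mdiff R M x y \<in> carrier M"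
  by (simp add: mdiff_def)

lemma mdiff_eq_zero_iff: "x \<in> carrier M \<Longrightarrow> y \<in> carrier M \<Longrightarrow> mdiff R M x y = \<zero>\<^bsub>M\<^esub> \<longleftrightarrow> x = y"
  unfolding mdiff_def by (rule diff_eq_zero_iff)

lemma mdiff_eq_minus:
  assumes "x \<in> carrier M" "y \<in> carrier M"
  shows "mdiff R M x y = x \<ominus>\<^bsub>M\<^esub> y"
proof -
  have "(\<ominus>\<^bsub>R\<^esub> \<one>\<^bsub>R\<^esub>) \<odot>\<^bsub>M\<^esub> y \<oplus>\<^bsub>M\<^esub> y = (\<ominus>\<^bsub>R\<^esub> \<one>\<^bsub>R\<^esub> \<oplus>\<^bsub>R\<^esub> \<one>\<^bsub>R\<^esub>) \<odot>\<^bsub>M\<^esub> y"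
    using assms by (subst smult_l_distr) auto
  then have "(\<ominus>\<^bsub>R\<^esub> \<one>\<^bsub>R\<^esub>) \<odot>\<^bsub>M\<^esub> y \<oplus>\<^bsub>M\<^esub> y = \<zero>\<^bsub>M\<^esub>" using assms by (simp add: R.l_neg)
  then have "(\<ominus>\<^bsub>R\<^esub> \<one>\<^bsub>R\<^esub>) \<odot>\<^bsub>M\<^esub> y = \<ominus>\<^bsub>M\<^esub> y"
    using assms M.minus_equality by simp
  then show ?thesis by (simp add: mdiff_def a_minus_def)
qed

lemma mdiff_add_cancel:
  "x \<in> carrier M \<Longrightarrow> y \<in> carrier M \<Longrightarrow> mdiff R M x y \<oplus>\<^bsub>M\<^esub> y = x"
  by (simp add: mdiff_eq_minus a_minus_def M.a_assoc M.l_neg)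

end

lemma lmod_hom_mdiff:
  assumes "left_module R M" "f \<in> lmod_hom R M N" "x \<in> carrier M" "y \<in> carrier M"
  shows "f (mdiff R M x y) = mdiff R N (f x) (f y)"
proof -
  interpret left_module R M by fact
  show ?thesis using lmod_homD[OF assms(2)] assms(3,4) by (simp add: mdiff_def)
qed

lemma lmod_hom_comp:
  assumes "f \<in> lmod_hom R M N" "g \<in> lmod_hom R N L"
  shows "(\<lambda>x. g (f x)) \<in> lmod_hom R M L"
  by (rule lmod_homI) (simp_all add: lmod_homD[OF assms(1)] lmod_homD[OF assms(2)])

lemma lmod_hom_id: "(\<lambda>x. x) \<in> lmod_hom R M M"
  by (rule lmod_homI) simp_all

lemma lmod_hom_restrict:
  assumes "f \<in> lmod_hom R M N" "H \<subseteq> carrier M" "\<And>x. x \<in> H \<Longrightarrow> f x \<in> K"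
  shows "f \<in> lmod_hom R (M\<lparr>carrier := H\<rparr>) (N\<lparr>carrier := K\<rparr>)"
  by (rule lmod_homI) (simp_all add: assms(3) lmod_homD[OF assms(1)] subsetD[OF assms(2)])

lemma mdiff_hom:
  assumes M: "left_module R M" and N: "left_module R N"
    and f: "f \<in> lmod_hom R M N" and g: "g \<in> lmod_hom R M N"
  shows "(\<lambda>x. mdiff R N (f x) (g x)) \<in> lmod_hom R M N"
proof (rule lmod_homI)
  interpret N: left_module R N by fact
  note h = lmod_homD[OF f] lmod_homD[OF g]
  fix x assume x: "x \<in> carrier M"
  show "mdiff R N (f x) (g x) \<in> carrier N" using h x by simp
  show "mdiff R N (f (x \<oplus>\<^bsub>M\<^esub> y)) (g (x \<oplus>\<^bsub>M\<^esub> y)) =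
      mdiff R N (f x) (g x) \<oplus>\<^bsub>N\<^esub> mdiff R N (f y) (g y)" if y: "y \<in> carrier M" for y
    using h x y by (simp add: mdiff_def N.smult_r_distr N.M.a_ac)
  fix a assume a: "a \<in> carrier R"
  have "(\<ominus>\<^bsub>R\<^esub> \<one>\<^bsub>R\<^esub>) \<odot>\<^bsub>N\<^esub> (a \<odot>\<^bsub>N\<^esub> g x) = a \<odot>\<^bsub>N\<^esub> ((\<ominus>\<^bsub>R\<^esub> \<one>\<^bsub>R\<^esub>) \<odot>\<^bsub>N\<^esub> g x)"
    using a h x by (simp add: N.smult_assoc1[symmetric] N.R.l_minus N.R.r_minus)
  then show "mdiff R N (f (a \<odot>\<^bsub>M\<^esub> x)) (g (a \<odot>\<^bsub>M\<^esub> x)) = a \<odot>\<^bsub>N\<^esub> mdiff R N (f x) (g x)"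
    using a h x by (simp add: mdiff_def N.smult_r_distr)
qed

text \<open>Coordinates outside \<open>S\<close> are zero instead of \<open>undefined\<close>, so
  the modules on all subsets of one type are nested, with the same zero, addition and scalar action.
  This lets \<open>S\<close> grow without transporting elements.\<close>

definition free_on :: "('r, 'z) ring_scheme \<Rightarrow> 'b set \<Rightarrow> ('r, 'b \<Rightarrow> 'r) module" where
  "free_on R S = \<lparr>carrier = {z. (\<forall>b. z b \<in> carrier R) \<and> finite {b. z b \<noteq> \<zero>\<^bsub>R\<^esub>} \<and>
       (\<forall>b. b \<notin> S \<longrightarrow> z b = \<zero>\<^bsub>R\<^esub>)},
     mult = undefined, one = undefined, zero = (\<lambda>_. \<zero>\<^bsub>R\<^esub>),
     add = (\<lambda>x y b. x b \<oplus>\<^bsub>R\<^esub> y b), smult = (\<lambda>a x b. a \<otimes>\<^bsub>R\<^esub> x b)\<rparr>"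

lemma free_on_carrier:
  "z \<in> carrier (free_on R S) \<longleftrightarrow> (\<forall>b. z b \<in> carrier R) \<and> finite {b. z b \<noteq> \<zero>\<^bsub>R\<^esub>} \<and>
     (\<forall>b. b \<notin> S \<longrightarrow> z b = \<zero>\<^bsub>R\<^esub>)"
  by (simp add: free_on_def)

lemma free_on_ops [simp]:
  "\<zero>\<^bsub>free_on R S\<^esub> = (\<lambda>_. \<zero>\<^bsub>R\<^esub>)"
  "x \<oplus>\<^bsub>free_on R S\<^esub> y = (\<lambda>b. x b \<oplus>\<^bsub>R\<^esub> y b)"
  "a \<odot>\<^bsub>free_on R S\<^esub> x = (\<lambda>b. a \<otimes>\<^bsub>R\<^esub> x b)"
  by (simp_all add: free_on_def)

lemma free_on_mono: "S \<subseteq> S' \<Longrightarrow> z \<in> carrier (free_on R S) \<Longrightarrow> z \<in> carrier (free_on R S')"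
  by (auto simp: free_on_carrier)

text \<open>Over the whole type extensionality is no restriction, so the module axioms and
  \<open>lin_comb\<close> carry over from \<open>free_module\<close>; for other \<open>S\<close> one
  passes to submodules.\<close>

lemma free_on_UNIV: "free_on R UNIV = free_module R UNIV"
  by (simp add: free_on_def direct_sum_def regular_module_def PiE_UNIV_domain Pi_def fun_eq_iff)

lemma free_on_left_module:
  fixes S :: "'b set"
  assumes "ring R" shows "left_module R (free_on R S)"
proof -
  interpret ring R by fact
  let ?U = "free_on R (UNIV :: 'b set)"
  have U: "left_module R ?U"
    unfolding free_on_UNIV
    by (intro direct_sum_left_module regular_module_left_module assms)
  interpret U: left_module R ?U by fact
  have eq: "free_on R S = ?U\<lparr>carrier := carrier (free_on R S)\<rparr>"
    by (simp add: free_on_def)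
  show ?thesis
    by (subst eq, rule left_module_restrict[OF U])
      (use U.M.a_closed U.smult_closed U.M.zero_closed in \<open>force simp: free_on_carrier\<close>)+
qed

lemma free_on_zero: "ring R \<Longrightarrow> (\<lambda>_. \<zero>\<^bsub>R\<^esub>) \<in> carrier (free_on R S)"
  by (simp add: free_on_carrier ring.ring_simprules(2))

lemma free_on_empty: "ring R \<Longrightarrow> carrier (free_on R {}) = {\<lambda>_. \<zero>\<^bsub>R\<^esub>}"
  by (auto simp: free_on_carrier ring.ring_simprules(2))

lemma mdiff_free_on:
  assumes "ring R" "x \<in> carrier (free_on R S)" "y \<in> carrier (free_on R S)"
  shows "mdiff R (free_on R S') x y = (\<lambda>b. x b \<ominus>\<^bsub>R\<^esub> y b)"
proof -
  interpret ring R by fact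
  show ?thesis using assms(2,3)
    by (auto simp: mdiff_def free_on_carrier fun_eq_iff a_minus_def l_minus)
qed

lemma lin_comb_hom_free_on:
  assumes "left_module R N" "\<And>i. b i \<in> carrier N"
  shows "lin_comb R N UNIV b \<in> lmod_hom R (free_on R UNIV) N"
  unfolding free_on_UNIV by (rule lin_comb_hom) (use assms in auto)

text \<open>
  A projective module \<open>P\<close> over the type \<open>'p\<close> splits off the free module on \<open>'p\<close>; the summand is the
  image of the idempotent \<open>s \<circ> \<pi>\<close>, and \<open>c\<close> is the complementary idempotent.
\<close>

lemma projective_split:
  fixes P :: "('r, 'p) module"
  assumes R: "ring R" and P: "projective R P"
  shows "\<exists>\<pi> s c. \<pi> \<in> lmod_hom R (free_on R (UNIV :: 'p set)) P \<and> s \<in> lmod_hom R P (free_on R UNIV) \<and>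
    c \<in> lmod_hom R (free_on R UNIV) (free_on R UNIV) \<and>
    (\<forall>x\<in>carrier P. \<pi> (s x) = x \<and> c (s x) = (\<lambda>_. \<zero>\<^bsub>R\<^esub>)) \<and>
    (\<forall>u\<in>carrier (free_on R UNIV). \<pi> (c u) = \<zero>\<^bsub>P\<^esub> \<and> c (c u) = c u \<and>
       (\<lambda>b. s (\<pi> u) b \<oplus>\<^bsub>R\<^esub> c u b) = u)"
proof -
  have PM: "left_module R P" using P by (simp add: projective_def)
  interpret P: left_module R P by fact
  let ?E = "free_on R (UNIV :: 'p set)"
  have E: "left_module R ?E" by (rule free_on_left_module[OF R])
  interpret E: left_module R ?E by fact
  \<comment> \<open>The basis is the whole type, so elements outside \<open>carrier P\<close> need a
    value too; zero keeps the map into \<open>P\<close>.\<close>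
  let ?b = "\<lambda>x. if x \<in> carrier P then x else \<zero>\<^bsub>P\<^esub>"
  define \<pi> where "\<pi> = lin_comb R P UNIV ?b"
  have pi: "\<pi> \<in> lmod_hom R ?E P" unfolding \<pi>_def by (rule lin_comb_hom_free_on[OF PM]) simp
  have sur: "\<pi> ` carrier ?E = carrier P"
  proof
    show "\<pi> ` carrier ?E \<subseteq> carrier P" using lmod_homD(1)[OF pi] by blast
    show "carrier P \<subseteq> \<pi> ` carrier ?E"
    proof
      fix x assume x: "x \<in> carrier P"
      let ?c = "\<lambda>i. if i = x then \<one>\<^bsub>R\<^esub> else \<zero>\<^bsub>R\<^esub>"
      have "{i \<in> UNIV. ?c i \<noteq> \<zero>\<^bsub>R\<^esub>} \<subseteq> {x}" by auto
      then have f: "finite {i. ?c i \<noteq> \<zero>\<^bsub>R\<^esub>}" by (simp add: finite_subset)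
      have "\<pi> ?c = finsum P (\<lambda>i. ?c i \<odot>\<^bsub>P\<^esub> ?b i) {x}"
        unfolding \<pi>_def by (rule lin_comb_superset[OF PM]) auto
      also have "\<dots> = x" using x by simp
      finally show "x \<in> \<pi> ` carrier ?E"
        using f by (intro image_eqI[of _ _ ?c]) (auto simp: free_on_carrier)
    qed
  qed
  obtain s where s: "s \<in> lmod_hom R P ?E" "\<And>x. x \<in> carrier P \<Longrightarrow> \<pi> (s x) = x"
    using projective_lift[OF P E PM pi sur lmod_hom_id] by blast
  define c where "c = (\<lambda>u. mdiff R ?E u (s (\<pi> u)))"
  have sp: "(\<lambda>u. s (\<pi> u)) \<in> lmod_hom R ?E ?E" by (rule lmod_hom_comp[OF pi s(1)])
  have c: "c \<in> lmod_hom R ?E ?E"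
    unfolding c_def by (rule mdiff_hom[OF E E lmod_hom_id sp])
  have cs: "c (s x) = \<zero>\<^bsub>?E\<^esub>" if "x \<in> carrier P" for x
    unfolding c_def using that lmod_homD(1)[OF s(1)] s(2) E.mdiff_eq_zero_iff by simp
  have pc: "\<pi> (c u) = \<zero>\<^bsub>P\<^esub>" if u: "u \<in> carrier ?E" for u
  proof -
    have "\<pi> (c u) = mdiff R P (\<pi> u) (\<pi> (s (\<pi> u)))"
      unfolding c_def by (rule lmod_hom_mdiff[OF E pi u lmod_homD(1)[OF sp u]])
    then show ?thesis using s(2) lmod_homD(1)[OF pi u] P.mdiff_eq_zero_iff by simp
  qed
  have sum: "s (\<pi> u) \<oplus>\<^bsub>?E\<^esub> c u = u" if u: "u \<in> carrier ?E" for u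
    using E.mdiff_add_cancel[OF u lmod_homD(1)[OF sp u]] E.M.a_comm lmod_homD(1)[OF sp u]
      lmod_homD(1)[OF c u] unfolding c_def by metis
  \<comment> \<open>Apply \<open>c\<close> to \<open>u = s (\<pi> u) + c u\<close> and use that
    \<open>c\<close> vanishes on the image of \<open>s\<close>.\<close>
  have cc: "c (c u) = c u" if u: "u \<in> carrier ?E" for u
  proof -
    have "c u = c (s (\<pi> u)) \<oplus>\<^bsub>?E\<^esub> c (c u)"
      using sum[OF u] lmod_homD(2)[OF c lmod_homD(1)[OF sp u] lmod_homD(1)[OF c u]] by simp
    also have "\<dots> = c (c u)"
      using cs[OF lmod_homD(1)[OF pi u]] lmod_homD(1)[OF c lmod_homD(1)[OF c u]] E.M.l_zero by simp
    finally show ?thesis by simp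
  qed
  show ?thesis
    using pi s c cs pc cc sum by (intro exI[of _ \<pi>] exI[of _ s] exI[of _ c]) auto
qed

section \<open>Free resolutions of finite length\<close>

text \<open>An index \<open>(j, i, x)\<close> stands for the basis element \<open>x\<close> in entry
  \<open>i\<close> of copy \<open>j\<close> of the countable direct power of
  \<open>E = free_on R UNIV\<close>. Finite support means that each entry lies in \<open>E\<close>
  and that only finitely many entries are nonzero.\<close>

lemma free_on_fibre:
  assumes w: "w \<in> carrier (free_on R (UNIV :: ('j \<times> nat \<times> 'p) set))"
  shows "(\<lambda>x. w (j, i, x)) \<in> carrier (free_on R UNIV)"
    and "finite {i. (\<lambda>x. w (j, i, x)) \<noteq> (\<lambda>_. \<zero>\<^bsub>R\<^esub>)}"
proof -
  let ?A = "{b. w b \<noteq> \<zero>\<^bsub>R\<^esub>}"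
  have f: "finite ?A" using w by (simp add: free_on_carrier)
  have "{x. w (j, i, x) \<noteq> \<zero>\<^bsub>R\<^esub>} \<subseteq> (\<lambda>b. snd (snd b)) ` ?A" by force
  then have "finite {x. w (j, i, x) \<noteq> \<zero>\<^bsub>R\<^esub>}" using f finite_surj by blast
  then show "(\<lambda>x. w (j, i, x)) \<in> carrier (free_on R UNIV)"
    using w by (simp add: free_on_carrier)
  have "{i. (\<lambda>x. w (j, i, x)) \<noteq> (\<lambda>_. \<zero>\<^bsub>R\<^esub>)} \<subseteq> (\<lambda>b. fst (snd b)) ` ?A"
    by (force simp: fun_eq_iff)
  then show "finite {i. (\<lambda>x. w (j, i, x)) \<noteq> (\<lambda>_. \<zero>\<^bsub>R\<^esub>)}" using f finite_surj by blast
qed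

lemma free_on_replace_fibre:
  assumes w: "w \<in> carrier (free_on R (UNIV :: ('j \<times> nat \<times> 'p) set))"
    and u: "\<And>i. u i \<in> carrier (free_on R UNIV)" and fin: "finite {i. u i \<noteq> (\<lambda>_. \<zero>\<^bsub>R\<^esub>)}"
  shows "(\<lambda>(j', i, x). if j' = j then u i x else w (j', i, x)) \<in> carrier (free_on R UNIV)"
proof -
  let ?z = "\<lambda>(j', i, x). if j' = j then u i x else w (j', i, x)"
  have "{b. ?z b \<noteq> \<zero>\<^bsub>R\<^esub>} \<subseteq> {b. w b \<noteq> \<zero>\<^bsub>R\<^esub>} \<union>
      (\<Union>i\<in>{i. u i \<noteq> (\<lambda>_. \<zero>\<^bsub>R\<^esub>)}. (\<lambda>x. (j, i, x)) ` {x. u i x \<noteq> \<zero>\<^bsub>R\<^esub>})"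
    by (auto simp: fun_eq_iff image_iff split: if_splits)
  moreover have "finite \<dots>"
    using w u fin by (auto simp: free_on_carrier)
  ultimately have "finite {b. ?z b \<noteq> \<zero>\<^bsub>R\<^esub>}" by (rule finite_subset)
  then show ?thesis using w u by (auto simp: free_on_carrier)
qed

text \<open>
  Eilenberg swindle: \<open>P \<oplus> E\<^bsup>\<nat>\<^esup> \<cong> E\<^bsup>\<nat>\<^esup>\<close> for \<open>P\<close> a direct summand of the free module \<open>E\<close>,
  applied to the fibre over \<open>j\<close>. With \<open>E = P \<oplus> P'\<close>, the isomorphism \<open>w \<mapsto> (\<pi> w, T w)\<close> regroups
  \<open>P \<oplus> (P' \<oplus> P) \<oplus> (P' \<oplus> P) \<oplus> \<dots>\<close>, and \<open>c\<close> is its inverse.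
\<close>

lemma swindle:
  fixes P :: "('r, 'p) module" and j :: 'j
  assumes R: "ring R" and P: "projective R P"
  defines "F \<equiv> free_on R (UNIV :: ('j \<times> nat \<times> 'p) set)"
  shows "\<exists>\<pi> T c. \<pi> \<in> lmod_hom R F P \<and> T \<in> lmod_hom R F F \<and>
    (\<forall>x\<in>carrier P. \<forall>w\<in>carrier F. c x w \<in> carrier F \<and> \<pi> (c x w) = x \<and> T (c x w) = w) \<and>
    (\<forall>w\<in>carrier F. c (\<pi> w) (T w) = w) \<and>
    (\<forall>x w b. fst b \<noteq> j \<longrightarrow> T w b = w b \<and> c x w b = w b)"
proof -
  interpret R: ring R by fact
  let ?E = "free_on R (UNIV :: 'p set)"
  let ?z = "\<lambda>_. \<zero>\<^bsub>R\<^esub>"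
  have PM: "left_module R P" using P by (simp add: projective_def)
  interpret P: left_module R P by fact
  have E: "left_module R ?E" by (rule free_on_left_module[OF R])
  interpret E: left_module R ?E by fact
  obtain p s c where p: "p \<in> lmod_hom R ?E P" and s: "s \<in> lmod_hom R P ?E"
    and c: "c \<in> lmod_hom R ?E ?E"
    and id: "\<And>x. x \<in> carrier P \<Longrightarrow> p (s x) = x" "\<And>x. x \<in> carrier P \<Longrightarrow> c (s x) = ?z"
      "\<And>u. u \<in> carrier ?E \<Longrightarrow> p (c u) = \<zero>\<^bsub>P\<^esub>" "\<And>u. u \<in> carrier ?E \<Longrightarrow> c (c u) = c u"
      "\<And>u. u \<in> carrier ?E \<Longrightarrow> (\<lambda>b. s (p u) b \<oplus>\<^bsub>R\<^esub> c u b) = u"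
    using projective_split[OF R P] by blast
  note hom = lmod_homD[OF p, unfolded free_on_ops] lmod_homD[OF s, unfolded free_on_ops]
    lmod_homD[OF c, unfolded free_on_ops]
  have null: "p ?z = \<zero>\<^bsub>P\<^esub>" "s \<zero>\<^bsub>P\<^esub> = ?z" "c ?z = ?z"
    using lmod_hom_zero[OF E PM p] lmod_hom_zero[OF PM E s] lmod_hom_zero[OF E E c] by simp_all
  have val: "u b \<in> carrier R" if "u \<in> carrier ?E" for u b using that by (simp add: free_on_carrier)
  define f where "f w i = (\<lambda>x. w (j, i, x))" for w :: "'j \<times> nat \<times> 'p \<Rightarrow> 'r" and i
  define rep where "rep w u = (\<lambda>(j', i, x). if j' = j then u i x else w (j', i, x))"
    for w :: "'j \<times> nat \<times> 'p \<Rightarrow> 'r" and u :: "nat \<Rightarrow> 'p \<Rightarrow> 'r"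
  \<comment> \<open>With \<open>p\<close> and \<open>c\<close> cutting an entry into its parts in
    \<open>P\<close> and \<open>P'\<close>, \<open>\<pi>\<close> takes out the \<open>P\<close>-part
    of entry 0, \<open>T\<close> moves the later \<open>P\<close>-parts one place down, and
    \<open>C\<close> undoes this by moving them up and inserting \<open>y\<close>. The
    \<open>P'\<close>-parts never move.\<close>
  define \<pi> where "\<pi> w = p (f w 0)" for w
  define T where "T w = rep w (\<lambda>i x. c (f w i) x \<oplus>\<^bsub>R\<^esub> s (p (f w (Suc i))) x)" for w
  define C where "C y w = rep w (\<lambda>i x.
      (case i of 0 \<Rightarrow> s y x | Suc i' \<Rightarrow> s (p (f w i')) x) \<oplus>\<^bsub>R\<^esub> c (f w i) x)" for y w
  have f: "f w i \<in> carrier ?E" "finite {i. f w i \<noteq> ?z}" if "w \<in> carrier F" for w i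
    using free_on_fibre[of w R j] that by (auto simp: f_def F_def)
  have rep: "rep w u \<in> carrier F"
    if "w \<in> carrier F" "\<And>i. u i \<in> carrier ?E" "finite {i. u i \<noteq> ?z}" for w u
    unfolding rep_def F_def by (rule free_on_replace_fibre) (use that in \<open>auto simp: F_def\<close>)
  have f_rep: "f (rep w u) i = u i" for w u i by (simp add: f_def rep_def)
  have rep_rep: "rep (rep w u) v = rep w v" for w u v by (auto simp: rep_def)
  have rep_id: "rep w (f w) = w" for w by (auto simp: f_def rep_def)
  have add: "(\<lambda>x. u x \<oplus>\<^bsub>R\<^esub> v x) \<in> carrier ?E" if "u \<in> carrier ?E" "v \<in> carrier ?E" for u v
    using E.M.a_closed[OF that] by simp
  have TE: "(\<lambda>x. c (f w i) x \<oplus>\<^bsub>R\<^esub> s (p (f w (Suc i))) x) \<in> carrier ?E" if "w \<in> carrier F" for w i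
    using that f hom by (intro add) auto
  have CE: "(\<lambda>x. (case i of 0 \<Rightarrow> s y x | Suc i' \<Rightarrow> s (p (f w i')) x) \<oplus>\<^bsub>R\<^esub> c (f w i) x) \<in> carrier ?E"
    if "w \<in> carrier F" "y \<in> carrier P" for w y i
    using that f hom add by (cases i) auto
  have TF: "T w \<in> carrier F" if w: "w \<in> carrier F" for w
    unfolding T_def
  proof (rule rep[OF w TE[OF w]])
    have "{i. (\<lambda>x. c (f w i) x \<oplus>\<^bsub>R\<^esub> s (p (f w (Suc i))) x) \<noteq> ?z}
        \<subseteq> {i. f w i \<noteq> ?z} \<union> Suc -` {i. f w i \<noteq> ?z}"
      by (auto simp: null)
    moreover have "finite \<dots>" using f(2)[OF w] by (intro finite_UnI finite_vimageI) auto
    ultimately show "finite {i. (\<lambda>x. c (f w i) x \<oplus>\<^bsub>R\<^esub> s (p (f w (Suc i))) x) \<noteq> ?z}"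
      by (rule finite_subset)
  qed
  have CF: "C y w \<in> carrier F" if w: "w \<in> carrier F" and y: "y \<in> carrier P" for w y
    unfolding C_def
  proof (rule rep[OF w CE[OF w y]])
    let ?u = "\<lambda>i x. (case i of 0 \<Rightarrow> s y x | Suc i' \<Rightarrow> s (p (f w i')) x) \<oplus>\<^bsub>R\<^esub> c (f w i) x"
    have "{i. ?u i \<noteq> ?z} \<subseteq> {0} \<union> {i. f w i \<noteq> ?z} \<union> Suc ` {i. f w i \<noteq> ?z}"
    proof
      fix i assume "i \<in> {i. ?u i \<noteq> ?z}"
      then show "i \<in> {0} \<union> {i. f w i \<noteq> ?z} \<union> Suc ` {i. f w i \<noteq> ?z}"
        by (cases i) (auto simp: null)
    qed
    moreover have "finite \<dots>" using f(2)[OF w] by simp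
    ultimately show "finite {i. ?u i \<noteq> ?z}" by (rule finite_subset)
  qed
  have f_add: "f (\<lambda>b. w b \<oplus>\<^bsub>R\<^esub> w' b) i = (\<lambda>b. f w i b \<oplus>\<^bsub>R\<^esub> f w' i b)"
    and f_smult: "f (\<lambda>b. a \<otimes>\<^bsub>R\<^esub> w b) i = (\<lambda>b. a \<otimes>\<^bsub>R\<^esub> f w i b)" for w w' a i
    by (simp_all add: f_def)
  have pi_hom: "\<pi> \<in> lmod_hom R F P"
    by (rule lmod_homI) (use hom f in \<open>auto simp: \<pi>_def F_def f_add f_smult\<close>)
  have T_hom: "T \<in> lmod_hom R F F"
  proof (rule lmod_homI)
    fix x y assume xy: "x \<in> carrier F" "y \<in> carrier F"
    note cl = val[OF f(1)[OF xy(1)]] val[OF f(1)[OF xy(2)]]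
      val[OF hom(7)[OF f(1)[OF xy(1)]]] val[OF hom(7)[OF f(1)[OF xy(2)]]]
      val[OF hom(4)[OF hom(1)[OF f(1)[OF xy(1)]]]] val[OF hom(4)[OF hom(1)[OF f(1)[OF xy(2)]]]]
    show "T (x \<oplus>\<^bsub>F\<^esub> y) = T x \<oplus>\<^bsub>F\<^esub> T y"
      using hom f(1)[OF xy(1)] f(1)[OF xy(2)] cl
      by (auto simp: T_def F_def rep_def f_add fun_eq_iff R.a_ac)
  next
    fix a x assume ax: "a \<in> carrier R" "x \<in> carrier F"
    note cl = val[OF hom(7)[OF f(1)[OF ax(2)]]] val[OF hom(4)[OF hom(1)[OF f(1)[OF ax(2)]]]]
    show "T (a \<odot>\<^bsub>F\<^esub> x) = a \<odot>\<^bsub>F\<^esub> T x"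
      using hom f(1)[OF ax(2)] cl ax(1)
      by (auto simp: T_def F_def rep_def f_smult fun_eq_iff R.r_distr)
  qed (rule TF)
  have zr: "(\<lambda>b. \<zero>\<^bsub>R\<^esub> \<oplus>\<^bsub>R\<^esub> u b) = u" "(\<lambda>b. u b \<oplus>\<^bsub>R\<^esub> \<zero>\<^bsub>R\<^esub>) = u" if "u \<in> carrier ?E" for u
    using val[OF that] by auto
  have pC: "\<pi> (C y w) = y" if w: "w \<in> carrier F" and y: "y \<in> carrier P" for w y
  proof -
    have "\<pi> (C y w) = p (\<lambda>x. s y x \<oplus>\<^bsub>R\<^esub> c (f w 0) x)" by (simp add: \<pi>_def C_def f_rep)
    also have "\<dots> = p (s y) \<oplus>\<^bsub>P\<^esub> p (c (f w 0))" using hom f(1)[OF w] y by simp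
    finally show ?thesis using id f(1)[OF w] y by simp
  qed
  have TC: "T (C y w) = w" if w: "w \<in> carrier F" and y: "y \<in> carrier P" for w y
  proof -
    have 1: "c (f (C y w) i) = c (f w i)" for i
    proof -
      have "c (f (C y w) i) =
          c (\<lambda>x. (case i of 0 \<Rightarrow> s y | Suc i' \<Rightarrow> s (p (f w i'))) x \<oplus>\<^bsub>R\<^esub> c (f w i) x)"
        by (cases i) (simp_all add: C_def f_rep)
      also have "\<dots> = (\<lambda>x. c (case i of 0 \<Rightarrow> s y | Suc i' \<Rightarrow> s (p (f w i'))) x \<oplus>\<^bsub>R\<^esub> c (c (f w i)) x)"
        using hom f(1)[OF w] y by (cases i) simp_all
      also have "\<dots> = c (f w i)"
        using id hom f(1)[OF w] y zr by (cases i) simp_all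
      finally show ?thesis .
    qed
    have 2: "p (f (C y w) (Suc i)) = p (f w i)" for i
    proof -
      have "p (f (C y w) (Suc i)) = p (\<lambda>x. s (p (f w i)) x \<oplus>\<^bsub>R\<^esub> c (f w (Suc i)) x)"
        by (simp add: C_def f_rep)
      also have "\<dots> = p (s (p (f w i))) \<oplus>\<^bsub>P\<^esub> p (c (f w (Suc i)))" using hom f(1)[OF w] by simp
      finally show ?thesis using id hom f(1)[OF w] by simp
    qed
    have 3: "(\<lambda>x. c (f w i) x \<oplus>\<^bsub>R\<^esub> s (p (f w i)) x) = f w i" for i
    proof -
      have "(\<lambda>x. c (f w i) x \<oplus>\<^bsub>R\<^esub> s (p (f w i)) x) = (\<lambda>x. s (p (f w i)) x \<oplus>\<^bsub>R\<^esub> c (f w i) x)"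
        using val hom f(1)[OF w] by (intro ext R.a_comm) auto
      then show ?thesis using id(5) f(1)[OF w] by simp
    qed
    have "T (C y w) = rep (C y w) (f w)" unfolding T_def 1 2 3 ..
    also have "\<dots> = rep w (f w)" by (simp only: C_def rep_rep)
    finally show ?thesis by (simp only: rep_id)
  qed
  have CT: "C (\<pi> w) (T w) = w" if w: "w \<in> carrier F" for w
  proof -
    have fT: "f (T w) i = (\<lambda>x. c (f w i) x \<oplus>\<^bsub>R\<^esub> s (p (f w (Suc i))) x)" for i
      by (simp add: T_def f_rep)
    have 1: "p (f (T w) i) = p (f w (Suc i))" for i
    proof -
      have "p (f (T w) i) = p (c (f w i)) \<oplus>\<^bsub>P\<^esub> p (s (p (f w (Suc i))))"
        unfolding fT using hom f(1)[OF w] by simp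
      then show ?thesis using id hom f(1)[OF w] by simp
    qed
    have 2: "c (f (T w) i) = c (f w i)" for i
    proof -
      have "c (f (T w) i) = (\<lambda>x. c (c (f w i)) x \<oplus>\<^bsub>R\<^esub> c (s (p (f w (Suc i)))) x)"
        unfolding fT using hom f(1)[OF w] by simp
      then show ?thesis using id hom f(1)[OF w] zr by simp
    qed
    have 3: "(\<lambda>x. (case i of 0 \<Rightarrow> s (\<pi> w) x | Suc i' \<Rightarrow> s (p (f w (Suc i'))) x) \<oplus>\<^bsub>R\<^esub> c (f w i) x) = f w i" for i
      using id(5) f(1)[OF w] by (cases i) (simp_all add: \<pi>_def)
    have "C (\<pi> w) (T w) = rep (T w) (f w)" unfolding C_def 1 2 3 ..
    also have "\<dots> = rep w (f w)" by (simp only: T_def rep_rep)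
    finally show ?thesis by (simp only: rep_id)
  qed
  \<comment> \<open>Outside copy \<open>j\<close> nothing changes; thus \<open>T\<close> and
    \<open>C\<close> also act on the free module spanned by any selection of copies that contains
    \<open>j\<close>.\<close>
  have off: "T w b = w b \<and> C y w b = w b" if "fst b \<noteq> j" for w b y
    using that by (auto simp: T_def C_def rep_def split: prod.splits)
  show ?thesis
    using pi_hom T_hom CF pC TC CT off
    by (intro exI[of _ \<pi>] exI[of _ T] exI[of _ C]) blast
qed

text \<open>The sequence runs through all \<open>k\<close>, with empty bases above \<open>n\<close>.
  Exactness then has one formula at every \<open>D k\<close>, and the left end needs no separate
  case.\<close>

definition free_resolution ::
  "('r, 'z) ring_scheme \<Rightarrow> nat \<Rightarrow> (nat \<Rightarrow> 'b set) \<Rightarrow> (nat \<Rightarrow> ('b \<Rightarrow> 'r) \<Rightarrow> 'b \<Rightarrow> 'r) \<Rightarrow>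
   (('b \<Rightarrow> 'r) \<Rightarrow> 'm) \<Rightarrow> ('r, 'm) module \<Rightarrow> bool" where
  "free_resolution R n B D e M \<longleftrightarrow>
     left_module R M \<and> (\<forall>k>n. B k = {}) \<and>
     e \<in> lmod_hom R (free_on R (B 0)) M \<and> e ` carrier (free_on R (B 0)) = carrier M \<and>
     (\<forall>k. D k \<in> lmod_hom R (free_on R (B (Suc k))) (free_on R (B k))) \<and>
     lmod_kernel (free_on R (B 0)) M e = D 0 ` carrier (free_on R (B 1)) \<and>
     (\<forall>k. lmod_kernel (free_on R (B (Suc k))) (free_on R (B k)) (D k) =
        D (Suc k) ` carrier (free_on R (B (Suc (Suc k)))))"

lemma free_on_restrict:
  assumes "ring R" "w \<in> carrier (free_on R S)"
  shows "(\<lambda>b. if b \<in> A then w b else \<zero>\<^bsub>R\<^esub>) \<in> carrier (free_on R (S \<inter> A))"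
proof -
  interpret ring R by fact
  have "{b. (if b \<in> A then w b else \<zero>\<^bsub>R\<^esub>) \<noteq> \<zero>\<^bsub>R\<^esub>} \<subseteq> {b. w b \<noteq> \<zero>\<^bsub>R\<^esub>}" by auto
  then have "finite {b. (if b \<in> A then w b else \<zero>\<^bsub>R\<^esub>) \<noteq> \<zero>\<^bsub>R\<^esub>}"
    by (rule finite_subset) (use assms(2) in \<open>simp add: free_on_carrier\<close>)
  then show ?thesis using assms(2) by (auto simp: free_on_carrier)
qed

text \<open>
  Given a projective resolution \<open>Q\<close>, let \<open>W k\<close> be free on copies \<open>k - 1\<close> and \<open>k\<close> of \<open>\<nat> \<times> 'p\<close>
  (without the copies \<open>-1\<close> and \<open>n\<close>). Adding the contractible complexes of the identities between the
  copies number \<open>k\<close> in \<open>W k\<close> and in \<open>W (k + 1)\<close> turns \<open>Q k\<close> into \<open>Q k \<oplus> W k\<close>, which the swindle identifies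
  with \<open>W k\<close>. For this \<open>W n\<close> must contain a copy, so \<open>n > 0\<close> is needed.
\<close>

lemma free_resolution_exists:
  fixes Q :: "nat \<Rightarrow> ('r, 'p) module" and M :: "('r, 'm) module"
  assumes R: "ring R" and n: "n > 0"
    and ex: "exact_resolution R n Q d e M" and proj: "\<And>k. k \<le> n \<Longrightarrow> projective R (Q k)"
  shows "\<exists>(B :: nat \<Rightarrow> (nat \<times> nat \<times> 'p) set) D e'. free_resolution R n B D e' M"
proof -
  interpret R: ring R by fact
  let ?F = "free_on R (UNIV :: (nat \<times> nat \<times> 'p) set)"
  let ?z = "\<lambda>_. \<zero>\<^bsub>R\<^esub>"
  have M: "left_module R M" and e: "e \<in> lmod_hom R (Q 0) M"
    and es: "e ` carrier (Q 0) = carrier M"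
    and QM: "\<And>k. k \<le> n \<Longrightarrow> left_module R (Q k)"
    and d: "\<And>k. k < n \<Longrightarrow> d k \<in> lmod_hom R (Q (Suc k)) (Q k)"
    and ke: "lmod_kernel (Q 0) M e = d 0 ` carrier (Q 1)"
    and kd: "\<And>k. Suc k < n \<Longrightarrow>
        lmod_kernel (Q (Suc k)) (Q k) (d k) = d (Suc k) ` carrier (Q (Suc (Suc k)))"
    and kn: "\<And>k. Suc k = n \<Longrightarrow> lmod_kernel (Q (Suc k)) (Q k) (d k) = {\<zero>\<^bsub>Q (Suc k)\<^esub>}"
    using ex n unfolding exact_resolution_def by auto
  \<comment> \<open>The swindle needs a copy belonging to \<open>W k\<close>: copy \<open>k\<close>
    serves as long as \<open>k < n\<close>, while \<open>W n\<close> contains only copy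
    \<open>n - 1\<close>.\<close>
  define j where "j k = min k (n - 1)" for k
  define B where "B k = {b :: nat \<times> nat \<times> 'p. fst b < n \<and> (fst b = k \<or> Suc (fst b) = k)}" for k
  define split where "split k \<pi> T c \<longleftrightarrow> \<pi> \<in> lmod_hom R ?F (Q k) \<and> T \<in> lmod_hom R ?F ?F \<and>
    (\<forall>x\<in>carrier (Q k). \<forall>w\<in>carrier ?F. c x w \<in> carrier ?F \<and> \<pi> (c x w) = x \<and> T (c x w) = w) \<and>
    (\<forall>w\<in>carrier ?F. c (\<pi> w) (T w) = w) \<and>
    (\<forall>x w b. fst b \<noteq> j k \<longrightarrow> T w b = w b \<and> c x w b = w b)" for k \<pi> T c
  have "\<exists>\<pi> T c. split k \<pi> T c" if "k \<le> n" for k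
    using swindle[OF R proj[OF that], of "j k"] unfolding split_def .
  then obtain \<pi> T c where split: "\<And>k. k \<le> n \<Longrightarrow> split k (\<pi> k) (T k) (c k)" by metis
  have piF: "\<pi> k \<in> lmod_hom R ?F (Q k)" and TF: "T k \<in> lmod_hom R ?F ?F" if "k \<le> n" for k
    using split[OF that] unfolding split_def by (rule conjunct1 | rule conjunct2[THEN conjunct1])+
  have cF: "c k x w \<in> carrier ?F" "\<pi> k (c k x w) = x" "T k (c k x w) = w"
    if "k \<le> n" "x \<in> carrier (Q k)" "w \<in> carrier ?F" for k x w
    using split[OF that(1), unfolded split_def, THEN conjunct2, THEN conjunct2, THEN conjunct1] that(2,3)
    by simp_all
  have cTF: "c k (\<pi> k w) (T k w) = w" if "k \<le> n" "w \<in> carrier ?F" for k w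
    using split[OF that(1), unfolded split_def, THEN conjunct2, THEN conjunct2, THEN conjunct2, THEN conjunct1]
      that(2) by simp
  have off: "T k w b = w b" "c k x w b = w b" if "k \<le> n" "fst b \<noteq> j k" for k x w b
    using split[OF that(1), unfolded split_def, THEN conjunct2, THEN conjunct2, THEN conjunct2, THEN conjunct2]
      that(2) by blast+
  define W where "W k = carrier (free_on R (B k))" for k
  have WF: "w \<in> carrier ?F" if "w \<in> W k" for w k
    using that unfolding W_def by (rule free_on_mono[rotated]) simp
  have WI: "w \<in> W k" if "w \<in> carrier ?F" "\<And>b. b \<notin> B k \<Longrightarrow> w b = \<zero>\<^bsub>R\<^esub>" for w k
    using that by (simp add: W_def free_on_carrier)
  have W0: "w b = \<zero>\<^bsub>R\<^esub>" if "w \<in> W k" "b \<notin> B k" for w k b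
    using that unfolding W_def free_on_carrier by blast
  have jB: "fst b \<noteq> j k" if "b \<notin> B k" "k \<le> n" for b k
    using that n by (auto simp: B_def j_def)
  have pi: "\<pi> k w \<in> carrier (Q k)" if "k \<le> n" "w \<in> W k" for k w
    by (rule lmod_homD(1)[OF piF[OF that(1)] WF[OF that(2)]])
  have T: "T k w \<in> W k" if "k \<le> n" "w \<in> W k" for k w
    using off(1)[OF that(1) jB[OF _ that(1)]] W0[OF that(2)]
    by (intro WI lmod_homD(1)[OF TF[OF that(1)] WF[OF that(2)]]) simp
  have c: "c k x w \<in> W k" if "k \<le> n" "x \<in> carrier (Q k)" "w \<in> W k" for k x w
    using off(2)[OF that(1) jB[OF _ that(1)]] W0[OF that(3)]
    by (intro WI cF(1)[OF that(1,2) WF[OF that(3)]]) simp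
  have pc: "\<pi> k (c k x w) = x" and Tc: "T k (c k x w) = w"
    if "k \<le> n" "x \<in> carrier (Q k)" "w \<in> W k" for k x w
    using cF(2,3)[OF that(1,2) WF[OF that(3)]] .
  have cpT: "c k (\<pi> k w) (T k w) = w" if "k \<le> n" "w \<in> W k" for k w
    by (rule cTF[OF that(1) WF[OF that(2)]])
  have pi_hom: "\<pi> k \<in> lmod_hom R (free_on R (B k)) (Q k)" if "k \<le> n" for k
    using lmod_homD(2,3)[OF piF[OF that]] pi[OF that] WF[of _ k]
    by (intro lmod_homI) (auto simp flip: W_def)
  have T_hom: "T k \<in> lmod_hom R (free_on R (B k)) (free_on R (B k))" if "k \<le> n" for k
    using lmod_homD(2,3)[OF TF[OF that]] T[OF that] WF[of _ k]
    by (intro lmod_homI) (auto simp flip: W_def)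
  have inj: "w = w'" if "k \<le> n" "w \<in> W k" "w' \<in> W k" "\<pi> k w = \<pi> k w'" "T k w = T k w'" for k w w'
    using cpT[OF that(1,2)] cpT[OF that(1,3)] that(4,5) by metis
  \<comment> \<open>For \<open>k < n\<close>, copy \<open>k\<close> is the one shared by
    \<open>W (Suc k)\<close> and \<open>W k\<close>; the projection \<open>r k\<close> onto it is
    the differential of the contractible part.\<close>
  define r where "r k w = (\<lambda>b. if b \<in> {b. fst b = k} then w b else \<zero>\<^bsub>R\<^esub>)" for k and w :: "nat \<times> nat \<times> 'p \<Rightarrow> 'r"
  have r: "r k w \<in> W k" "r k w \<in> W (Suc k)" if "w \<in> W (Suc k)" "k < n" for k w
  proof -
    have rc: "r k w \<in> carrier (free_on R (B (Suc k) \<inter> {b. fst b = k}))"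
      unfolding r_def by (rule free_on_restrict[OF R]) (use that in \<open>simp add: W_def\<close>)
    have "B (Suc k) \<inter> {b. fst b = k} \<subseteq> B k" using that(2) by (auto simp: B_def)
    then show "r k w \<in> W k" unfolding W_def using rc by (rule free_on_mono)
    show "r k w \<in> W (Suc k)" unfolding W_def using Int_lower1 rc by (rule free_on_mono)
  qed
  \<comment> \<open>The map \<open>d k \<oplus> r k\<close>, transported along the identification of
    \<open>W\<close> with \<open>Q \<oplus> W\<close> by \<open>\<pi>\<close> and \<open>T\<close>.
    For \<open>k \<ge> n\<close> its source \<open>W (Suc k)\<close> is zero.\<close>
  define D where "D k w = (if k < n then c k (d k (\<pi> (Suc k) w)) (r k (T (Suc k) w)) else ?z)" for k w
  have zW: "?z \<in> W k" for k unfolding W_def by (rule free_on_zero[OF R])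
  have dp: "d k (\<pi> (Suc k) w) \<in> carrier (Q k)" if "k < n" "w \<in> W (Suc k)" for k w
    using lmod_homD(1)[OF d[OF that(1)]] pi that by simp
  have D: "D k w \<in> W k" if "w \<in> W (Suc k)" for k w
    using that by (simp add: D_def zW c dp r T)
  have pD: "\<pi> k (D k w) = d k (\<pi> (Suc k) w)" and TD: "T k (D k w) = r k (T (Suc k) w)"
    if "k < n" "w \<in> W (Suc k)" for k w
    using that by (simp_all add: D_def pc Tc dp r T)
  have FM: "left_module R (free_on R (B k))" for k by (rule free_on_left_module[OF R])
  have D_hom: "D k \<in> lmod_hom R (free_on R (B (Suc k))) (free_on R (B k))" for k
  proof (cases "k < n")
    case True
    then have k: "k \<le> n" "Suc k \<le> n" by auto
    note h = lmod_homD(2,3)[OF pi_hom[OF k(1)], folded W_def] lmod_homD(2,3)[OF T_hom[OF k(1)], folded W_def]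
      lmod_homD(2,3)[OF pi_hom[OF k(2)], folded W_def] lmod_homD(2,3)[OF T_hom[OF k(2)], folded W_def]
      lmod_homD(2,3)[OF d[OF True]]
    interpret FS: left_module R "free_on R (B (Suc k))" by (rule FM)
    interpret Fk: left_module R "free_on R (B k)" by (rule FM)
    have r_add: "r k (x \<oplus>\<^bsub>free_on R (B (Suc k))\<^esub> y) = r k x \<oplus>\<^bsub>free_on R (B k)\<^esub> r k y"
      if "x \<in> W (Suc k)" "y \<in> W (Suc k)" for x y
      by (auto simp: r_def fun_eq_iff)
    have r_smult: "r k (a \<odot>\<^bsub>free_on R (B (Suc k))\<^esub> x) = a \<odot>\<^bsub>free_on R (B k)\<^esub> r k x"
      if "a \<in> carrier R" for a x
      using that by (auto simp: r_def fun_eq_iff)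
    show ?thesis
    proof (rule lmod_homI)
      fix x assume x: "x \<in> carrier (free_on R (B (Suc k)))"
      then have xW: "x \<in> W (Suc k)" by (simp add: W_def)
      show "D k x \<in> carrier (free_on R (B k))" using D[OF xW] by (simp add: W_def)
      show "D k (x \<oplus>\<^bsub>free_on R (B (Suc k))\<^esub> y) = D k x \<oplus>\<^bsub>free_on R (B k)\<^esub> D k y"
        if y: "y \<in> carrier (free_on R (B (Suc k)))" for y
      proof -
        have yW: "y \<in> W (Suc k)" using y by (simp add: W_def)
        have sW: "x \<oplus>\<^bsub>free_on R (B (Suc k))\<^esub> y \<in> W (Suc k)"
          using FS.M.a_closed[OF x y] by (simp only: W_def)
        have DW: "D k x \<oplus>\<^bsub>free_on R (B k)\<^esub> D k y \<in> W k"
          using Fk.M.a_closed[of "D k x" "D k y"] D[OF xW] D[OF yW] by (simp only: W_def)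
        show ?thesis
        \<comment> \<open>\<open>c\<close> is given only as an inverse map, so linearity is checked
          on the components under \<open>\<pi> k\<close> and \<open>T k\<close>, which jointly
          separate points.\<close>
        proof (rule inj[OF k(1) D[OF sW] DW])
          show "\<pi> k (D k (x \<oplus>\<^bsub>free_on R (B (Suc k))\<^esub> y)) = \<pi> k (D k x \<oplus>\<^bsub>free_on R (B k)\<^esub> D k y)"
            unfolding pD[OF True sW] h(1)[OF D[OF xW] D[OF yW]] pD[OF True xW] pD[OF True yW]
              h(5)[OF xW yW] by (rule h(9)) (use pi k xW yW in auto)
          show "T k (D k (x \<oplus>\<^bsub>free_on R (B (Suc k))\<^esub> y)) = T k (D k x \<oplus>\<^bsub>free_on R (B k)\<^esub> D k y)"
            unfolding TD[OF True sW] h(3)[OF D[OF xW] D[OF yW]] TD[OF True xW] TD[OF True yW]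
              h(7)[OF xW yW] by (rule r_add) (use T k xW yW in auto)
        qed
      qed
      fix a assume a: "a \<in> carrier R"
      have sW: "a \<odot>\<^bsub>free_on R (B (Suc k))\<^esub> x \<in> W (Suc k)"
        using FS.smult_closed[OF a x] by (simp only: W_def)
      have DW: "a \<odot>\<^bsub>free_on R (B k)\<^esub> D k x \<in> W k"
        using Fk.smult_closed[of a "D k x"] D[OF xW] a by (simp only: W_def)
      show "D k (a \<odot>\<^bsub>free_on R (B (Suc k))\<^esub> x) = a \<odot>\<^bsub>free_on R (B k)\<^esub> D k x"
      proof (rule inj[OF k(1) D[OF sW] DW])
        show "\<pi> k (D k (a \<odot>\<^bsub>free_on R (B (Suc k))\<^esub> x)) = \<pi> k (a \<odot>\<^bsub>free_on R (B k)\<^esub> D k x)"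
          unfolding pD[OF True sW] h(2)[OF a D[OF xW]] pD[OF True xW] h(6)[OF a xW]
          by (rule h(10)) (use a pi k xW in auto)
        show "T k (D k (a \<odot>\<^bsub>free_on R (B (Suc k))\<^esub> x)) = T k (a \<odot>\<^bsub>free_on R (B k)\<^esub> D k x)"
          unfolding TD[OF True sW] h(4)[OF a D[OF xW]] TD[OF True xW] h(8)[OF a xW]
          by (rule r_smult[OF a])
      qed
    qed
  next
    case False
    then show ?thesis by (intro lmod_homI) (simp_all add: D_def free_on_zero[OF R])
  qed
  have z0: "\<pi> k ?z = \<zero>\<^bsub>Q k\<^esub>" "T k ?z = ?z" if "k \<le> n" for k
    using lmod_hom_zero[OF FM QM pi_hom] lmod_hom_zero[OF FM FM T_hom] that by simp_all
  have eq0: "w = ?z" if "k \<le> n" "w \<in> W k" "\<pi> k w = \<zero>\<^bsub>Q k\<^esub>" "T k w = ?z" for k w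
    by (rule inj[OF that(1,2) zW]) (use that z0 in auto)
  have r0: "r k (r (Suc k) w) = ?z" "r k ?z = ?z" for k w by (auto simp: r_def)
  have r_id: "r k w = w" if "w \<in> W k" "\<And>b. Suc (fst b) = k \<Longrightarrow> w b = \<zero>\<^bsub>R\<^esub>" for k w
  proof
    show "r k w b = w b" for b
      using W0[OF that(1), of b] that(2)[of b]
      by (cases "fst b = k"; cases "Suc (fst b) = k") (auto simp: r_def B_def)
  qed
  have kerD: "lmod_kernel (free_on R (B (Suc k))) (free_on R (B k)) (D k) = D (Suc k) ` W (Suc (Suc k))"
    (is "?K = _") for k
  proof -
    have K: "w \<in> ?K \<longleftrightarrow> w \<in> W (Suc k) \<and> D k w = ?z" for w by (simp add: lmod_kernel_def W_def)
    consider "Suc k < n" | "Suc k = n" | "n \<le> k" by linarith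
    then show ?thesis
    proof cases
      case 1
      then have k: "k < n" "k \<le> n" "Suc k \<le> n" "Suc (Suc k) \<le> n" by auto
      have "w \<in> D (Suc k) ` W (Suc (Suc k))" if "w \<in> ?K" for w
      proof -
        have w: "w \<in> W (Suc k)" "D k w = ?z" using that K by auto
        have "d k (\<pi> (Suc k) w) = \<zero>\<^bsub>Q k\<^esub>" using pD[OF k(1) w(1)] w(2) z0 k by simp
        then have "\<pi> (Suc k) w \<in> lmod_kernel (Q (Suc k)) (Q k) (d k)"
          using pi k w by (simp add: lmod_kernel_def)
        then obtain x where x: "x \<in> carrier (Q (Suc (Suc k)))" "\<pi> (Suc k) w = d (Suc k) x"
          using kd[OF 1] by auto
        let ?y = "T (Suc k) w"
        have "r k ?y = ?z" using TD[OF k(1) w(1)] w(2) z0 k by simp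
        then have "?y b = \<zero>\<^bsub>R\<^esub>" if "fst b = k" for b using that by (metis (mono_tags) r_def mem_Collect_eq)
        \<comment> \<open>An element of \<open>W (Suc k)\<close> killed by \<open>r k\<close> lives
          on copy \<open>Suc k\<close>; hence it also belongs to \<open>W (Suc (Suc k))\<close> and
          is its own preimage under \<open>r (Suc k)\<close>.\<close>
        then have y: "r (Suc k) ?y = ?y" by (intro r_id) (use T k w in auto)
        have yW: "?y \<in> W (Suc k)" using T k w by auto
        then have yW': "?y \<in> W (Suc (Suc k))"
        proof -
          have "?y \<in> carrier (free_on R (B (Suc k) \<inter> {b. fst b = Suc k}))"
            using free_on_restrict[OF R, of ?y "B (Suc k)" "{b. fst b = Suc k}"] yW y
            by (simp add: W_def r_def)
          moreover have "B (Suc k) \<inter> {b. fst b = Suc k} \<subseteq> B (Suc (Suc k))" by (auto simp: B_def)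
          ultimately show ?thesis unfolding W_def by (rule free_on_mono[rotated])
        qed
        let ?w = "c (Suc (Suc k)) x ?y"
        have wW: "?w \<in> W (Suc (Suc k))" by (rule c[OF k(4) x(1) yW'])
        have "D (Suc k) ?w = w"
          by (rule inj[OF k(3) D[OF wW] w(1)])
            (use 1 wW pD TD pc[OF k(4) x(1) yW'] Tc[OF k(4) x(1) yW'] x(2) y in auto)
        then show ?thesis using wW by (metis image_eqI)
      qed
      moreover have "D (Suc k) w \<in> ?K" if w: "w \<in> W (Suc (Suc k))" for w
      proof -
        have "d (Suc k) (\<pi> (Suc (Suc k)) w) \<in> lmod_kernel (Q (Suc k)) (Q k) (d k)"
          unfolding kd[OF 1] using pi[OF k(4) w] by blast
        then have "d k (d (Suc k) (\<pi> (Suc (Suc k)) w)) = \<zero>\<^bsub>Q k\<^esub>" by (simp add: lmod_kernel_def)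
        then have "\<pi> k (D k (D (Suc k) w)) = \<zero>\<^bsub>Q k\<^esub>"
          by (simp only: pD[OF k(1) D[OF w]] pD[OF 1 w])
        moreover have "T k (D k (D (Suc k) w)) = ?z"
          by (simp only: TD[OF k(1) D[OF w]] TD[OF 1 w] r0)
        ultimately have "D k (D (Suc k) w) = ?z"
          by (rule eq0[OF k(2) D[OF D[OF w]]])
        then show ?thesis using D[OF w] unfolding K by (rule conjI[rotated])
      qed
      ultimately show ?thesis by (intro equalityI subsetI) auto
    next
      case 2
      then have k: "k < n" "k \<le> n" "Suc k \<le> n" by auto
      have "w = ?z" if "w \<in> ?K" for w
      proof -
        have w: "w \<in> W (Suc k)" "D k w = ?z" using that K by auto
        have "d k (\<pi> (Suc k) w) = \<zero>\<^bsub>Q k\<^esub>" using pD[OF k(1) w(1)] w(2) z0 k by simp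
        then have "\<pi> (Suc k) w \<in> lmod_kernel (Q (Suc k)) (Q k) (d k)"
          using pi k w by (simp add: lmod_kernel_def)
        then have p0: "\<pi> (Suc k) w = \<zero>\<^bsub>Q (Suc k)\<^esub>" using kn[OF 2] by simp
        let ?y = "T (Suc k) w"
        have "r k ?y = ?z" using TD[OF k(1) w(1)] w(2) z0 k by simp
        then have "?y b = \<zero>\<^bsub>R\<^esub>" if "fst b = k" for b using that by (metis (mono_tags) r_def mem_Collect_eq)
        \<comment> \<open>Here \<open>Suc k = n\<close> and there is no copy \<open>n\<close>, so
          copy \<open>k\<close> is all of \<open>W n\<close> and \<open>r k\<close> is injective on
          it.\<close>
        moreover have "?y b = \<zero>\<^bsub>R\<^esub>" if "fst b \<noteq> k" for b
          by (rule W0[OF T[OF k(3) w(1)]]) (use that 2 in \<open>auto simp: B_def\<close>)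
        ultimately have "?y b = \<zero>\<^bsub>R\<^esub>" for b by (cases "fst b = k")
        then have "?y = ?z" by (rule ext)
        then show ?thesis by (rule eq0[OF k(3) w(1) p0])
      qed
      moreover have "?z \<in> ?K"
        using K zW lmod_hom_zero[OF FM FM D_hom] by simp
      moreover have "D (Suc k) ` W (Suc (Suc k)) = {?z}"
        using 2 zW by (auto simp: D_def)
      ultimately have "?K = {?z}" "D (Suc k) ` W (Suc (Suc k)) = {?z}" by blast+
      then show ?thesis by simp
    next
      case 3
      then have "B (Suc k) = {}" by (auto simp: B_def)
      then have "W (Suc k) = {?z}" by (simp add: W_def free_on_empty[OF R])
      then have "?K = {?z}" using K 3 by (auto simp: D_def)
      moreover have "D (Suc k) ` W (Suc (Suc k)) = {?z}" using 3 zW by (auto simp: D_def)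
      ultimately show ?thesis by simp
    qed
  qed
  define e' where "e' w = e (\<pi> 0 w)" for w
  have e': "e' \<in> lmod_hom R (free_on R (B 0)) M"
    unfolding e'_def by (rule lmod_hom_comp[OF pi_hom e]) simp
  have es': "e' ` W 0 = carrier M"
  proof -
    have "\<pi> 0 ` W 0 = carrier (Q 0)"
    proof
      show "\<pi> 0 ` W 0 \<subseteq> carrier (Q 0)" using pi by auto
      show "carrier (Q 0) \<subseteq> \<pi> 0 ` W 0"
        using pc[OF _ _ zW, of 0] c[OF _ _ zW, of 0] by (metis image_eqI subsetI zero_le)
    qed
    then show ?thesis using es unfolding e'_def by (metis image_image)
  qed
  have kere: "lmod_kernel (free_on R (B 0)) M e' = D 0 ` W 1" (is "?K = _")
  proof -
    have K: "w \<in> ?K \<longleftrightarrow> w \<in> W 0 \<and> e (\<pi> 0 w) = \<zero>\<^bsub>M\<^esub>" for w by (simp add: lmod_kernel_def W_def e'_def)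
    have "w \<in> D 0 ` W 1" if "w \<in> ?K" for w
    proof -
      have w: "w \<in> W 0" "e (\<pi> 0 w) = \<zero>\<^bsub>M\<^esub>" using that K by auto
      then have "\<pi> 0 w \<in> lmod_kernel (Q 0) M e" using pi by (simp add: lmod_kernel_def)
      then obtain x where x: "x \<in> carrier (Q (Suc 0))" "\<pi> 0 w = d 0 x" using ke by auto
      let ?y = "T 0 w"
      have yW: "?y \<in> W 0" using T w by auto
      \<comment> \<open>There is no copy \<open>-1\<close>: \<open>W 0\<close> lives on copy 0
        alone, where \<open>r 0\<close> is the identity, so \<open>?y\<close> lifts to degree 1
        unchanged.\<close>
      have y: "r 0 ?y = ?y" by (rule r_id[OF yW]) simp
      have yW': "?y \<in> W (Suc 0)"
        using yW unfolding W_def by (rule free_on_mono[rotated]) (auto simp: B_def)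
      let ?w = "c (Suc 0) x ?y"
      have n1: "Suc 0 \<le> n" using n by simp
      have wW: "?w \<in> W (Suc 0)" by (rule c[OF n1 x(1) yW'])
      have "D 0 ?w = w"
        by (rule inj[OF _ D[OF wW] w(1)])
          (use n wW pD TD pc[OF n1 x(1) yW'] Tc[OF n1 x(1) yW'] x(2) y in auto)
      then show ?thesis using wW by (metis image_eqI One_nat_def)
    qed
    moreover have "D 0 w \<in> ?K" if w: "w \<in> W 1" for w
    proof -
      have "d 0 (\<pi> 1 w) \<in> lmod_kernel (Q 0) M e" unfolding ke using pi[of 1] n w by auto
      then show ?thesis using K D[of w 0] w pD[of 0 w] n by (simp add: lmod_kernel_def)
    qed
    ultimately show ?thesis by blast
  qed
  have "free_resolution R n B D e' M"
    unfolding free_resolution_def W_def[symmetric]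
    using M e' es' D_hom kere kerD by (auto simp: B_def)
  then show ?thesis by blast
qed

section \<open>Small extensions of good sets\<close>

lemma card_of_UN_ordLeq:
  assumes "Card_order \<kappa>" "infinite (Field \<kappa>)" "|I| \<le>o \<kappa>" "\<And>i. i \<in> I \<Longrightarrow> |A i| \<le>o \<kappa>"
  shows "|\<Union>i\<in>I. A i| \<le>o \<kappa>"
  using assms by (intro card_of_UNION_ordLeq_infinite_Field) auto

lemma card_of_countable_ordLeq:
  assumes "Card_order \<kappa>" "infinite (Field \<kappa>)" "countable A"
  shows "|A| \<le>o \<kappa>"
proof -
  have "|A| \<le>o |UNIV :: nat set|"
    using assms(3) unfolding countable_def card_of_ordLeq[symmetric] by auto
  also have "|UNIV :: nat set| \<le>o |Field \<kappa>|" using assms(2) by (simp add: infinite_iff_card_of_nat)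
  finally show ?thesis using card_of_Field_ordIso[OF assms(1)] ordLeq_ordIso_trans by blast
qed

lemma card_of_finite_ordLeq:
  assumes "Card_order \<kappa>" "infinite (Field \<kappa>)" "finite A"
  shows "|A| \<le>o \<kappa>"
  by (rule card_of_countable_ordLeq[OF assms(1,2) countable_finite[OF assms(3)]])

lemma card_of_lists_ordLeq:
  assumes "Card_order \<kappa>" "infinite (Field \<kappa>)" "|W| \<le>o \<kappa>"
  shows "|lists W| \<le>o \<kappa>"
proof -
  have "|{l. set l \<subseteq> W \<and> length l = k}| \<le>o \<kappa>" for k
  proof (induction k)
    case 0
    show ?case by (rule card_of_finite_ordLeq[OF assms(1,2)]) simp
  next
    case (Suc k)
    let ?L = "{l. set l \<subseteq> W \<and> length l = k}"
    have "{l. set l \<subseteq> W \<and> length l = Suc k} \<subseteq> (\<lambda>(x, l). x # l) ` (W \<times> ?L)"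
      by (auto simp: length_Suc_conv)
    then have "|{l. set l \<subseteq> W \<and> length l = Suc k}| \<le>o |W \<times> ?L|"
      by (rule surj_imp_ordLeq)
    also have "|W \<times> ?L| \<le>o \<kappa>"
      using assms Suc by (intro card_of_Times_ordLeq_infinite_Field) auto
    finally show ?case .
  qed
  then have "|\<Union>k. {l. set l \<subseteq> W \<and> length l = k}| \<le>o \<kappa>"
    by (intro card_of_UN_ordLeq[OF assms(1,2) card_of_countable_ordLeq[OF assms(1,2)]]) auto
  moreover have "(\<Union>k. {l. set l \<subseteq> W \<and> length l = k}) = lists W" by auto
  ultimately show ?thesis by simp
qed

text \<open>The arguments of \<open>f\<close> are finite lists, so \<omega> rounds suffice: a list
  over the union of the increasing stages has all its entries in one stage, and its values are added
  in the next.\<close>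

lemma closure_ordLeq:
  fixes f :: "'a list \<Rightarrow> 'a set"
  assumes \<kappa>: "Card_order \<kappa>" "infinite (Field \<kappa>)" and A: "|A| \<le>o \<kappa>" and f: "\<And>l. |f l| \<le>o \<kappa>"
  shows "\<exists>W. A \<subseteq> W \<and> |W| \<le>o \<kappa> \<and> (\<forall>l. set l \<subseteq> W \<longrightarrow> f l \<subseteq> W)"
proof -
  define V where "V k = ((\<lambda>W. W \<union> (\<Union>l\<in>lists W. f l)) ^^ k) A" for k
  have V: "V 0 = A" "V (Suc k) = V k \<union> (\<Union>l\<in>lists (V k). f l)" for k by (simp_all add: V_def)
  have "|V k| \<le>o \<kappa>" for k
  proof (induction k)
    case (Suc k)
    have "|\<Union>l\<in>lists (V k). f l| \<le>o \<kappa>"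
      by (intro card_of_UN_ordLeq[OF \<kappa>] card_of_lists_ordLeq[OF \<kappa>] Suc f)
    then show ?case unfolding V by (intro card_of_Un_ordLeq_infinite_Field \<kappa> Suc)
  qed (simp add: V A)
  then have card: "|\<Union>k. V k| \<le>o \<kappa>"
    by (intro card_of_UN_ordLeq[OF \<kappa> card_of_countable_ordLeq[OF \<kappa>]]) auto
  have mono: "V k \<subseteq> V k'" if "k \<le> k'" for k k' using that by (induction rule: dec_induct) (auto simp: V)
  have "f l \<subseteq> (\<Union>k. V k)" if l: "set l \<subseteq> (\<Union>k. V k)" for l
  proof -
    have "\<exists>k. set l \<subseteq> V k"
      using l
    proof (induction l)
      case (Cons x l)
      then obtain k k' where "set l \<subseteq> V k" "x \<in> V k'" by auto
      then have "set (x # l) \<subseteq> V (max k k')" using mono[of k "max k k'"] mono[of k' "max k k'"] by auto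
      then show ?case by blast
    qed simp
    then obtain k where "l \<in> lists (V k)" by auto
    then have "f l \<subseteq> V (Suc k)" by (auto simp: V)
    then show ?thesis by blast
  qed
  then show ?thesis using card V(1) by (intro exI[of _ "\<Union>k. V k"]) auto
qed

text \<open>Bounds the number of witnesses demanded by one finite set of basis elements. Each
  further basis element multiplies the number of coefficient functions by at most the size of
  \<open>R\<close>.\<close>

lemma card_of_free_on_ordLeq:
  assumes ring: "ring R"
    and \<kappa>: "Card_order \<kappa>" "infinite (Field \<kappa>)" and R: "|carrier R| \<le>o \<kappa>" and S: "finite S"
  shows "|carrier (free_on R S)| \<le>o \<kappa>"
  using S
proof (induction S rule: finite_induct)
  case empty
  have "carrier (free_on R {}) \<subseteq> {\<lambda>_. \<zero>\<^bsub>R\<^esub>}" by (auto simp: free_on_carrier)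
  then have "finite (carrier (free_on R {}))" by (rule finite_subset) simp
  then show ?case by (rule card_of_finite_ordLeq[OF \<kappa>])
next
  case (insert b S)
  have "carrier (free_on R (insert b S)) \<subseteq> (\<lambda>(a, z). z(b := a)) ` (carrier R \<times> carrier (free_on R S))"
  proof
    fix z assume z: "z \<in> carrier (free_on R (insert b S))"
    have "{b'. (z(b := \<zero>\<^bsub>R\<^esub>)) b' \<noteq> \<zero>\<^bsub>R\<^esub>} \<subseteq> {b. z b \<noteq> \<zero>\<^bsub>R\<^esub>}" by auto
    then have "finite {b'. (z(b := \<zero>\<^bsub>R\<^esub>)) b' \<noteq> \<zero>\<^bsub>R\<^esub>}"
      by (rule finite_subset) (use z in \<open>simp add: free_on_carrier\<close>)
    moreover have "\<zero>\<^bsub>R\<^esub> \<in> carrier R" using ring by (rule ring.ring_simprules(2))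
    ultimately have "z(b := \<zero>\<^bsub>R\<^esub>) \<in> carrier (free_on R S)"
      using z by (simp add: free_on_carrier)
    moreover have "z b \<in> carrier R" using z by (simp add: free_on_carrier)
    ultimately show "z \<in> (\<lambda>(a, z). z(b := a)) ` (carrier R \<times> carrier (free_on R S))"
      by (intro image_eqI[of _ _ "(z b, z(b := \<zero>\<^bsub>R\<^esub>))"]) simp_all
  qed
  then have "|carrier (free_on R (insert b S))| \<le>o |carrier R \<times> carrier (free_on R S)|"
    by (rule surj_imp_ordLeq)
  also have "|carrier R \<times> carrier (free_on R S)| \<le>o \<kappa>"
    using \<kappa> R insert.IH by (intro card_of_Times_ordLeq_infinite_Field) auto
  finally show ?case .
qed

section \<open>Good families for a system of additive relations\<close>

definition slice :: "('i \<times> 'b) set \<Rightarrow> 'i \<Rightarrow> 'b set" where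
  "slice S i = {b. (i, b) \<in> S}"

text \<open>\<open>B\<close> is a disjoint union of bases tagged by \<open>'i\<close>, and each
  \<open>\<rho> i i'\<close> is an additive relation between two of the free modules: closure under
  differences makes it a subgroup of their product once it is nonempty. Countability of
  \<open>'i\<close> keeps the union over all index pairs within \<kappa>.\<close>

locale relation_system =
  fixes R :: "('r, 'z) ring_scheme" and B :: "('i :: countable \<times> 'b) set"
    and \<rho> :: "'i \<Rightarrow> 'i \<Rightarrow> ('b \<Rightarrow> 'r) \<Rightarrow> ('b \<Rightarrow> 'r) \<Rightarrow> bool"
  assumes ring: "ring R"
    and rho_diff: "\<lbrakk>w \<in> carrier (free_on R (slice B i)); w' \<in> carrier (free_on R (slice B i));
      z \<in> carrier (free_on R (slice B i')); z' \<in> carrier (free_on R (slice B i'));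
      \<rho> i i' w z; \<rho> i i' w' z'\<rbrakk> \<Longrightarrow> \<rho> i i' (\<lambda>b. w b \<ominus>\<^bsub>R\<^esub> w' b) (\<lambda>b. z b \<ominus>\<^bsub>R\<^esub> z' b)"
begin

abbreviation F :: "('i \<times> 'b) set \<Rightarrow> 'i \<Rightarrow> ('b \<Rightarrow> 'r) set" where
  "F S i \<equiv> carrier (free_on R (slice S i))"

text \<open>The condition of an elementary substructure for the formulas
  \<open>\<exists>z. \<rho> i i' w z\<close> with parameter \<open>w\<close> in the span of
  \<open>S\<close>: what is solvable over \<open>B\<close> is already solvable over
  \<open>S\<close>.\<close>

definition good :: "('i \<times> 'b) set \<Rightarrow> bool" where
  "good S \<longleftrightarrow> S \<subseteq> B \<and> (\<forall>i i'. \<forall>w\<in>F S i. (\<exists>z\<in>F B i'. \<rho> i i' w z) \<longrightarrow> (\<exists>z\<in>F S i'. \<rho> i i' w z))"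

lemma F_mono: "S \<subseteq> S' \<Longrightarrow> z \<in> F S i \<Longrightarrow> z \<in> F S' i"
  by (erule free_on_mono[rotated]) (auto simp: slice_def)

lemma F_zero: "(\<lambda>_. \<zero>\<^bsub>R\<^esub>) \<in> F S i"
  by (rule free_on_zero[OF ring])

lemma F_add:
  assumes "w \<in> F S i" "z \<in> F S i" shows "(\<lambda>b. w b \<oplus>\<^bsub>R\<^esub> z b) \<in> F S i"
  using abelian_monoid.a_closed[OF abelian_group.axioms(1)[OF left_module.axioms(2)[OF
    free_on_left_module[OF ring]]] assms] by (simp only: free_on_ops)

lemma F_diff:
  assumes "w \<in> F S i" "z \<in> F S i" shows "(\<lambda>b. w b \<ominus>\<^bsub>R\<^esub> z b) \<in> F S i"
  using left_module.mdiff_closed[OF free_on_left_module[OF ring] assms]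
  by (simp only: mdiff_free_on[OF ring assms])

lemma F_val: "z \<in> F S i \<Longrightarrow> z b \<in> carrier R"
  by (simp add: free_on_carrier)

text \<open>The finite support of \<open>w\<close> lies in a single member of the chain.\<close>

lemma F_Union:
  assumes "subset.chain UNIV \<C>" "\<C> \<noteq> {}" and w: "w \<in> F (\<Union>\<C>) i"
  shows "\<exists>S\<in>\<C>. w \<in> F S i"
proof -
  let ?A = "{i} \<times> {b. w b \<noteq> \<zero>\<^bsub>R\<^esub>}"
  have "finite ?A" "?A \<subseteq> \<Union>\<C>" using w by (auto simp: free_on_carrier slice_def)
  then obtain S where S: "S \<in> \<C>" "?A \<subseteq> S"
    using finite_subset_Union_chain[OF _ _ assms(2,1)] by metis
  then have "w \<in> F S i" using w by (auto simp: free_on_carrier slice_def)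
  then show ?thesis using S(1) by blast
qed

lemma good_Union:
  assumes chain: "subset.chain UNIV \<C>" and good: "\<And>S. S \<in> \<C> \<Longrightarrow> good S"
  shows "good (\<Union>\<C>)"
proof -
  have "\<exists>z\<in>F (\<Union>\<C>) i'. \<rho> i i' w z" if w: "w \<in> F (\<Union>\<C>) i" and z: "z \<in> F B i'" "\<rho> i i' w z" for i i' w z
  proof (cases "\<C> = {}")
    case True
    interpret ring R by (rule ring)
    have "w = (\<lambda>_. \<zero>\<^bsub>R\<^esub>)" using w True by (simp add: slice_def free_on_empty[OF ring])
    moreover from this have wB: "w \<in> F B i" by (simp add: F_zero)
    ultimately show ?thesis
      using rho_diff[OF wB wB z(1,1,2,2)] F_zero F_val[OF z(1)] by (auto simp: r_neg a_minus_def)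
  next
    case False
    then obtain S where S: "S \<in> \<C>" "w \<in> F S i" using F_Union[OF chain _ w] by blast
    then obtain z where "z \<in> F S i'" "\<rho> i i' w z" using good[OF S(1)] S(2) z unfolding good_def by blast
    then show ?thesis using F_mono[of S "\<Union>\<C>"] S(1) by blast
  qed
  moreover have "\<Union>\<C> \<subseteq> B" using good unfolding good_def by blast
  ultimately show ?thesis unfolding good_def by blast
qed

text \<open>
  Relative to a good \<open>S\<close>, a witness \<open>W z\<close> for some element of the coset \<open>z + F S i\<close> serves for the whole
  coset, so closing \<open>T\<close> under \<open>W\<close> needs witnesses for the elements of \<open>F T\<close> only, not for those of \<open>F S\<close>.
\<close>

lemma good_extend:
  assumes \<kappa>: "Card_order \<kappa>" "infinite (Field \<kappa>)" and R\<kappa>: "|carrier R| \<le>o \<kappa>"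
    and S: "good S" and A: "A \<subseteq> B" "|A| \<le>o \<kappa>"
  shows "\<exists>T. A \<subseteq> T \<and> |T| \<le>o \<kappa> \<and> good (S \<union> T)"
proof -
  interpret R: ring R by (rule ring)
  define E where "E i i' z w \<longleftrightarrow> w \<in> F B i' \<and> (\<exists>s\<in>F S i. \<rho> i i' (\<lambda>b. z b \<oplus>\<^bsub>R\<^esub> s b) w)" for i i' z w
  define V where "V i i' z = (if \<exists>w. E i i' z w then {i'} \<times> {b. (SOME w. E i i' z w) b \<noteq> \<zero>\<^bsub>R\<^esub>} else {})" for i i' z
  have V: "\<exists>w. E i i' z w \<and> {i'} \<times> {b. w b \<noteq> \<zero>\<^bsub>R\<^esub>} = V i i' z" if "E i i' z w" for i i' z w
    using someI[of "E i i' z", OF that] that by (intro exI[of _ "SOME w. E i i' z w"]) (auto simp: V_def)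
  have Vfin: "finite (V i i' z)" and VB: "V i i' z \<subseteq> B" for i i' z
  proof -
    have "finite (V i i' z) \<and> V i i' z \<subseteq> B"
    proof (cases "\<exists>w. E i i' z w")
      case True
      then obtain w where w: "E i i' z w" "{i'} \<times> {b. w b \<noteq> \<zero>\<^bsub>R\<^esub>} = V i i' z" using V by blast
      have "finite ({i'} \<times> {b. w b \<noteq> \<zero>\<^bsub>R\<^esub>})" "{i'} \<times> {b. w b \<noteq> \<zero>\<^bsub>R\<^esub>} \<subseteq> B"
        using w(1) unfolding E_def free_on_carrier slice_def by auto
      then show ?thesis unfolding w(2) by blast
    qed (simp add: V_def)
    then show "finite (V i i' z)" "V i i' z \<subseteq> B" by auto
  qed
  \<comment> \<open>A list of basis elements calls for witnesses for all pairs of indices and all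
    combinations of the listed elements. Only the supports are recorded, since having them in
    \<open>T\<close> puts the witnesses into its span.\<close>
  define f where "f l = (\<Union>(i, i')\<in>UNIV. \<Union>z\<in>F (set l) i. V i i' z)" for l
  have "|f l| \<le>o \<kappa>" for l
  proof -
    have fin: "finite (slice (set l) i)" for i
    proof -
      have "slice (set l) i \<subseteq> snd ` set l" by (force simp: slice_def)
      then show ?thesis by (rule finite_subset) simp
    qed
    have 1: "|\<Union>z\<in>F (set l) i. V i i' z| \<le>o \<kappa>" for i i'
      by (rule card_of_UN_ordLeq[OF \<kappa> card_of_free_on_ordLeq[OF ring \<kappa> R\<kappa> fin]])
        (rule card_of_finite_ordLeq[OF \<kappa> Vfin])
    show ?thesis unfolding f_def
      by (rule card_of_UN_ordLeq[OF \<kappa> card_of_countable_ordLeq[OF \<kappa>]]) (simp_all add: 1 split_beta)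
  qed
  from closure_ordLeq[OF \<kappa> A(2) this] obtain W where
    "A \<subseteq> W \<and> |W| \<le>o \<kappa> \<and> (\<forall>l. set l \<subseteq> W \<longrightarrow> f l \<subseteq> W)" ..
  then have W: "A \<subseteq> W" "|W| \<le>o \<kappa>" "\<And>l. set l \<subseteq> W \<Longrightarrow> f l \<subseteq> W" by simp_all
  \<comment> \<open>The closure was formed in the whole type. Supports of witnesses lie in
    \<open>B\<close>, so cutting down to \<open>B\<close> loses none of them.\<close>
  define T where "T = W \<inter> B"
  have VT: "V i i' z \<subseteq> T" if z: "z \<in> F T i" for i i' z
  proof -
    have "finite ({i} \<times> {b. z b \<noteq> \<zero>\<^bsub>R\<^esub>})" using z by (simp add: free_on_carrier)
    then obtain l where l: "set l = {i} \<times> {b. z b \<noteq> \<zero>\<^bsub>R\<^esub>}" using finite_list by blast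
    have "z \<in> F (set l) i" using z unfolding l by (simp add: free_on_carrier slice_def)
    then have "V i i' z \<subseteq> f l" by (auto simp: f_def)
    also have "set l \<subseteq> W" using z unfolding l by (auto simp: free_on_carrier slice_def T_def)
    then have "f l \<subseteq> W" by (rule W(3))
    finally show ?thesis using VB by (auto simp: T_def)
  qed
  have "\<exists>z\<in>F (S \<union> T) i'. \<rho> i i' w z" if w: "w \<in> F (S \<union> T) i" and z: "z \<in> F B i'" "\<rho> i i' w z" for i i' w z
  proof -
    \<comment> \<open>Split \<open>w\<close> into its part \<open>s\<close> over \<open>S\<close>
      and a remainder \<open>t\<close> supported in \<open>T\<close>. The witness stored for the
      coset of \<open>t\<close> belongs to some \<open>t + s'\<close>, not necessarily to
      \<open>w = t + s\<close>.\<close>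
    define s where "s b = (if b \<in> slice S i then w b else \<zero>\<^bsub>R\<^esub>)" for b
    define t where "t b = (if b \<in> - slice S i then w b else \<zero>\<^bsub>R\<^esub>)" for b
    have SB: "S \<subseteq> B" "T \<subseteq> B" using S by (auto simp: good_def T_def)
    have "slice (S \<union> T) i \<inter> slice S i = slice S i" "slice (S \<union> T) i \<inter> - slice S i \<subseteq> slice T i"
      by (auto simp: slice_def)
    then have s: "s \<in> F S i" and t: "t \<in> F T i"
      using free_on_restrict[OF ring w, of "slice S i"] free_on_restrict[OF ring w, of "- slice S i"]
      unfolding s_def[abs_def] t_def[abs_def] by (auto intro: free_on_mono)
    have wst: "(\<lambda>b. t b \<oplus>\<^bsub>R\<^esub> s b) = w" using F_val[OF w] by (auto simp: s_def t_def)
    then have "E i i' t z" unfolding E_def using s z by auto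
    then obtain v s' where v: "v \<in> F B i'" "{i'} \<times> {b. v b \<noteq> \<zero>\<^bsub>R\<^esub>} = V i i' t"
      and s': "s' \<in> F S i" "\<rho> i i' (\<lambda>b. t b \<oplus>\<^bsub>R\<^esub> s' b) v"
      using V unfolding E_def by meson
    have "v \<in> F T i'" using v VT[OF t] by (auto simp: free_on_carrier slice_def)
    then have vT: "v \<in> F (S \<union> T) i'" by (rule F_mono[rotated]) simp
    let ?w' = "\<lambda>b. t b \<oplus>\<^bsub>R\<^esub> s' b"
    note B = F_mono[OF SB(1)] F_mono[OF SB(2)]
    have w'B: "?w' \<in> F B i" using F_add[OF B(2)[OF t] B(1)[OF s'(1)]] .
    have wB: "w \<in> F B i" using F_mono[OF _ w] SB by simp
    have eq1: "(\<lambda>b. ?w' b \<ominus>\<^bsub>R\<^esub> w b) = (\<lambda>b. s' b \<ominus>\<^bsub>R\<^esub> s b)"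
    proof
      fix b
      have "t b \<in> carrier R" "s b \<in> carrier R" "s' b \<in> carrier R" using F_val t s s'(1) by blast+
      then show "?w' b \<ominus>\<^bsub>R\<^esub> w b = s' b \<ominus>\<^bsub>R\<^esub> s b"
        unfolding wst[symmetric] by algebra
    qed
    \<comment> \<open>The error \<open>s' - s\<close> lies in \<open>F S i\<close> and has the
      witness \<open>v - z\<close> over \<open>B\<close>, so goodness of \<open>S\<close> yields a
      witness \<open>u\<close> over \<open>S\<close>. Subtracting turns the witness \<open>v\<close>
      for \<open>t + s'\<close> into \<open>v - u\<close> for \<open>w\<close>.\<close>
    have "\<rho> i i' (\<lambda>b. s' b \<ominus>\<^bsub>R\<^esub> s b) (\<lambda>b. v b \<ominus>\<^bsub>R\<^esub> z b)"
      using rho_diff[OF w'B wB v(1) z(1) s'(2) z(2)] unfolding eq1 .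
    then obtain u where u: "u \<in> F S i'" "\<rho> i i' (\<lambda>b. s' b \<ominus>\<^bsub>R\<^esub> s b) u"
      using S F_diff[OF s'(1) s] F_diff[OF v(1) z(1)] unfolding good_def by blast
    have eq2: "(\<lambda>b. ?w' b \<ominus>\<^bsub>R\<^esub> (s' b \<ominus>\<^bsub>R\<^esub> s b)) = w"
    proof
      fix b
      have "t b \<in> carrier R" "s b \<in> carrier R" "s' b \<in> carrier R" using F_val t s s'(1) by blast+
      then show "?w' b \<ominus>\<^bsub>R\<^esub> (s' b \<ominus>\<^bsub>R\<^esub> s b) = w b"
        unfolding wst[symmetric] by algebra
    qed
    have "\<rho> i i' w (\<lambda>b. v b \<ominus>\<^bsub>R\<^esub> u b)"
      using rho_diff[OF w'B B(1)[OF F_diff[OF s'(1) s]] v(1) B(1)[OF u(1)] s'(2) u(2)] unfolding eq2 .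
    moreover have "(\<lambda>b. v b \<ominus>\<^bsub>R\<^esub> u b) \<in> F (S \<union> T) i'"
      using F_diff[OF vT F_mono[OF _ u(1)]] by simp
    ultimately show ?thesis by blast
  qed
  moreover have "|T| \<le>o \<kappa>" unfolding T_def
    using W(2) card_of_mono1[of "W \<inter> B" W] ordLeq_transitive by blast
  moreover have "S \<union> T \<subseteq> B" "A \<subseteq> T" using S W(1) A(1) by (auto simp: good_def T_def)
  ultimately show ?thesis unfolding good_def by blast
qed

end

section \<open>Resolutions by small free modules\<close>

lemma free_rank_one_generator:
  assumes R: "ring R" and c: "c \<in> carrier (free_module R {j})"
  shows "lin_comb R (free_module R {j}) {j} (\<lambda>_. \<lambda>i\<in>{j}. \<one>\<^bsub>R\<^esub>) c = c"
proof -
  interpret R: ring R by fact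
  let ?F = "free_module R {j}"
  have F: "left_module R ?F" by (intro direct_sum_left_module regular_module_left_module R)
  interpret F: left_module R ?F by fact
  have one: "(\<lambda>i\<in>{j}. \<one>\<^bsub>R\<^esub>) \<in> carrier ?F" by (simp add: free_module_simps)
  have cj: "c j \<in> carrier R" using c by (simp add: free_module_simps PiE_iff)
  have "lin_comb R ?F {j} (\<lambda>_. \<lambda>i\<in>{j}. \<one>\<^bsub>R\<^esub>) c = finsum ?F (\<lambda>i. c i \<odot>\<^bsub>?F\<^esub> (\<lambda>i\<in>{j}. \<one>\<^bsub>R\<^esub>)) {j}"
    by (rule lin_comb_superset[OF F]) (use one cj in auto)
  also have "\<dots> = c j \<odot>\<^bsub>?F\<^esub> (\<lambda>i\<in>{j}. \<one>\<^bsub>R\<^esub>)"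
    using F.M.finsum_singleton[of j "{j}" "\<lambda>i. c i \<odot>\<^bsub>?F\<^esub> (\<lambda>i\<in>{j}. \<one>\<^bsub>R\<^esub>)"] one cj by simp
  also have "\<dots> = c"
    using c cj by (auto simp: free_module_simps PiE_iff extensional_def fun_eq_iff)
  finally show ?thesis .
qed

text \<open>A homomorphism from a free module of rank one is fixed by its value at the generator,
  and a preimage of that value defines the lift.\<close>

lemma free_rank_one_projective:
  fixes R :: "('r, 'z) ring_scheme" and j :: 'j
  assumes R: "ring R" shows "projective R (free_module R {j})"
  unfolding projective_def
proof (intro conjI allI impI)
  interpret R: ring R by fact
  let ?F = "free_module R {j}" and ?u = "\<lambda>i\<in>{j}. \<one>\<^bsub>R\<^esub>"
  show F: "left_module R ?F" by (intro direct_sum_left_module regular_module_left_module R)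
  have u: "?u \<in> carrier ?F" by (simp add: free_module_simps)
  fix M :: "('r, ('j \<Rightarrow> 'r) \<Rightarrow> 'r) module" and N :: "('r, 'j \<Rightarrow> 'r) module" and g f
  assume "left_module R M \<and> left_module R N \<and> g \<in> lmod_hom R M N \<and> g ` carrier M = carrier N \<and>
    f \<in> lmod_hom R ?F N"
  then have M: "left_module R M" and N: "left_module R N" and g: "g \<in> lmod_hom R M N"
    and sur: "g ` carrier M = carrier N" and f: "f \<in> lmod_hom R ?F N" by auto
  have "f ?u \<in> g ` carrier M" unfolding sur by (rule lmod_homD(1)[OF f u])
  then obtain y where y: "y \<in> carrier M" "g y = f ?u" by auto
  let ?h = "lin_comb R M {j} (\<lambda>_. y)"
  have "?h \<in> lmod_hom R ?F M" by (rule lin_comb_hom[OF M]) (use y in auto)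
  moreover have "g (?h c) = f c" if c: "c \<in> carrier ?F" for c
  proof -
    have "g (?h c) = lin_comb R N {j} (\<lambda>_. f ?u) c"
      using hom_lin_comb[OF M N g _ c, of "\<lambda>_. y"] y by simp
    also have "\<dots> = f (lin_comb R ?F {j} (\<lambda>_. ?u) c)"
      using hom_lin_comb[OF F N f _ c, of "\<lambda>_. ?u"] u by simp
    finally show ?thesis by (simp only: free_rank_one_generator[OF R c])
  qed
  ultimately show "\<exists>h\<in>lmod_hom R ?F M. \<forall>x\<in>carrier ?F. g (h x) = f x"
    by (intro bexI[of _ ?h] ballI)
qed

lemma free_rank_one_countably_generated:
  assumes R: "ring R" shows "countably_generated R (free_module R {j})"
  unfolding countably_generated_def
proof (intro conjI exI[of _ "{\<lambda>i\<in>{j}. \<one>\<^bsub>R\<^esub>}"] allI impI)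
  interpret R: ring R by fact
  let ?F = "free_module R {j}" and ?u = "\<lambda>i\<in>{j}. \<one>\<^bsub>R\<^esub>"
  show F: "left_module R ?F" by (intro direct_sum_left_module regular_module_left_module R)
  show "{?u} \<subseteq> carrier ?F" by (simp add: free_module_simps)
  fix H assume H: "submodule H R ?F \<and> {?u} \<subseteq> H"
  have "c \<in> H" if c: "c \<in> carrier ?F" for c
  proof -
    have cj: "c j \<in> carrier R" using c by (simp add: free_module_simps PiE_iff)
    have "c j \<odot>\<^bsub>?F\<^esub> ?u \<in> H" using H cj submodule.smult_closed[of H R ?F "c j" ?u] by blast
    moreover have "c j \<odot>\<^bsub>?F\<^esub> ?u = c"
      using c cj by (auto simp: free_module_simps PiE_iff extensional_def fun_eq_iff)
    ultimately show ?thesis by simp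
  qed
  moreover have "H \<subseteq> carrier ?F"
    using H subgroup.subset[of H "add_monoid ?F"] submodule.axioms(1) by fastforce
  ultimately show "H = carrier ?F" by blast
qed simp

text \<open>Every basis element contributes one summand \<open>R\<close>, written as the free module
  on \<open>{0 :: nat}\<close> so that it lives over \<open>nat \<Rightarrow> 'r\<close>;
  \<open>\<iota>\<close> moves the index set to another type, in the application the one that
  carries \<kappa>.\<close>

lemma free_on_iso_direct_sum:
  fixes R :: "('r, 'z) ring_scheme" and \<iota> :: "'b \<Rightarrow> 'k"
  assumes R: "ring R" and inj: "inj_on \<iota> T"
  defines "Q \<equiv> direct_sum (\<iota> ` T) (\<lambda>_. free_module R {0 :: nat})"
  shows "\<exists>enc dec. enc \<in> lmod_hom R (free_on R T) Q \<and> dec \<in> lmod_hom R Q (free_on R T) \<and>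
    (\<forall>z\<in>carrier (free_on R T). dec (enc z) = z) \<and> (\<forall>c\<in>carrier Q. enc (dec c) = c)"
proof -
  interpret R: ring R by fact
  let ?G = "free_module R {0 :: nat}"
  define enc where "enc z = (\<lambda>i\<in>\<iota> ` T. \<lambda>j\<in>{0 :: nat}. z (inv_into T \<iota> i))" for z :: "'b \<Rightarrow> 'r"
  define dec where "dec c = (\<lambda>b. if b \<in> T then c (\<iota> b) 0 else \<zero>\<^bsub>R\<^esub>)" for c :: "'k \<Rightarrow> nat \<Rightarrow> 'r"
  have inv: "inv_into T \<iota> (\<iota> b) = b" if "b \<in> T" for b using inj that by (rule inv_into_f_f)
  have G0: "\<zero>\<^bsub>?G\<^esub> = (\<lambda>j\<in>{0}. \<zero>\<^bsub>R\<^esub>)" by (simp add: direct_sum_def regular_module_def)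
  have Gc: "c \<in> carrier ?G \<longleftrightarrow> c 0 \<in> carrier R \<and> c \<in> extensional {0}" for c
    by (simp add: free_module_simps PiE_iff)
  have Gext: "c = c'" if "c \<in> extensional {0}" "c' \<in> extensional {0}" "c 0 = c' 0"
    for c c' :: "nat \<Rightarrow> 'r"
    using that by (intro extensionalityI[of c "{0}" c']) auto
  have Qc: "c \<in> carrier Q \<longleftrightarrow> c \<in> extensional (\<iota> ` T) \<and> (\<forall>b\<in>T. c (\<iota> b) \<in> carrier ?G) \<and>
      finite {i \<in> \<iota> ` T. c i \<noteq> \<zero>\<^bsub>?G\<^esub>}" for c
    by (auto simp: Q_def direct_sum_def PiE_iff)
  have Qops: "c \<oplus>\<^bsub>Q\<^esub> c' = (\<lambda>i\<in>\<iota> ` T. \<lambda>j\<in>{0}. c i j \<oplus>\<^bsub>R\<^esub> c' i j)"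
    "a \<odot>\<^bsub>Q\<^esub> c = (\<lambda>i\<in>\<iota> ` T. \<lambda>j\<in>{0}. a \<otimes>\<^bsub>R\<^esub> c i j)" for c c' a
    by (auto simp: Q_def direct_sum_def regular_module_def fun_eq_iff)
  have G0iff: "c = \<zero>\<^bsub>?G\<^esub> \<longleftrightarrow> c 0 = \<zero>\<^bsub>R\<^esub>" if "c \<in> extensional {0}" for c
    unfolding G0 using that by (auto intro: Gext)
  have enc: "enc z \<in> carrier Q" if z: "z \<in> carrier (free_on R T)" for z
  proof -
    have "{i \<in> \<iota> ` T. enc z i \<noteq> \<zero>\<^bsub>?G\<^esub>} \<subseteq> \<iota> ` {b. z b \<noteq> \<zero>\<^bsub>R\<^esub>}"
      by (auto simp: enc_def G0 inv)
    then have "finite {i \<in> \<iota> ` T. enc z i \<noteq> \<zero>\<^bsub>?G\<^esub>}"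
      by (rule finite_subset) (use z in \<open>simp add: free_on_carrier\<close>)
    then show ?thesis using z unfolding Qc Gc by (auto simp: enc_def free_on_carrier)
  qed
  have dec: "dec c \<in> carrier (free_on R T)" if c: "c \<in> carrier Q" for c
  proof -
    let ?A = "{i \<in> \<iota> ` T. c i \<noteq> \<zero>\<^bsub>?G\<^esub>}"
    have "{b. dec c b \<noteq> \<zero>\<^bsub>R\<^esub>} \<subseteq> inv_into T \<iota> ` ?A"
    proof
      fix b assume "b \<in> {b. dec c b \<noteq> \<zero>\<^bsub>R\<^esub>}"
      then have b: "b \<in> T" "c (\<iota> b) 0 \<noteq> \<zero>\<^bsub>R\<^esub>" by (auto simp: dec_def split: if_splits)
      then have "\<iota> b \<in> ?A" by (auto simp: G0)
      then show "b \<in> inv_into T \<iota> ` ?A" using inv[OF b(1)] by force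
    qed
    then have "finite {b. dec c b \<noteq> \<zero>\<^bsub>R\<^esub>}"
      by (rule finite_subset) (use c in \<open>simp add: Qc\<close>)
    then show ?thesis using c unfolding Qc Gc by (auto simp: dec_def free_on_carrier)
  qed
  have "enc \<in> lmod_hom R (free_on R T) Q"
    by (rule lmod_homI[OF enc]) (auto simp: Qops enc_def fun_eq_iff)
  moreover have "dec \<in> lmod_hom R Q (free_on R T)"
    by (rule lmod_homI[OF dec]) (auto simp: Qops dec_def fun_eq_iff)
  moreover have "dec (enc z) = z" if "z \<in> carrier (free_on R T)" for z
    using that by (auto simp: enc_def dec_def fun_eq_iff inv free_on_carrier)
  moreover have "enc (dec c) = c" if c: "c \<in> carrier Q" for c
  proof (rule extensionalityI[of _ "\<iota> ` T"])
    show "enc (dec c) \<in> extensional (\<iota> ` T)" by (simp add: enc_def)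
    show "c \<in> extensional (\<iota> ` T)" using c by (simp add: Qc)
    fix i assume "i \<in> \<iota> ` T"
    then obtain b where b: "b \<in> T" "i = \<iota> b" by blast
    have "c i \<in> extensional {0}" using c b unfolding Qc Gc by blast
    then show "enc (dec c) i = c i"
      using b by (intro Gext) (simp_all add: enc_def dec_def inv)
  qed
  ultimately show ?thesis by blast
qed

text \<open>A basis of size at most \<kappa> embeds into \<open>Field \<kappa>\<close>, which
  supplies the index sets; the summands have rank one, and exactness passes along the isomorphisms
  \<open>enc\<close> and \<open>dec\<close>.\<close>

lemma free_resolution_Proj_dim_card:
  fixes \<kappa> :: "'k rel" and M :: "('r, 'm) module" and T :: "nat \<Rightarrow> 'b set"
  assumes R: "ring R" and \<kappa>: "Card_order \<kappa>"
    and res: "free_resolution R n T D e M" and card: "\<And>k. |T k| \<le>o \<kappa>"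
  shows "M \<in> Proj_dim_card R n \<kappa>"
proof -
  have "|T k| \<le>o |Field \<kappa>|" for k
    using card ordLeq_ordIso_trans ordIso_symmetric[OF card_of_Field_ordIso[OF \<kappa>]] by blast
  then have "\<forall>k. \<exists>f. inj_on f (T k) \<and> f ` T k \<subseteq> Field \<kappa>"
    unfolding card_of_ordLeq[symmetric] by blast
  then obtain \<iota> where \<iota>: "\<And>k. inj_on (\<iota> k :: 'b \<Rightarrow> 'k) (T k)" by metis
  define I where "I k = \<iota> k ` T k" for k
  define Q where "Q k = direct_sum (I k) (\<lambda>_. free_module R {0 :: nat})" for k
  let ?F = "\<lambda>k. free_on R (T k)"
  define iso where "iso k enc dec \<longleftrightarrow> enc \<in> lmod_hom R (?F k) (Q k) \<and> dec \<in> lmod_hom R (Q k) (?F k) \<and>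
    (\<forall>z\<in>carrier (?F k). dec (enc z) = z) \<and> (\<forall>c\<in>carrier (Q k). enc (dec c) = c)" for k enc dec
  have "\<exists>enc dec. iso k enc dec" for k
    unfolding iso_def Q_def I_def by (rule free_on_iso_direct_sum[OF R \<iota>])
  then obtain enc dec where "\<And>k. iso k (enc k) (dec k)" by metis
  note iso = this[unfolded iso_def]
  have enc: "enc k \<in> lmod_hom R (?F k) (Q k)" and dec: "dec k \<in> lmod_hom R (Q k) (?F k)" for k
    using iso[of k] by simp_all
  have de: "z \<in> carrier (?F k) \<Longrightarrow> dec k (enc k z) = z"
    and ed: "c \<in> carrier (Q k) \<Longrightarrow> enc k (dec k c) = c" for k z c
    using iso[of k] by simp_all
  note encc = lmod_homD(1)[OF enc] and decc = lmod_homD(1)[OF dec]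
  have QM: "left_module R (Q k)" and FM: "left_module R (?F k)" for k
    unfolding Q_def by (intro direct_sum_left_module regular_module_left_module free_on_left_module R)+
  have M: "left_module R M" and T0: "\<And>k. k > n \<Longrightarrow> T k = {}" and e: "e \<in> lmod_hom R (?F 0) M"
    and es: "e ` carrier (?F 0) = carrier M" and D: "\<And>k. D k \<in> lmod_hom R (?F (Suc k)) (?F k)"
    and ke: "lmod_kernel (?F 0) M e = D 0 ` carrier (?F 1)"
    and kD: "\<And>k. lmod_kernel (?F (Suc k)) (?F k) (D k) = D (Suc k) ` carrier (?F (Suc (Suc k)))"
    using res unfolding free_resolution_def by auto
  define d where "d k c = enc k (D k (dec (Suc k) c))" for k c
  define e' where "e' c = e (dec 0 c)" for c
  have dec_im: "dec k ` carrier (Q k) = carrier (?F k)" for k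
    using decc encc de by (metis image_eqI image_subsetI subsetI subset_antisym)
  have ker0: "D k ` carrier (?F (Suc k)) = {\<lambda>_. \<zero>\<^bsub>R\<^esub>}" if "Suc k > n" for k
    using T0[OF that] lmod_hom_zero[OF FM FM D, of k] by (simp add: free_on_empty[OF R])
  have z: "dec k \<zero>\<^bsub>Q k\<^esub> = (\<lambda>_. \<zero>\<^bsub>R\<^esub>)" "enc k (\<lambda>_. \<zero>\<^bsub>R\<^esub>) = \<zero>\<^bsub>Q k\<^esub>" for k
    using lmod_hom_zero[OF QM FM dec] lmod_hom_zero[OF FM QM enc] by simp_all
  \<comment> \<open>As the bases are empty above \<open>n\<close>, the uniform exactness of
    \<open>free_resolution\<close> turns into the zero kernel that \<open>exact_resolution\<close>
    prescribes at its left end.\<close>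
  have d_top: "Suc k > n \<Longrightarrow> d k ` carrier (Q (Suc k)) = {\<zero>\<^bsub>Q k\<^esub>}"
    and d_dec: "d k ` carrier (Q (Suc k)) = {c \<in> carrier (Q k). dec k c \<in> D k ` carrier (?F (Suc k))}" for k
  proof -
    have "d k ` carrier (Q (Suc k)) = enc k ` D k ` carrier (?F (Suc k))"
      unfolding d_def dec_im[symmetric] by (simp add: image_image)
    then show "Suc k > n \<Longrightarrow> d k ` carrier (Q (Suc k)) = {\<zero>\<^bsub>Q k\<^esub>}"
      using ker0[of k] z by simp
    have "D k ` carrier (?F (Suc k)) \<subseteq> carrier (?F k)" using lmod_homD(1)[OF D] by blast
    then show "d k ` carrier (Q (Suc k)) = {c \<in> carrier (Q k). dec k c \<in> D k ` carrier (?F (Suc k))}"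
      unfolding \<open>d k ` carrier (Q (Suc k)) = enc k ` D k ` carrier (?F (Suc k))\<close>
      using encc de ed by (auto intro!: image_eqI[of _ "enc k", OF ed[symmetric]])
  qed
  have "lmod_kernel (Q 0) M e' = {c \<in> carrier (Q 0). dec 0 c \<in> lmod_kernel (?F 0) M e}"
    using decc by (auto simp: lmod_kernel_def e'_def)
  also have "\<dots> = d 0 ` carrier (Q 1)" using ke d_dec[of 0] by simp
  finally have ke': "lmod_kernel (Q 0) M e' = d 0 ` carrier (Q 1)" .
  have kd': "lmod_kernel (Q (Suc k)) (Q k) (d k) = d (Suc k) ` carrier (Q (Suc (Suc k)))" for k
  proof -
    have "enc k w = \<zero>\<^bsub>Q k\<^esub> \<longleftrightarrow> w = (\<lambda>_. \<zero>\<^bsub>R\<^esub>)" if "w \<in> carrier (?F k)" for w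
      using de[OF that] z by metis
    then have "lmod_kernel (Q (Suc k)) (Q k) (d k) =
        {c \<in> carrier (Q (Suc k)). dec (Suc k) c \<in> lmod_kernel (?F (Suc k)) (?F k) (D k)}"
      using decc lmod_homD(1)[OF D] by (auto simp: lmod_kernel_def d_def z)
    then show ?thesis unfolding kD d_dec[of "Suc k"] .
  qed
  have "exact_resolution R n Q d e' M"
    unfolding exact_resolution_def
  proof (intro conjI allI impI)
    show "e' \<in> lmod_hom R (Q 0) M" unfolding e'_def by (rule lmod_hom_comp[OF dec e])
    show "d k \<in> lmod_hom R (Q (Suc k)) (Q k)" for k
      unfolding d_def by (intro lmod_hom_comp[OF lmod_hom_comp[OF dec D] enc])
    show "e' ` carrier (Q 0) = carrier M"
      unfolding e'_def es[symmetric] dec_im[symmetric] by (simp add: image_image)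
    show "lmod_kernel (Q 0) M e' = (if n = 0 then {\<zero>\<^bsub>Q 0\<^esub>} else d 0 ` carrier (Q 1))"
      using ke' d_top[of 0] by simp
    show "lmod_kernel (Q (Suc k)) (Q k) (d k) =
        (if Suc k = n then {\<zero>\<^bsub>Q n\<^esub>} else d (Suc k) ` carrier (Q (Suc (Suc k))))" for k
      using kd'[of k] d_top[of "Suc k"] by (cases "Suc k = n") auto
  qed (use M QM in simp_all)
  moreover have "|I k| \<le>o \<kappa>" for k
    unfolding I_def using card_of_image card[of k] ordLeq_transitive by blast
  ultimately show ?thesis
    unfolding Proj_dim_card_def mem_Collect_eq Q_def[abs_def]
    by (intro exI[of _ I] exI[of _ "\<lambda>_ _. free_module R {0}"] exI[of _ d] exI[of _ e'])
      (simp add: free_rank_one_projective[OF R] free_rank_one_countably_generated[OF R])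
qed

section \<open>Quotient complexes and transfinite recursion\<close>

text \<open>The cokernels in a filtration have to live over the type \<open>'m\<close> of the
  complex itself, so cosets are replaced by chosen representatives: \<open>q m\<close> picks the
  representative, and the operations of \<open>C\<close> compute in \<open>Y\<close> and normalise
  with \<open>q\<close>.\<close>

lemma quotient_complex:
  fixes Y :: "('r, 'm) cplx" and U :: "int \<Rightarrow> 'm set"
  assumes Y: "chain_complex R Y" and U: "\<And>m. U m \<subseteq> carrier (ob Y m)"
    and zero: "\<And>m. \<zero>\<^bsub>ob Y m\<^esub> \<in> U m"
    and add: "\<And>m x y. x \<in> U m \<Longrightarrow> y \<in> U m \<Longrightarrow> x \<oplus>\<^bsub>ob Y m\<^esub> y \<in> U m"
    and smult: "\<And>m a x. a \<in> carrier R \<Longrightarrow> x \<in> U m \<Longrightarrow> a \<odot>\<^bsub>ob Y m\<^esub> x \<in> U m"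
    and bd: "\<And>m x. x \<in> U m \<Longrightarrow> bd Y m x \<in> U (m - 1)"
  shows "\<exists>(C :: ('r, 'm) cplx) q. chain_complex R C \<and> chain_map R Y C q \<and>
    (\<forall>m. q m ` carrier (ob Y m) = carrier (ob C m) \<and>
      lmod_kernel (ob Y m) (ob C m) (q m) = U m)"
proof -
  let ?M = "\<lambda>m. carrier (ob Y m)"
  have YM: "left_module R (ob Y m)" for m by (rule chain_complexD(1)[OF Y])
  have ag: "abelian_group (ob Y m)" for m by (rule left_module.axioms(2)[OF YM])
  have R: "ring R" by (rule left_module.axioms(1)[OF YM])
  interpret R: ring R by (rule R)
  note b = lmod_homD[OF chain_complexD(2)[OF Y]]
  define E where "E m x y \<longleftrightarrow> mdiff R (ob Y m) x y \<in> U m" for m x y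
  have E_refl: "E m x x" if "x \<in> ?M m" for m x
    using zero[of m] left_module.mdiff_eq_zero_iff[OF YM that that] by (simp add: E_def)
  have E_sym: "E m y x" if "E m x y" "x \<in> ?M m" "y \<in> ?M m" for m x y
  proof -
    interpret left_module R "ob Y m" by (rule YM)
    have "mdiff R (ob Y m) y x = mdiff R (ob Y m) \<zero>\<^bsub>ob Y m\<^esub> (mdiff R (ob Y m) x y)"
      using that by (simp add: mdiff_eq_minus M.minus_eq M.minus_add M.a_comm)
    also have "\<dots> \<in> U m"
      unfolding mdiff_def[of R _ "\<zero>\<^bsub>ob Y m\<^esub>"] using that(1) zero by (intro add smult) (simp_all add: E_def)
    finally show ?thesis by (simp add: E_def)
  qed
  have E_trans: "E m x z" if "E m x y" "E m y z" "x \<in> ?M m" "y \<in> ?M m" "z \<in> ?M m" for m x y z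
  proof -
    interpret left_module R "ob Y m" by (rule YM)
    have "mdiff R (ob Y m) x z = mdiff R (ob Y m) x y \<oplus>\<^bsub>ob Y m\<^esub> mdiff R (ob Y m) y z"
      using that M.r_neg1[of y] by (simp add: mdiff_eq_minus M.minus_eq M.a_assoc M.r_neg2)
    then show ?thesis using that add by (simp add: E_def)
  qed
  have E_add: "E m (x \<oplus>\<^bsub>ob Y m\<^esub> y) (x' \<oplus>\<^bsub>ob Y m\<^esub> y')" if "E m x x'" "E m y y'" 
    "x \<in> ?M m" "x' \<in> ?M m" "y \<in> ?M m" "y' \<in> ?M m" for m x x' y y'
  proof -
    interpret left_module R "ob Y m" by (rule YM)
    have "mdiff R (ob Y m) (x \<oplus>\<^bsub>ob Y m\<^esub> y) (x' \<oplus>\<^bsub>ob Y m\<^esub> y') =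
        mdiff R (ob Y m) x x' \<oplus>\<^bsub>ob Y m\<^esub> mdiff R (ob Y m) y y'"
      using that by (simp add: mdiff_def smult_r_distr M.a_ac)
    then show ?thesis using that add by (simp add: E_def)
  qed
  have E_smult: "E m (a \<odot>\<^bsub>ob Y m\<^esub> x) (a \<odot>\<^bsub>ob Y m\<^esub> x')" if "E m x x'" "a \<in> carrier R"
    "x \<in> ?M m" "x' \<in> ?M m" for m x x' a
  proof -
    interpret left_module R "ob Y m" by (rule YM)
    have "(\<lambda>x. a \<odot>\<^bsub>ob Y m\<^esub> x) (mdiff R (ob Y m) x x') = mdiff R (ob Y m) (a \<odot>\<^bsub>ob Y m\<^esub> x) (a \<odot>\<^bsub>ob Y m\<^esub> x')"
      using that by (simp add: mdiff_def smult_r_distr smult_assoc1[symmetric] R.l_minus R.r_minus)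
    then show ?thesis using that smult by (simp add: E_def) (metis)
  qed
  have E_bd: "E (m - 1) (bd Y m x) (bd Y m x')" if "E m x x'" "x \<in> ?M m" "x' \<in> ?M m" for m x x'
    using lmod_hom_mdiff[OF YM chain_complexD(2)[OF Y] that(2,3)] that(1) bd by (metis E_def)
  define q where "q m x = (SOME y. y \<in> ?M m \<and> E m x y)" for m x
  have q: "q m x \<in> ?M m" "E m x (q m x)" if "x \<in> ?M m" for m x
    using someI[of "\<lambda>y. y \<in> ?M m \<and> E m x y" x] that E_refl unfolding q_def by auto
  \<comment> \<open>Congruent elements have the same coset, and \<open>SOME\<close> applied to equal
    predicates returns equal values.\<close>
  have q_eq: "q m x = q m y" if "E m x y" "x \<in> ?M m" "y \<in> ?M m" for m x y
  proof -
    have "(\<lambda>z. z \<in> ?M m \<and> E m x z) = (\<lambda>z. z \<in> ?M m \<and> E m y z)"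
      using that E_sym E_trans by (intro ext) blast
    then show ?thesis by (simp add: q_def)
  qed
  have q_iff: "q m x = q m y \<longleftrightarrow> E m x y" if "x \<in> ?M m" "y \<in> ?M m" for m x y
    using that q q_eq E_sym E_trans by metis
  have qq: "q m (q m x) = q m x" if "x \<in> ?M m" for m x
    using q_eq[OF q(2)[OF that] that q(1)[OF that]] by simp
  have cl: "x \<in> ?M m \<Longrightarrow> y \<in> ?M m \<Longrightarrow> x \<oplus>\<^bsub>ob Y m\<^esub> y \<in> ?M m"
    "a \<in> carrier R \<Longrightarrow> x \<in> ?M m \<Longrightarrow> a \<odot>\<^bsub>ob Y m\<^esub> x \<in> ?M m" "\<zero>\<^bsub>ob Y m\<^esub> \<in> ?M m" for m x y a
    using abelian_monoid.a_closed[OF abelian_group.axioms(1)[OF ag]] left_module.smult_closed[OF YM]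
      abelian_monoid.zero_closed[OF abelian_group.axioms(1)[OF ag]] by simp_all
  have q_add: "q m (q m x \<oplus>\<^bsub>ob Y m\<^esub> q m y) = q m (x \<oplus>\<^bsub>ob Y m\<^esub> y)"
    "q m (x \<oplus>\<^bsub>ob Y m\<^esub> q m y) = q m (x \<oplus>\<^bsub>ob Y m\<^esub> y)" "q m (q m x \<oplus>\<^bsub>ob Y m\<^esub> y) = q m (x \<oplus>\<^bsub>ob Y m\<^esub> y)"
    if "x \<in> ?M m" "y \<in> ?M m" for m x y
    using that q E_refl cl by (auto intro!: q_eq[symmetric] E_add)
  have q_smult: "q m (a \<odot>\<^bsub>ob Y m\<^esub> q m x) = q m (a \<odot>\<^bsub>ob Y m\<^esub> x)" if "a \<in> carrier R" "x \<in> ?M m" for m x a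
    using that q cl by (auto intro!: q_eq[symmetric] E_smult)
  have q_bd: "q (m - 1) (bd Y m (q m x)) = q (m - 1) (bd Y m x)" if "x \<in> ?M m" for m x
    using that q b(1) by (auto intro!: q_eq[symmetric] E_bd)
  define C :: "('r, 'm) cplx" where "C = \<lparr>ob = (\<lambda>m. \<lparr>carrier = q m ` ?M m, mult = undefined, one = undefined,
      zero = q m \<zero>\<^bsub>ob Y m\<^esub>, add = (\<lambda>x y. q m (x \<oplus>\<^bsub>ob Y m\<^esub> y)), smult = (\<lambda>a x. q m (a \<odot>\<^bsub>ob Y m\<^esub> x))\<rparr>),
      bd = (\<lambda>m x. q (m - 1) (bd Y m x))\<rparr>"
  have C: "carrier (ob C m) = q m ` ?M m" "\<zero>\<^bsub>ob C m\<^esub> = q m \<zero>\<^bsub>ob Y m\<^esub>"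
    "x \<oplus>\<^bsub>ob C m\<^esub> y = q m (x \<oplus>\<^bsub>ob Y m\<^esub> y)" "a \<odot>\<^bsub>ob C m\<^esub> x = q m (a \<odot>\<^bsub>ob Y m\<^esub> x)"
    "bd C m x = q (m - 1) (bd Y m x)" for m x y a
    by (simp_all add: C_def)
  have "left_module R (ob C m)" for m
  proof -
    interpret left_module R "ob Y m" by (rule YM)
    have "abelian_group (ob C m)"
    proof (rule abelian_groupI)
      fix x assume "x \<in> carrier (ob C m)"
      then obtain u where u: "u \<in> ?M m" "x = q m u" by (auto simp: C)
      then have "q m (q m (\<ominus>\<^bsub>ob Y m\<^esub> u) \<oplus>\<^bsub>ob Y m\<^esub> q m u) = q m \<zero>\<^bsub>ob Y m\<^esub>"
        by (simp add: q_add M.l_neg)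
      then show "\<exists>y\<in>carrier (ob C m). y \<oplus>\<^bsub>ob C m\<^esub> x = \<zero>\<^bsub>ob C m\<^esub>"
        using u by (intro bexI[of _ "q m (\<ominus>\<^bsub>ob Y m\<^esub> u)"]) (simp_all add: C)
    qed (auto simp: C q_add M.a_ac)
    then show ?thesis
      by (rule left_moduleI[OF R])
        (auto simp: C q_add q_smult qq smult_l_distr smult_r_distr smult_assoc1)
  qed
  moreover have "bd C m \<in> lmod_hom R (ob C m) (ob C (m - 1))" for m
    by (rule lmod_homI) (auto simp: C q_add q_smult q_bd b cl)
  moreover have "bd C (m - 1) (bd C m x) = \<zero>\<^bsub>ob C (m - 2)\<^esub>" if x: "x \<in> carrier (ob C m)" for m x
  proof -
    obtain u where u: "u \<in> ?M m" "x = q m u" using x by (auto simp: C)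
    have "bd C (m - 1) (bd C m x) = q (m - 1 - 1) (bd Y (m - 1) (bd Y m u))"
      using u b(1)[OF u(1)] by (simp only: C q_bd)
    then show ?thesis using chain_complexD(3)[OF Y u(1)] by (simp add: C)
  qed
  ultimately have "chain_complex R C" by (simp add: chain_complex_def)
  moreover have "chain_map R Y C q"
    unfolding chain_map_def
  proof (intro allI conjI ballI)
    fix m
    show "q m \<in> lmod_hom R (ob Y m) (ob C m)"
      by (rule lmod_homI) (auto simp: C q_add q_smult)
    show "q (m - 1) (bd Y m x) = bd C m (q m x)" if "x \<in> ?M m" for x
      using that by (simp add: C q_bd)
  qed
  moreover have "lmod_kernel (ob Y m) (ob C m) (q m) = U m" for m
  proof -
    interpret left_module R "ob Y m" by (rule YM)
    have "E m x \<zero>\<^bsub>ob Y m\<^esub> \<longleftrightarrow> x \<in> U m" if "x \<in> ?M m" for x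
      using that by (simp add: E_def mdiff_def)
    then show ?thesis using U[of m] by (auto simp: lmod_kernel_def C q_iff)
  qed
  ultimately show ?thesis using C(1) by (intro exI[of _ C] exI[of _ q]) simp
qed

section \<open>Transfinite unions along a well-order\<close>

lemma succ_exists:
  assumes r: "Well_order r" and "\<alpha> \<in> underS r \<beta>"
  shows "\<exists>\<gamma>. succ_in r \<alpha> \<gamma> \<and> \<alpha> \<in> underS r \<gamma> \<and> (\<gamma>, \<beta>) \<in> r"
proof -
  have wo: "wo_rel r" using r by (simp add: wo_rel_def)
  note WF = wo_rel.WF[OF wo] and TOTALS = wo_rel.TOTALS[OF wo] and TRANS = wo_rel.TRANS[OF wo]
    and ANTISYM = wo_rel.ANTISYM[OF wo] and REFL = wo_rel.REFL[OF wo]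
  let ?A = "{\<gamma>. \<alpha> \<in> underS r \<gamma>}"
  have fld: "\<gamma> \<in> Field r" if "\<gamma> \<in> ?A" for \<gamma> using that by (auto simp: underS_def Field_def)
  \<comment> \<open>The successor is the least element strictly above \<open>\<alpha>\<close>;
    \<open>\<beta>\<close> shows that there is one.\<close>
  obtain \<gamma> where \<gamma>: "\<gamma> \<in> ?A" "\<And>\<delta>. (\<delta>, \<gamma>) \<in> r - Id \<Longrightarrow> \<delta> \<notin> ?A"
    using wfE_min[OF WF, of \<beta> ?A] assms(2) by blast
  have \<alpha>: "\<alpha> \<in> Field r" "(\<alpha>, \<gamma>) \<in> r" "\<alpha> \<noteq> \<gamma>" using \<gamma>(1) by (auto simp: underS_def Field_def)
  have "underS r \<gamma> = under r \<alpha>"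
  proof (intro equalityI subsetI)
    fix \<delta> assume \<delta>: "\<delta> \<in> underS r \<gamma>"
    then have "\<delta> \<notin> ?A" "\<delta> \<in> Field r" using \<gamma>(2) by (auto simp: underS_def Field_def)
    then show "\<delta> \<in> under r \<alpha>" using TOTALS \<alpha>(1) by (auto simp: underS_def under_def)
  next
    fix \<delta> assume "\<delta> \<in> under r \<alpha>"
    then show "\<delta> \<in> underS r \<gamma>"
      using \<alpha> transD[OF TRANS, of \<delta> \<alpha> \<gamma>] antisymD[OF ANTISYM, of \<alpha> \<gamma>] by (auto simp: underS_def under_def)
  qed
  then have "succ_in r \<alpha> \<gamma>" using \<alpha>(1) fld[OF \<gamma>(1)] by (simp add: succ_in_def)
  moreover have "(\<gamma>, \<beta>) \<in> r"
    using TOTALS fld[OF \<gamma>(1)] fld[of \<beta>] assms(2) \<gamma>(2)[of \<beta>] by (cases "\<gamma> = \<beta>") auto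
  ultimately show ?thesis using \<gamma>(1) by blast
qed

text \<open>One recursion, in which \<open>G \<alpha>\<close> is the union of
  \<open>st \<beta> (G \<beta>)\<close> over all \<open>\<beta>\<close> below
  \<open>\<alpha>\<close>, treats zero, successors and limits alike: these sets increase with
  \<open>\<beta>\<close>, so at a successor the union collapses to its last member.
  \<open>Un\<close> for the empty chain makes the start \<open>{}\<close> good.\<close>

lemma transfinite_union_chain:
  fixes r :: "'i rel" and good :: "'a set \<Rightarrow> bool"
  assumes r: "Well_order r"
    and Un: "\<And>\<C>. subset.chain UNIV \<C> \<Longrightarrow> (\<And>S. S \<in> \<C> \<Longrightarrow> good S) \<Longrightarrow> good (\<Union>\<C>)"
    and step: "\<And>S \<alpha>. good S \<Longrightarrow> \<alpha> \<in> Field r \<Longrightarrow> \<exists>S'. good S' \<and> S \<subseteq> S' \<and> Q \<alpha> S S'"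
  shows "\<exists>G. (\<forall>\<alpha>. good (G \<alpha>)) \<and> (\<forall>\<alpha>. underS r \<alpha> = {} \<longrightarrow> G \<alpha> = {}) \<and>
    (\<forall>\<alpha> \<beta>. (\<alpha>, \<beta>) \<in> r \<longrightarrow> G \<alpha> \<subseteq> G \<beta>) \<and> (\<forall>\<alpha> \<beta>. succ_in r \<alpha> \<beta> \<longrightarrow> Q \<alpha> (G \<alpha>) (G \<beta>)) \<and>
    (\<forall>\<beta>. limit_in r \<beta> \<longrightarrow> G \<beta> = \<Union>(G ` underS r \<beta>))"
proof -
  have wo: "wo_rel r" using r by (simp add: wo_rel_def)
  note WF = wo_rel.WF[OF wo] and TOTALS = wo_rel.TOTALS[OF wo] and TRANS = wo_rel.TRANS[OF wo]
    and ANTISYM = wo_rel.ANTISYM[OF wo] and REFL = wo_rel.REFL[OF wo]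
  define st where "st \<alpha> S = (SOME S'. good S' \<and> S \<subseteq> S' \<and> Q \<alpha> S S')" for \<alpha> S
  have st: "good (st \<alpha> S)" "S \<subseteq> st \<alpha> S" "Q \<alpha> S (st \<alpha> S)" if "good S" "\<alpha> \<in> Field r" for \<alpha> S
    using someI_ex[OF step[OF that]] unfolding st_def by simp_all
  define H where "H G \<alpha> = (\<Union>\<beta>\<in>underS r \<alpha>. st \<beta> (G \<beta>))" for G \<alpha>
  define G where "G = wo_rel.worec r H"
  have "wo_rel.adm_wo r H" by (auto simp: wo_rel.adm_wo_def[OF wo] H_def)
  then have "G = H G" unfolding G_def by (rule wo_rel.worec_fixpoint[OF wo])
  then have G: "G \<alpha> = (\<Union>\<beta>\<in>underS r \<alpha>. st \<beta> (G \<beta>))" for \<alpha>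
    unfolding H_def by (rule fun_cong)
  have fld: "\<alpha> \<in> Field r" if "\<alpha> \<in> underS r \<beta>" for \<alpha> \<beta> using that by (auto simp: underS_def Field_def)
  have tr: "underS r \<alpha> \<subseteq> underS r \<beta>" if "(\<alpha>, \<beta>) \<in> r" for \<alpha> \<beta>
    using that transD[OF TRANS, of _ \<alpha> \<beta>] antisymD[OF ANTISYM] by (auto simp: underS_def)
  have good: "good (G \<alpha>)" for \<alpha>
  proof (induction \<alpha> rule: wo_rel.well_order_induct[OF wo])
    case (1 \<alpha>)
    then have IH: "good (G \<beta>)" if "\<beta> \<in> underS r \<alpha>" for \<beta> using that by (simp add: underS_def)
    let ?C = "(\<lambda>\<beta>. st \<beta> (G \<beta>)) ` underS r \<alpha>"
    have le: "st \<beta> (G \<beta>) \<subseteq> st \<gamma> (G \<gamma>)" if "\<beta> \<in> underS r \<gamma>" "\<gamma> \<in> underS r \<alpha>" for \<beta> \<gamma>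
      using st(2)[OF IH[OF that(2)] fld[OF that(2)]] that(1) G[of \<gamma>] by blast
    have "subset.chain UNIV ?C"
      unfolding subset_chain_def
    proof (intro conjI ballI)
      fix A B assume "A \<in> ?C" "B \<in> ?C"
      then obtain \<beta> \<gamma> where bg: "\<beta> \<in> underS r \<alpha>" "\<gamma> \<in> underS r \<alpha>" "A = st \<beta> (G \<beta>)" "B = st \<gamma> (G \<gamma>)" by blast
      then consider "\<beta> = \<gamma>" | "\<beta> \<in> underS r \<gamma>" | "\<gamma> \<in> underS r \<beta>"
        using TOTALS fld by (auto simp: underS_def)
      then show "A \<subseteq> B \<or> B \<subseteq> A" by cases (use le bg in auto)
    qed simp
    then show ?case unfolding G[of \<alpha>] using st(1)[OF IH fld] by (intro Un) auto
  qed
  have st_le: "st \<alpha> (G \<alpha>) \<subseteq> G \<beta>" if "\<alpha> \<in> underS r \<beta>" for \<alpha> \<beta>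
    by (subst G[of \<beta>]) (rule UN_upper[OF that])
  have G_le: "G \<alpha> \<subseteq> A" if "\<And>\<beta>. \<beta> \<in> underS r \<alpha> \<Longrightarrow> st \<beta> (G \<beta>) \<subseteq> A" for \<alpha> A
    by (subst G[of \<alpha>]) (rule UN_least[OF that])
  have mono: "G \<alpha> \<subseteq> G \<beta>" if "(\<alpha>, \<beta>) \<in> r" for \<alpha> \<beta>
    by (rule G_le[OF st_le[OF subsetD[OF tr[OF that]]]])
  have "Q \<alpha> (G \<alpha>) (G \<beta>)" if s: "succ_in r \<alpha> \<beta>" for \<alpha> \<beta>
  proof -
    have \<alpha>: "\<alpha> \<in> Field r" and eq: "underS r \<beta> = underS r \<alpha> \<union> {\<alpha>}"
      using s Refl_under_underS[OF REFL] by (auto simp: succ_in_def)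
    have "G \<beta> = st \<alpha> (G \<alpha>)"
    proof
      show "G \<beta> \<subseteq> st \<alpha> (G \<alpha>)"
        by (rule G_le) (use eq st_le[of _ \<alpha>] st(2)[OF good \<alpha>] in blast)
      show "st \<alpha> (G \<alpha>) \<subseteq> G \<beta>" by (rule st_le) (simp add: eq)
    qed
    then show ?thesis using st(3)[OF good \<alpha>] by simp
  qed
  moreover have "G \<beta> = \<Union>(G ` underS r \<beta>)" if l: "limit_in r \<beta>" for \<beta>
  proof
    show "\<Union>(G ` underS r \<beta>) \<subseteq> G \<beta>" using mono by (auto simp: underS_def)
    have "st \<alpha> (G \<alpha>) \<subseteq> \<Union>(G ` underS r \<beta>)" if \<alpha>: "\<alpha> \<in> underS r \<beta>" for \<alpha>
    proof -
      obtain \<gamma> where \<gamma>: "succ_in r \<alpha> \<gamma>" "\<alpha> \<in> underS r \<gamma>" "(\<gamma>, \<beta>) \<in> r"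
        using succ_exists[OF r \<alpha>] by blast
      \<comment> \<open>A limit is no successor, so the successor \<open>\<gamma>\<close> of
        \<open>\<alpha>\<close> is still below \<open>\<beta>\<close>, and \<open>G \<gamma>\<close>
        already contains \<open>st \<alpha> (G \<alpha>)\<close>.\<close>
      then have "\<gamma> \<in> underS r \<beta>" using l by (auto simp: limit_in_def underS_def)
      then show ?thesis using st_le[OF \<gamma>(2)] by blast
    qed
    then show "G \<beta> \<subseteq> \<Union>(G ` underS r \<beta>)" by (rule G_le)
  qed
  moreover have "G \<alpha> = {}" if "underS r \<alpha> = {}" for \<alpha>
    by (subst G[of \<alpha>]) (simp add: that)
  ultimately show ?thesis using good mono by (intro exI[of _ G] conjI allI impI)
qed

section \<open>Resolved complexes\<close>

text \<open>The resolutions in different degrees \<open>m\<close> are chosen independently; nothing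
  relates \<open>D\<close> and \<open>e\<close> in degree \<open>m\<close> to those in degree
  \<open>m - 1\<close> except the differential of \<open>X\<close> itself.\<close>

locale resolved_complex =
  fixes R :: "('r, 'z) ring_scheme" and X :: "('r, 'm) cplx" and n :: nat
    and Bs :: "int \<Rightarrow> nat \<Rightarrow> 'b set" and D :: "int \<Rightarrow> nat \<Rightarrow> ('b \<Rightarrow> 'r) \<Rightarrow> 'b \<Rightarrow> 'r"
    and e :: "int \<Rightarrow> ('b \<Rightarrow> 'r) \<Rightarrow> 'm"
  assumes R: "ring R" and X: "chain_complex R X" and exact: "exact_complex X"
    and res: "\<And>m. free_resolution R n (Bs m) (D m) (e m) (ob X m)"
begin

definition B :: "((int \<times> nat) \<times> 'b) set" where
  "B = {((m, k), b). b \<in> Bs m k}"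

text \<open>
  The graphs of the differentials of the resolutions and, in terms of representatives in the free
  modules, of the differential of \<open>X\<close>, together with the converse relations.
\<close>

definition \<rho> :: "int \<times> nat \<Rightarrow> int \<times> nat \<Rightarrow> ('b \<Rightarrow> 'r) \<Rightarrow> ('b \<Rightarrow> 'r) \<Rightarrow> bool" where
  "\<rho> i i' w z \<longleftrightarrow> (\<exists>m k.
     (i = (m, Suc k) \<and> i' = (m, k) \<and> D m k w = z) \<or>
     (i = (m, k) \<and> i' = (m, Suc k) \<and> D m k z = w) \<or>
     (i = (m, 0) \<and> i' = (m - 1, 0) \<and> bd X m (e m w) = e (m - 1) z) \<or>
     (i = (m - 1, 0) \<and> i' = (m, 0) \<and> bd X m (e m z) = e (m - 1) w))"

lemma slice_B [simp]: "slice B (m, k) = Bs m k"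
  by (simp add: slice_def B_def)

lemma
  shows X_module: "left_module R (ob X m)"
    and e_hom: "e m \<in> lmod_hom R (free_on R (Bs m 0)) (ob X m)"
    and e_surj: "e m ` carrier (free_on R (Bs m 0)) = carrier (ob X m)"
    and D_hom: "D m k \<in> lmod_hom R (free_on R (Bs m (Suc k))) (free_on R (Bs m k))"
    and ker_e: "lmod_kernel (free_on R (Bs m 0)) (ob X m) (e m) = D m 0 ` carrier (free_on R (Bs m 1))"
    and ker_D: "lmod_kernel (free_on R (Bs m (Suc k))) (free_on R (Bs m k)) (D m k) =
        D m (Suc k) ` carrier (free_on R (Bs m (Suc (Suc k))))"
    and Bs_top: "k > n \<Longrightarrow> Bs m k = {}"
  using res[of m] unfolding free_resolution_def by simp_all

lemma free_module: "left_module R (free_on R S)"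
  by (rule free_on_left_module[OF R])

lemmas bd_hom = chain_complexD(2)[OF X]

lemma D_diff:
  assumes "w \<in> carrier (free_on R (Bs m (Suc k)))" "z \<in> carrier (free_on R (Bs m (Suc k)))"
  shows "D m k (\<lambda>b. w b \<ominus>\<^bsub>R\<^esub> z b) = (\<lambda>b. D m k w b \<ominus>\<^bsub>R\<^esub> D m k z b)"
  using lmod_hom_mdiff[OF free_module D_hom assms]
  by (simp only: mdiff_free_on[OF R assms] mdiff_free_on[OF R lmod_homD(1)[OF D_hom] lmod_homD(1)[OF D_hom]] assms)

lemma e_diff:
  assumes "w \<in> carrier (free_on R (Bs m 0))" "z \<in> carrier (free_on R (Bs m 0))"
  shows "e m (\<lambda>b. w b \<ominus>\<^bsub>R\<^esub> z b) = mdiff R (ob X m) (e m w) (e m z)"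
  using lmod_hom_mdiff[OF free_module e_hom assms] by (simp only: mdiff_free_on[OF R assms])

lemma bd_diff:
  "x \<in> carrier (ob X m) \<Longrightarrow> y \<in> carrier (ob X m) \<Longrightarrow>
    bd X m (mdiff R (ob X m) x y) = mdiff R (ob X (m - 1)) (bd X m x) (bd X m y)"
  by (rule lmod_hom_mdiff[OF X_module bd_hom])

lemmas e_closed = lmod_homD(1)[OF e_hom]

text \<open>The index pair \<open>(i, i')\<close> determines which of the four clauses of
  \<open>\<rho>\<close> applies, and the degree in it. Two related pairs over the same indices
  therefore satisfy the same additive equation, and so does their difference.\<close>

sublocale relation_system R B \<rho>
proof (rule relation_system.intro)
  show "ring R" by (rule R)
  fix i i' w w' z z'
  assume w: "w \<in> carrier (free_on R (slice B i))" and w': "w' \<in> carrier (free_on R (slice B i))"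
    and z: "z \<in> carrier (free_on R (slice B i'))" and z': "z' \<in> carrier (free_on R (slice B i'))"
    and rw: "\<rho> i i' w z" and rw': "\<rho> i i' w' z'"
  from rw obtain m k where mk: "(i = (m, Suc k) \<and> i' = (m, k) \<and> D m k w = z) \<or>
     (i = (m, k) \<and> i' = (m, Suc k) \<and> D m k z = w) \<or>
     (i = (m, 0) \<and> i' = (m - 1, 0) \<and> bd X m (e m w) = e (m - 1) z) \<or>
     (i = (m - 1, 0) \<and> i' = (m, 0) \<and> bd X m (e m z) = e (m - 1) w)"
    unfolding \<rho>_def by blast
  then consider (1) "i = (m, Suc k)" "i' = (m, k)" "D m k w = z"
    | (2) "i = (m, k)" "i' = (m, Suc k)" "D m k z = w"
    | (3) "i = (m, 0)" "i' = (m - 1, 0)" "bd X m (e m w) = e (m - 1) z"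
    | (4) "i = (m - 1, 0)" "i' = (m, 0)" "bd X m (e m z) = e (m - 1) w"
    by blast
  then show "\<rho> i i' (\<lambda>b. w b \<ominus>\<^bsub>R\<^esub> w' b) (\<lambda>b. z b \<ominus>\<^bsub>R\<^esub> z' b)"
  proof cases
    case 1
    then have "D m k w' = z'" using rw' by (auto simp: \<rho>_def)
    then have "D m k (\<lambda>b. w b \<ominus>\<^bsub>R\<^esub> w' b) = (\<lambda>b. z b \<ominus>\<^bsub>R\<^esub> z' b)"
      using D_diff[of w m k w'] w w' 1 by simp
    then show ?thesis using 1 unfolding \<rho>_def by blast
  next
    case 2
    then have "D m k z' = w'" using rw' by (auto simp: \<rho>_def)
    then have "D m k (\<lambda>b. z b \<ominus>\<^bsub>R\<^esub> z' b) = (\<lambda>b. w b \<ominus>\<^bsub>R\<^esub> w' b)"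
      using D_diff[of z m k z'] z z' 2 by simp
    then show ?thesis using 2 unfolding \<rho>_def by blast
  next
    case 3
    then have c3: "bd X m (e m w') = e (m - 1) z'" using rw' by (auto simp: \<rho>_def)
    have "bd X m (e m (\<lambda>b. w b \<ominus>\<^bsub>R\<^esub> w' b)) = e (m - 1) (\<lambda>b. z b \<ominus>\<^bsub>R\<^esub> z' b)"
      using w w' z z' 3 c3 by (simp add: e_diff bd_diff e_closed)
    then show ?thesis using 3 unfolding \<rho>_def by blast
  next
    case 4
    then have c4: "bd X m (e m z') = e (m - 1) w'" using rw' by (auto simp: \<rho>_def)
    have "bd X m (e m (\<lambda>b. z b \<ominus>\<^bsub>R\<^esub> z' b)) = e (m - 1) (\<lambda>b. w b \<ominus>\<^bsub>R\<^esub> w' b)"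
      using w w' z z' 4 c4 by (simp add: e_diff bd_diff e_closed)
    then show ?thesis using 4 unfolding \<rho>_def by blast
  qed
qed

lemma FB: "good S \<Longrightarrow> z \<in> F S (m, k) \<Longrightarrow> z \<in> carrier (free_on R (Bs m k))"
  using F_mono[of S B z "(m, k)"] by (simp add: good_def)

lemma goodD:
  assumes "good S" "w \<in> F S i" "z \<in> F B i'" "\<rho> i i' w z"
  shows "\<exists>z\<in>F S i'. \<rho> i i' w z"
  using assms unfolding good_def by blast

text \<open>The graph of a map admits only one witness, so goodness forces the value itself into the
  span.\<close>

lemma D_F:
  assumes S: "good S" and z: "z \<in> F S (m, Suc k)"
  shows "D m k z \<in> F S (m, k)"
proof -
  have "D m k z \<in> F B (m, k)" using lmod_homD(1)[OF D_hom FB[OF S z]] by simp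
  moreover have "\<rho> (m, Suc k) (m, k) z (D m k z)" by (auto simp: \<rho>_def)
  ultimately obtain y where y: "y \<in> F S (m, k)" "\<rho> (m, Suc k) (m, k) z y"
    using goodD[OF S z] by blast
  then have "D m k z = y" by (auto simp: \<rho>_def)
  then show ?thesis using y by simp
qed

text \<open>Goodness for the converse of the graph. It is the source of exactness for the spans of
  good families.\<close>

lemma D_lift:
  assumes S: "good S" and z: "D m k w \<in> F S (m, k)" and w: "w \<in> carrier (free_on R (Bs m (Suc k)))"
  shows "\<exists>s\<in>F S (m, Suc k). D m k s = D m k w"
proof -
  have "\<rho> (m, k) (m, Suc k) (D m k w) w" by (auto simp: \<rho>_def)
  then obtain y where "y \<in> F S (m, Suc k)" "\<rho> (m, k) (m, Suc k) (D m k w) y"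
    using goodD[OF S z, of w "(m, Suc k)"] w by auto
  then show ?thesis by (auto simp: \<rho>_def)
qed

section \<open>Subcomplexes spanned by good families\<close>

definition Y :: "((int \<times> nat) \<times> 'b) set \<Rightarrow> int \<Rightarrow> 'm set" where
  "Y S m = e m ` F S (m, 0)"

definition subcplx :: "((int \<times> nat) \<times> 'b) set \<Rightarrow> ('r, 'm) cplx" where
  "subcplx S = \<lparr>ob = (\<lambda>m. (ob X m)\<lparr>carrier := Y S m\<rparr>), bd = bd X\<rparr>"

lemma subcplx_simps [simp]: "ob (subcplx S) m = (ob X m)\<lparr>carrier := Y S m\<rparr>" "bd (subcplx S) = bd X"
  by (simp_all add: subcplx_def)

text \<open>An arbitrary representative of the boundary serves as witness over \<open>B\<close>;
  goodness trades it for one over \<open>S\<close>, possibly different but with the same image under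
  \<open>e\<close>.\<close>

lemma bd_Y:
  assumes S: "good S" and y: "y \<in> Y S m"
  shows "bd X m y \<in> Y S (m - 1)"
proof -
  obtain w where w: "w \<in> F S (m, 0)" "y = e m w" using y by (auto simp: Y_def)
  have "bd X m (e m w) \<in> carrier (ob X (m - 1))"
    by (rule lmod_homD(1)[OF bd_hom e_closed[OF FB[OF S w(1)]]])
  then obtain z where z: "z \<in> carrier (free_on R (Bs (m - 1) 0))" "e (m - 1) z = bd X m (e m w)"
    unfolding e_surj[symmetric] by auto
  then have "\<rho> (m, 0) (m - 1, 0) w z" by (auto simp: \<rho>_def)
  then obtain z' where "z' \<in> F S (m - 1, 0)" "\<rho> (m, 0) (m - 1, 0) w z'"
    using goodD[OF S w(1), of z "(m - 1, 0)"] z by auto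
  then show ?thesis using w by (auto simp: \<rho>_def Y_def)
qed

text \<open>Goodness for the converse clause of the differential of \<open>X\<close>. The
  \<open>y\<close> obtained may differ from \<open>x\<close> by a cycle; only its boundary matters
  for exactness.\<close>

lemma bd_lift:
  assumes S: "good S" and x: "x \<in> carrier (ob X m)" and y: "bd X m x \<in> Y S (m - 1)"
  shows "\<exists>y\<in>Y S m. bd X m y = bd X m x"
proof -
  obtain z where z: "z \<in> F S (m - 1, 0)" "bd X m x = e (m - 1) z" using y by (auto simp: Y_def)
  obtain w where w: "w \<in> carrier (free_on R (Bs m 0))" "x = e m w"
    using x unfolding e_surj[symmetric] by auto
  have "\<rho> (m - 1, 0) (m, 0) z w" using z w by (auto simp: \<rho>_def)
  then obtain w' where "w' \<in> F S (m, 0)" "\<rho> (m - 1, 0) (m, 0) z w'"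
    using goodD[OF S z(1), of w "(m, 0)"] w by auto
  then show ?thesis using z by (auto simp: \<rho>_def Y_def)
qed

lemma Y_mono: "S \<subseteq> S' \<Longrightarrow> Y S m \<subseteq> Y S' m"
  using F_mono unfolding Y_def by blast

lemma Y_carrier: "good S \<Longrightarrow> Y S m \<subseteq> carrier (ob X m)"
  using FB e_closed by (auto simp: Y_def)

lemma Y_zero: "\<zero>\<^bsub>ob X m\<^esub> \<in> Y S m"
  unfolding Y_def
  by (rule image_eqI[OF _ F_zero]) (simp add: lmod_hom_zero[OF free_module X_module e_hom, symmetric])

lemma Y_add:
  assumes S: "good S" and "x \<in> Y S m" "y \<in> Y S m" shows "x \<oplus>\<^bsub>ob X m\<^esub> y \<in> Y S m"
proof -
  obtain w z where wz: "w \<in> F S (m, 0)" "z \<in> F S (m, 0)" "x = e m w" "y = e m z"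
    using assms(2,3) by (auto simp: Y_def)
  then have "x \<oplus>\<^bsub>ob X m\<^esub> y = e m (\<lambda>b. w b \<oplus>\<^bsub>R\<^esub> z b)"
    using lmod_homD(2)[OF e_hom FB[OF S wz(1)] FB[OF S wz(2)]] by simp
  then show ?thesis using F_add[OF wz(1,2)] by (auto simp: Y_def)
qed

lemma Y_smult:
  assumes S: "good S" and "a \<in> carrier R" "x \<in> Y S m" shows "a \<odot>\<^bsub>ob X m\<^esub> x \<in> Y S m"
proof -
  obtain w where w: "w \<in> F S (m, 0)" "x = e m w" using assms(3) by (auto simp: Y_def)
  then have "a \<odot>\<^bsub>ob X m\<^esub> x = e m (\<lambda>b. a \<otimes>\<^bsub>R\<^esub> w b)"
    using lmod_homD(3)[OF e_hom assms(2) FB[OF S w(1)]] by simp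
  moreover have "(\<lambda>b. a \<otimes>\<^bsub>R\<^esub> w b) \<in> F S (m, 0)"
    using left_module.smult_closed[OF free_module assms(2) w(1)] by (simp only: free_on_ops)
  ultimately show ?thesis by (auto simp: Y_def)
qed

lemma Y_diff:
  assumes S: "good S" and "x \<in> Y S m" "y \<in> Y S m" shows "mdiff R (ob X m) x y \<in> Y S m"
  unfolding mdiff_def using assms R
  by (intro Y_add[OF S] Y_smult[OF S]) (auto intro: ring.ring_simprules)

lemma subcplx_complex:
  assumes S: "good S" shows "chain_complex R (subcplx S)"
  unfolding chain_complex_def
proof (intro allI conjI ballI)
  fix m
  show "left_module R (ob (subcplx S) m)"
    unfolding subcplx_simps
    by (rule left_module_restrict[OF X_module Y_carrier[OF S] Y_zero Y_add[OF S] Y_smult[OF S]])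
  show "bd (subcplx S) m \<in> lmod_hom R (ob (subcplx S) m) (ob (subcplx S) (m - 1))"
    unfolding subcplx_simps by (rule lmod_hom_restrict[OF bd_hom Y_carrier[OF S] bd_Y[OF S]])
  show "bd (subcplx S) (m - 1) (bd (subcplx S) m x) = \<zero>\<^bsub>ob (subcplx S) (m - 2)\<^esub>"
    if "x \<in> carrier (ob (subcplx S) m)" for x
    using that chain_complexD(3)[OF X] Y_carrier[OF S] by auto
qed

lemma subcplx_inclusion:
  assumes "\<And>m. Y S m \<subseteq> Y S' m"
  shows "chain_map R (subcplx S) (subcplx S') (\<lambda>m x. x)"
  unfolding chain_map_def using subsetD[OF assms] by (auto intro!: lmod_homI)

text \<open>The free modules on the parts of \<open>S\<close> and \<open>S'\<close> resolve
  \<open>Y S\<close> and \<open>Y S'\<close>, so their quotients resolve \<open>Y S' / Y S\<close>.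
  The proof is the elementwise form of this, with the quotient of free modules realised by the
  coordinates in \<open>S' - S\<close>.\<close>

lemma subquotient_class:
  fixes C :: "('r, 'c) cplx" and \<kappa> :: "'k rel"
  assumes \<kappa>: "Card_order \<kappa>" and S: "good S" and S': "good S'" and sub: "S \<subseteq> S'"
    and card: "|S' - S| \<le>o \<kappa>" and C: "chain_complex R C"
    and q: "chain_map R (subcplx S') C q" and sur: "\<And>m. q m ` Y S' m = carrier (ob C m)"
    and ker: "\<And>m. lmod_kernel (ob (subcplx S') m) (ob C m) (q m) = Y S m"
  shows "C \<in> ex_tilde R (Proj_dim_card R n \<kappa>)"
proof -
  interpret R: ring R by (rule R)
  note CM = chain_complexD(1)[OF C]
  note q_hom = chain_mapD(1)[OF q]
  note SM = chain_complexD(1)[OF subcplx_complex[OF S']]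
  have qc: "y \<in> Y S' m \<Longrightarrow> q m y \<in> carrier (ob C m)" for y m
    using lmod_homD(1)[OF q_hom] by simp
  have q_bd: "y \<in> Y S' m \<Longrightarrow> q (m - 1) (bd X m y) = bd C m (q m y)" for y m
    using chain_mapD(2)[OF q] by simp
  have q_zero: "q m y = \<zero>\<^bsub>ob C m\<^esub> \<longleftrightarrow> y \<in> Y S m" if "y \<in> Y S' m" for y m
    using ker[of m] that by (auto simp: lmod_kernel_def)
  have q_diff: "q m (mdiff R (ob X m) x y) = mdiff R (ob C m) (q m x) (q m y)"
    if "x \<in> Y S' m" "y \<in> Y S' m" for x y m
    using lmod_hom_mdiff[OF SM q_hom, of x m y] that by simp
  have C_diff0: "mdiff R (ob C m) x \<zero>\<^bsub>ob C m\<^esub> = x" if "x \<in> carrier (ob C m)" for x m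
  proof -
    interpret Cm: left_module R "ob C m" by (rule CM)
    show ?thesis using that by (simp add: mdiff_def)
  qed
  note YS = subsetD[OF Y_carrier[OF S]] and YS' = subsetD[OF Y_carrier[OF S']]
    and YY = subsetD[OF Y_mono[OF sub]]
  have X_diff0: "mdiff R (ob X m) x y = \<zero>\<^bsub>ob X m\<^esub> \<longleftrightarrow> x = y"
    if "x \<in> carrier (ob X m)" "y \<in> carrier (ob X m)" for x y m
    by (rule left_module.mdiff_eq_zero_iff[OF X_module that])
  have "exact_complex C"
    unfolding exact_complex_def
  proof (intro allI equalityI subsetI)
    fix m c assume "c \<in> lmod_kernel (ob C m) (ob C (m - 1)) (bd C m)"
    then obtain y where y: "y \<in> Y S' m" "q m y = c" and "bd C m c = \<zero>\<^bsub>ob C (m - 1)\<^esub>"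
      unfolding lmod_kernel_def sur[symmetric] by auto
    then have "bd X m y \<in> Y S (m - 1)" using q_zero[OF bd_Y[OF S' y(1)]] q_bd[OF y(1)] by simp
    \<comment> \<open>\<open>bd X m y\<close> is only known to lie in \<open>Y S\<close>.
      Subtracting an \<open>s\<close> from \<open>Y S\<close> with the same boundary gives a genuine
      cycle without changing the class \<open>c\<close>.\<close>
    then obtain s where s: "s \<in> Y S m" "bd X m s = bd X m y" using bd_lift[OF S YS'[OF y(1)]] by blast
    let ?d = "mdiff R (ob X m) y s"
    have d: "?d \<in> Y S' m" by (rule Y_diff[OF S' y(1) YY[OF s(1)]])
    have "bd X m ?d = \<zero>\<^bsub>ob X (m - 1)\<^esub>"
      using bd_diff[OF YS'[OF y(1)] YS[OF s(1)]] s(2) lmod_homD(1)[OF bd_hom YS[OF s(1)]] X_diff0 by simp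
    then have "?d \<in> bd X (m + 1) ` carrier (ob X (m + 1))"
      using exact YS'[OF d] unfolding exact_complex_def lmod_kernel_def by blast
    then obtain x where x: "x \<in> carrier (ob X (m + 1))" "bd X (m + 1) x = ?d" by auto
    \<comment> \<open>The preimage from exactness of \<open>X\<close> may lie outside
      \<open>Y S'\<close>; goodness of \<open>S'\<close> exchanges it for one inside.\<close>
    then obtain x' where x': "x' \<in> Y S' (m + 1)" "bd X (m + 1) x' = ?d"
      using bd_lift[OF S' x(1)] d by auto
    have "bd C (m + 1) (q (m + 1) x') = q m ?d" using q_bd[OF x'(1)] x'(2) by simp
    also have "\<dots> = mdiff R (ob C m) c \<zero>\<^bsub>ob C m\<^esub>"
      using q_diff[OF y(1) YY[OF s(1)]] q_zero[OF YY[OF s(1)]] s(1) y(2) by simp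
    also have "\<dots> = c" using C_diff0 qc[OF y(1)] y(2) by simp
    finally show "c \<in> bd C (m + 1) ` carrier (ob C (m + 1))" using qc[OF x'(1)] by (metis image_eqI)
  next
    fix m c assume "c \<in> bd C (m + 1) ` carrier (ob C (m + 1))"
    then obtain c' where c': "c' \<in> carrier (ob C (m + 1))" "c = bd C (m + 1) c'" by blast
    then show "c \<in> lmod_kernel (ob C m) (ob C (m - 1)) (bd C m)"
      using lmod_homD(1)[OF chain_complexD(2)[OF C] c'(1)] chain_complexD(3)[OF C c'(1)]
      by (simp add: lmod_kernel_def)
  qed
  moreover have "ob C m \<in> Proj_dim_card R n \<kappa>" for m
  proof -
    define N where "N = S' - S"
    define T where "T k = slice N (m, k)" for k
    \<comment> \<open>Forgetting the coordinates in \<open>S\<close> represents the projection of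
      \<open>F S'\<close> onto \<open>F S' / F S\<close>, with \<open>F N\<close> as a set of
      representatives.\<close>
    define r where "r k w = (\<lambda>b. if b \<in> T k then w b else \<zero>\<^bsub>R\<^esub>)" for k and w :: "'b \<Rightarrow> 'r"
    have TF: "carrier (free_on R (T k)) = F N (m, k)" for k by (simp add: T_def)
    have NS': "z \<in> F N i \<Longrightarrow> z \<in> F S' i" for z i by (rule F_mono) (auto simp: N_def)
    have SS': "z \<in> F S i \<Longrightarrow> z \<in> F S' i" for z i by (rule F_mono[OF sub])
    have r: "r k w \<in> F N (m, k)" "(\<lambda>b. w b \<ominus>\<^bsub>R\<^esub> r k w b) \<in> F S (m, k)" if w: "w \<in> F S' (m, k)" for k w
    proof -
      have "slice S' (m, k) \<inter> T k = T k" by (auto simp: T_def slice_def N_def)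
      then show rN: "r k w \<in> F N (m, k)"
        using free_on_restrict[OF R w, of "T k"] by (simp add: r_def T_def)
      have "(\<lambda>b. w b \<ominus>\<^bsub>R\<^esub> r k w b) \<in> F S' (m, k)" by (rule F_diff[OF w NS'[OF rN]])
      moreover have "w b \<ominus>\<^bsub>R\<^esub> r k w b = \<zero>\<^bsub>R\<^esub>" if "b \<notin> slice S (m, k)" for b
      proof (cases "b \<in> slice S' (m, k)")
        case True
        then have "b \<in> T k" using that by (simp add: T_def slice_def N_def)
        then show ?thesis using F_val[OF w] by (simp add: r_def R.minus_eq R.r_neg)
      next
        case False
        then have "w b = \<zero>\<^bsub>R\<^esub>" using w by (simp add: free_on_carrier)
        then show ?thesis by (simp add: r_def R.minus_eq)
      qed
      ultimately show "(\<lambda>b. w b \<ominus>\<^bsub>R\<^esub> r k w b) \<in> F S (m, k)" by (simp add: free_on_carrier)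
    qed
    have r_diff: "r k (\<lambda>b. w b \<ominus>\<^bsub>R\<^esub> z b) = (\<lambda>b. r k w b \<ominus>\<^bsub>R\<^esub> r k z b)" for k w z
      by (auto simp: r_def R.minus_eq fun_eq_iff)
    have r_S: "r k w = (\<lambda>_. \<zero>\<^bsub>R\<^esub>)" if "w \<in> F S (m, k)" for k w
    proof
      show "r k w b = \<zero>\<^bsub>R\<^esub>" for b
        using that by (cases "b \<in> T k") (simp_all add: r_def T_def slice_def N_def free_on_carrier)
    qed
    have r_N: "r k w = w" if "w \<in> F N (m, k)" for k w
    proof
      show "r k w b = w b" for b
        using that by (cases "b \<in> T k") (simp_all add: r_def T_def free_on_carrier)
    qed
    have rz: "r k (\<lambda>_. \<zero>\<^bsub>R\<^esub>) = (\<lambda>_. \<zero>\<^bsub>R\<^esub>)" for k by (auto simp: r_def)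
    have minus0: "(\<lambda>b. w b \<ominus>\<^bsub>R\<^esub> \<zero>\<^bsub>R\<^esub>) = w" if "w \<in> F A i" for w A i
      using F_val[OF that] by (simp add: R.minus_eq)
    have minus_self: "(\<lambda>b. w b \<ominus>\<^bsub>R\<^esub> w b) = (\<lambda>_. \<zero>\<^bsub>R\<^esub>)" if "w \<in> F A i" for w A i
      using F_val[OF that] by (simp add: R.minus_eq R.r_neg)
    have minus_eq0: "w = z" if "(\<lambda>b. w b \<ominus>\<^bsub>R\<^esub> z b) = (\<lambda>_. \<zero>\<^bsub>R\<^esub>)" "w \<in> F A i" "z \<in> F A' i'" for w z A A' i i'
    proof
      fix b
      have wz: "w b \<in> carrier R" "z b \<in> carrier R" using F_val that(2,3) by blast+
      then have "w b = z b \<oplus>\<^bsub>R\<^esub> (w b \<ominus>\<^bsub>R\<^esub> z b)" by algebra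
      then show "w b = z b" using fun_cong[OF that(1), of b] wz by simp
    qed
    \<comment> \<open>Truncating changes \<open>w\<close> by an element of \<open>F S\<close>, whose
      image under \<open>D\<close> stays in \<open>F S\<close> and is erased by \<open>r\<close>. So
      truncated \<open>D\<close> is the differential induced on the quotients.\<close>
    have rDr: "r k (D m k (r (Suc k) w)) = r k (D m k w)" if w: "w \<in> F S' (m, Suc k)" for k w
    proof -
      let ?s = "\<lambda>b. w b \<ominus>\<^bsub>R\<^esub> r (Suc k) w b"
      have rw: "r (Suc k) w \<in> F S' (m, Suc k)" by (rule NS'[OF r(1)[OF w]])
      have "D m k ?s = (\<lambda>b. D m k w b \<ominus>\<^bsub>R\<^esub> D m k (r (Suc k) w) b)"
        by (rule D_diff[OF FB[OF S' w] FB[OF S' rw]])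
      moreover have "r k (D m k ?s) = (\<lambda>_. \<zero>\<^bsub>R\<^esub>)" by (rule r_S[OF D_F[OF S r(2)[OF w]]])
      ultimately have "(\<lambda>b. r k (D m k w) b \<ominus>\<^bsub>R\<^esub> r k (D m k (r (Suc k) w)) b) = (\<lambda>_. \<zero>\<^bsub>R\<^esub>)"
        by (simp add: r_diff)
      then have "r k (D m k w) = r k (D m k (r (Suc k) w))"
        by (rule minus_eq0[OF _ r(1)[OF D_F[OF S' w]] r(1)[OF D_F[OF S' rw]]])
      then show ?thesis by simp
    qed
    have eY: "w \<in> F S' (m, 0) \<Longrightarrow> e m w \<in> Y S' m" "w \<in> F S (m, 0) \<Longrightarrow> e m w \<in> Y S m" for w
      by (simp_all add: Y_def)
    \<comment> \<open>Likewise \<open>e\<close> maps the discarded part into \<open>Y S\<close>, the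
      kernel of \<open>q\<close>.\<close>
    have qer: "q m (e m (r 0 w)) = q m (e m w)" if w: "w \<in> F S' (m, 0)" for w
    proof -
      let ?s = "\<lambda>b. w b \<ominus>\<^bsub>R\<^esub> r 0 w b"
      have rw: "r 0 w \<in> F S' (m, 0)" by (rule NS'[OF r(1)[OF w]])
      have "e m ?s \<in> Y S m" by (rule eY(2)[OF r(2)[OF w]])
      then have "q m (e m ?s) = \<zero>\<^bsub>ob C m\<^esub>" using q_zero YY by blast
      then have "mdiff R (ob C m) (q m (e m w)) (q m (e m (r 0 w))) = \<zero>\<^bsub>ob C m\<^esub>"
        unfolding e_diff[OF FB[OF S' w] FB[OF S' rw]] q_diff[OF eY(1)[OF w] eY(1)[OF rw]] .
      then show ?thesis
        using left_module.mdiff_eq_zero_iff[OF CM qc[OF eY(1)[OF w]] qc[OF eY(1)[OF rw]]] by simp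
    qed
    define D' where "D' k z = r k (D m k z)" for k z
    define e' where "e' z = q m (e m z)" for z
    have D': "D' k z \<in> F N (m, k)" if "z \<in> F N (m, Suc k)" for k z
      unfolding D'_def by (rule r(1)[OF D_F[OF S' NS'[OF that]]])
    have S'D0: "\<exists>w\<in>F S' (m, Suc k). D m k w = z"
      if z: "z \<in> F S' (m, k)" "z \<in> D m k ` carrier (free_on R (Bs m (Suc k)))" for z k
    proof -
      obtain w where w: "w \<in> carrier (free_on R (Bs m (Suc k)))" "D m k w = z" using z(2) by auto
      then show ?thesis using D_lift[OF S', of m k w] z(1) by simp
    qed
    \<comment> \<open>A representative that becomes a boundary after a correction in
      \<open>F S\<close> is a boundary in the quotient; the harder inclusion of both kernel
      computations reduces to this.\<close>
    have lift: "z \<in> D' k ` F N (m, Suc k)"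
      if z: "z \<in> F N (m, k)" and s: "s \<in> F S (m, k)"
        and d: "(\<lambda>b. z b \<ominus>\<^bsub>R\<^esub> s b) \<in> D m k ` carrier (free_on R (Bs m (Suc k)))" for z s k
    proof -
      obtain w where w: "w \<in> F S' (m, Suc k)" "D m k w = (\<lambda>b. z b \<ominus>\<^bsub>R\<^esub> s b)"
        using S'D0[OF F_diff[OF NS'[OF z] SS'[OF s]] d] by blast
      have "D' k (r (Suc k) w) = (\<lambda>b. r k z b \<ominus>\<^bsub>R\<^esub> r k s b)"
        unfolding D'_def rDr[OF w(1)] w(2) r_diff ..
      then have "D' k (r (Suc k) w) = z" using r_S[OF s] r_N[OF z] minus0[OF z] by simp
      then show ?thesis using r(1)[OF w(1)] by (metis image_eqI)
    qed
    have D'_hom: "D' k \<in> lmod_hom R (free_on R (T (Suc k))) (free_on R (T k))" for k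
    proof (rule lmod_homI)
      fix x assume x: "x \<in> carrier (free_on R (T (Suc k)))"
      then have xB: "x \<in> carrier (free_on R (Bs m (Suc k)))" unfolding TF by (rule FB[OF S' NS'])
      show "D' k x \<in> carrier (free_on R (T k))" using D' x unfolding TF .
      show "D' k (x \<oplus>\<^bsub>free_on R (T (Suc k))\<^esub> y) = D' k x \<oplus>\<^bsub>free_on R (T k)\<^esub> D' k y"
        if y: "y \<in> carrier (free_on R (T (Suc k)))" for y
      proof -
        have yB: "y \<in> carrier (free_on R (Bs m (Suc k)))" using y unfolding TF by (rule FB[OF S' NS'])
        show ?thesis using lmod_homD(2)[OF D_hom xB yB] by (auto simp: D'_def r_def)
      qed
      show "D' k (a \<odot>\<^bsub>free_on R (T (Suc k))\<^esub> x) = a \<odot>\<^bsub>free_on R (T k)\<^esub> D' k x" if a: "a \<in> carrier R" for a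
        using lmod_homD(3)[OF D_hom a xB] a by (auto simp: D'_def r_def)
    qed
    have e_hom': "e m \<in> lmod_hom R (free_on R (slice S' (m, 0))) (ob (subcplx S') m)"
      using lmod_homD(2,3)[OF e_hom] FB[OF S'] eY(1) by (intro lmod_homI) simp_all
    have e'_hom: "e' \<in> lmod_hom R (free_on R (T 0)) (ob C m)"
    proof -
      have "(\<lambda>z. q m (e m z)) \<in> lmod_hom R (free_on R (slice S' (m, 0))) (ob C m)"
        by (rule lmod_hom_comp[OF e_hom' q_hom])
      note h = lmod_homD[OF this]
      show ?thesis
        using h NS' unfolding e'_def by (intro lmod_homI) (simp_all add: TF)
    qed
    have e'_sur: "e' ` F N (m, 0) = carrier (ob C m)"
    proof (intro equalityI subsetI)
      fix c assume "c \<in> carrier (ob C m)"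
      then obtain w where w: "w \<in> F S' (m, 0)" "c = q m (e m w)" unfolding sur[symmetric] Y_def by auto
      then have "c = e' (r 0 w)" by (simp add: e'_def qer)
      then show "c \<in> e' ` F N (m, 0)" using r(1)[OF w(1)] by blast
    qed (use lmod_homD(1)[OF e'_hom] TF in auto)
    have ker_e': "lmod_kernel (free_on R (T 0)) (ob C m) e' = D' 0 ` F N (m, 1)"
    proof (intro equalityI subsetI)
      fix z assume "z \<in> lmod_kernel (free_on R (T 0)) (ob C m) e'"
      then have z: "z \<in> F N (m, 0)" "q m (e m z) = \<zero>\<^bsub>ob C m\<^esub>" by (simp_all add: lmod_kernel_def TF e'_def)
      then have "e m z \<in> Y S m" using q_zero[OF eY(1)[OF NS'[OF z(1)]]] by simp
      then obtain s where s: "s \<in> F S (m, 0)" "e m s = e m z" by (auto simp: Y_def)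
      have zs: "(\<lambda>b. z b \<ominus>\<^bsub>R\<^esub> s b) \<in> F S' (m, 0)" by (rule F_diff[OF NS'[OF z(1)] SS'[OF s(1)]])
      have "e m (\<lambda>b. z b \<ominus>\<^bsub>R\<^esub> s b) = \<zero>\<^bsub>ob X m\<^esub>"
        using e_diff[OF FB[OF S' NS'[OF z(1)]] FB[OF S s(1)]] s(2) X_diff0 e_closed[OF FB[OF S s(1)]] by simp
      then have "(\<lambda>b. z b \<ominus>\<^bsub>R\<^esub> s b) \<in> D m 0 ` carrier (free_on R (Bs m 1))"
        using FB[OF S' zs] unfolding ker_e[symmetric] by (simp add: lmod_kernel_def)
      then show "z \<in> D' 0 ` F N (m, 1)" using lift[OF z(1) s(1)] by simp
    next
      fix z assume "z \<in> D' 0 ` F N (m, 1)"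
      then obtain w where w: "w \<in> F N (m, Suc 0)" "z = r 0 (D m 0 w)" by (auto simp: D'_def)
      have wS': "w \<in> F S' (m, Suc 0)" by (rule NS'[OF w(1)])
      have "D m 0 w \<in> lmod_kernel (free_on R (Bs m 0)) (ob X m) (e m)"
        unfolding ker_e using FB[OF S' wS'] by simp
      then have "e m (D m 0 w) \<in> Y S m" using Y_zero by (simp add: lmod_kernel_def)
      then have "e' z = \<zero>\<^bsub>ob C m\<^esub>"
        using qer[OF D_F[OF S' wS']] q_zero[OF eY(1)[OF D_F[OF S' wS']]] w(2) by (simp add: e'_def)
      then show "z \<in> lmod_kernel (free_on R (T 0)) (ob C m) e'"
        using r(1)[OF D_F[OF S' wS']] w(2) by (simp add: lmod_kernel_def TF)
    qed
    have ker_D': "lmod_kernel (free_on R (T (Suc k))) (free_on R (T k)) (D' k) = D' (Suc k) ` F N (m, Suc (Suc k))" for k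
    proof (intro equalityI subsetI)
      fix z assume "z \<in> lmod_kernel (free_on R (T (Suc k))) (free_on R (T k)) (D' k)"
      then have z: "z \<in> F N (m, Suc k)" "r k (D m k z) = (\<lambda>_. \<zero>\<^bsub>R\<^esub>)"
        by (simp_all add: lmod_kernel_def TF D'_def)
      have DzS': "D m k z \<in> F S' (m, k)" by (rule D_F[OF S' NS'[OF z(1)]])
      \<comment> \<open>A cycle of the quotient has its \<open>D\<close>-image in
        \<open>F S\<close>, and \<open>D_lift\<close> finds \<open>s\<close> in \<open>F S\<close>
        with the same image, so \<open>z - s\<close> is a cycle of the full resolution.\<close>
      have "D m k z \<in> F S (m, k)"
        using r(2)[OF DzS'] minus0[OF DzS'] z(2) by simp
      then obtain s where s: "s \<in> F S (m, Suc k)" "D m k s = D m k z"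
        using D_lift[OF S _ FB[OF S' NS'[OF z(1)]]] by blast
      have zs: "(\<lambda>b. z b \<ominus>\<^bsub>R\<^esub> s b) \<in> F S' (m, Suc k)" by (rule F_diff[OF NS'[OF z(1)] SS'[OF s(1)]])
      have "D m k (\<lambda>b. z b \<ominus>\<^bsub>R\<^esub> s b) = (\<lambda>_. \<zero>\<^bsub>R\<^esub>)"
        using D_diff[OF FB[OF S' NS'[OF z(1)]] FB[OF S s(1)]] s(2) minus_self[OF DzS'] by simp
      then have "(\<lambda>b. z b \<ominus>\<^bsub>R\<^esub> s b) \<in> D m (Suc k) ` carrier (free_on R (Bs m (Suc (Suc k))))"
        using FB[OF S' zs] unfolding ker_D[symmetric] by (simp add: lmod_kernel_def)
      then show "z \<in> D' (Suc k) ` F N (m, Suc (Suc k))" by (rule lift[OF z(1) s(1)])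
    next
      fix z assume "z \<in> D' (Suc k) ` F N (m, Suc (Suc k))"
      then obtain w where w: "w \<in> F N (m, Suc (Suc k))" "z = r (Suc k) (D m (Suc k) w)" by (auto simp: D'_def)
      have wS': "w \<in> F S' (m, Suc (Suc k))" by (rule NS'[OF w(1)])
      have "D m (Suc k) w \<in> lmod_kernel (free_on R (Bs m (Suc k))) (free_on R (Bs m k)) (D m k)"
        unfolding ker_D using FB[OF S' wS'] by simp
      then have "D' k z = (\<lambda>_. \<zero>\<^bsub>R\<^esub>)"
        using rDr[OF D_F[OF S' wS']] w(2) rz by (simp add: D'_def lmod_kernel_def)
      then show "z \<in> lmod_kernel (free_on R (T (Suc k))) (free_on R (T k)) (D' k)"
        using r(1)[OF D_F[OF S' wS']] w(2) by (simp add: lmod_kernel_def TF)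
    qed
    have "T k = {}" if "k > n" for k
    proof -
      have "T k \<subseteq> slice B (m, k)" using S' by (auto simp: T_def slice_def N_def good_def)
      then show ?thesis using Bs_top[OF that] by simp
    qed
    then have "free_resolution R n T D' e' (ob C m)"
      unfolding free_resolution_def TF using CM e'_hom e'_sur D'_hom ker_e' ker_D' by simp
    moreover have "|T k| \<le>o \<kappa>" for k
    proof -
      have "T k \<subseteq> snd ` N" by (force simp: T_def slice_def)
      then have "|T k| \<le>o |N|" by (rule surj_imp_ordLeq)
      then show ?thesis using card unfolding N_def by (rule ordLeq_transitive)
    qed
    ultimately show ?thesis by (rule free_resolution_Proj_dim_card[OF R \<kappa>])
  qed
  ultimately show ?thesis using C by (simp add: ex_tilde_def)
qed

text \<open>The maps of a cocone agree on overlaps because any two indices are comparable, so they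
  glue over the union. The hypothesis is stated for \<open>Y\<close> only: for \<open>S = B\<close>
  the families \<open>G \<alpha>\<close> reach all elements of \<open>X\<close> but may fail to
  exhaust \<open>B\<close>.\<close>

lemma is_colimit_subcplx:
  fixes r :: "'i rel"
  assumes r: "Well_order r" and J: "J \<subseteq> Field r" "J \<noteq> {}"
    and mono: "\<And>\<alpha> \<beta>. (\<alpha>, \<beta>) \<in> r \<Longrightarrow> G \<alpha> \<subseteq> G \<beta>"
    and G: "\<And>\<alpha>. good (G \<alpha>)" and S: "good S" and Y: "\<And>m. Y S m = (\<Union>\<alpha>\<in>J. Y (G \<alpha>) m)"
  shows "is_colimit R r J (\<lambda>\<alpha>. subcplx (G \<alpha>)) (\<lambda>_ _ _ x. x) (subcplx S) (\<lambda>_ _ x. x)"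
proof -
  have incl: "chain_map R (subcplx (G \<alpha>)) (subcplx S) (\<lambda>m x. x)" if "\<alpha> \<in> J" for \<alpha>
    by (rule subcplx_inclusion) (use Y that in blast)
  have "factors_uniquely R J (\<lambda>\<alpha>. subcplx (G \<alpha>)) (subcplx S) (\<lambda>_ _ x. x) Z h"
    if Z: "chain_complex R Z" and "cocone R r J (\<lambda>\<alpha>. subcplx (G \<alpha>)) (\<lambda>_ _ _ x. x) Z h"
    for Z :: "('r, ('i \<times> 'm) set) cplx" and h
  proof -
    have h: "chain_map R (subcplx (G \<alpha>)) Z (h \<alpha>)" if "\<alpha> \<in> J" for \<alpha>
      using \<open>cocone R r J _ _ Z h\<close> that by (simp add: cocone_def)
    have comp: "h \<beta> m x = h \<alpha> m x" if "\<alpha> \<in> J" "\<beta> \<in> J" "(\<alpha>, \<beta>) \<in> r" "x \<in> Y (G \<alpha>) m" for \<alpha> \<beta> m x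
      using \<open>cocone R r J _ _ Z h\<close> that unfolding cocone_def subcplx_simps by simp
    have hh: "h \<alpha> m x \<in> carrier (ob Z m)"
      "a \<in> carrier R \<Longrightarrow> h \<alpha> m (a \<odot>\<^bsub>ob X m\<^esub> x) = a \<odot>\<^bsub>ob Z m\<^esub> h \<alpha> m x"
      "y \<in> Y (G \<alpha>) m \<Longrightarrow> h \<alpha> m (x \<oplus>\<^bsub>ob X m\<^esub> y) = h \<alpha> m x \<oplus>\<^bsub>ob Z m\<^esub> h \<alpha> m y"
      "h \<alpha> (m - 1) (bd X m x) = bd Z m (h \<alpha> m x)"
      if "\<alpha> \<in> J" "x \<in> Y (G \<alpha>) m" for \<alpha> m x y a
      using lmod_homD[OF chain_mapD(1)[OF h[OF that(1)], of m]] chain_mapD(2)[OF h[OF that(1)], of x m] that(2)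
      by simp_all
    have dir: "(\<alpha>, \<beta>) \<in> r \<or> (\<beta>, \<alpha>) \<in> r" if "\<alpha> \<in> J" "\<beta> \<in> J" for \<alpha> \<beta>
      using wo_rel.TOTALS[of r] r J(1) that by (auto simp: wo_rel_def)
    define u where "u m x = h (SOME \<alpha>. \<alpha> \<in> J \<and> x \<in> Y (G \<alpha>) m) m x" for m x
    have u: "u m x = h \<alpha> m x" if \<alpha>: "\<alpha> \<in> J" "x \<in> Y (G \<alpha>) m" for \<alpha> m x
    proof -
      define \<beta> where "\<beta> = (SOME \<alpha>. \<alpha> \<in> J \<and> x \<in> Y (G \<alpha>) m)"
      have "\<beta> \<in> J \<and> x \<in> Y (G \<beta>) m"
        unfolding \<beta>_def by (rule someI[of "\<lambda>\<alpha>. \<alpha> \<in> J \<and> x \<in> Y (G \<alpha>) m" \<alpha>]) (use \<alpha> in simp)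
      then have \<beta>: "\<beta> \<in> J" "x \<in> Y (G \<beta>) m" by simp_all
      have "h \<beta> m x = h \<alpha> m x"
        using dir[OF \<alpha>(1) \<beta>(1)] comp[OF \<alpha>(1) \<beta>(1) _ \<alpha>(2)] comp[OF \<beta>(1) \<alpha>(1) _ \<beta>(2)] by auto
      then show ?thesis by (simp only: u_def \<beta>_def)
    qed
    have joint: "\<exists>\<alpha>\<in>J. x \<in> Y (G \<alpha>) m \<and> y \<in> Y (G \<alpha>) m" if xy: "x \<in> Y S m" "y \<in> Y S m" for x y m
    proof -
      obtain \<alpha> \<beta> where "\<alpha> \<in> J" "x \<in> Y (G \<alpha>) m" "\<beta> \<in> J" "y \<in> Y (G \<beta>) m" using xy unfolding Y by blast
      then show ?thesis using dir[of \<alpha> \<beta>] Y_mono[OF mono] by blast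
    qed
    have "chain_map R (subcplx S) Z u"
      unfolding chain_map_def
    proof (intro allI conjI ballI)
      fix m
      show "u m \<in> lmod_hom R (ob (subcplx S) m) (ob Z m)"
      proof (rule lmod_homI)
        fix x assume "x \<in> carrier (ob (subcplx S) m)"
        then have x: "x \<in> Y S m" by simp
        then obtain \<alpha> where \<alpha>: "\<alpha> \<in> J" "x \<in> Y (G \<alpha>) m" using Y by auto
        show "u m x \<in> carrier (ob Z m)" using u[OF \<alpha>] hh(1)[OF \<alpha>] by simp
        show "u m (a \<odot>\<^bsub>ob (subcplx S) m\<^esub> x) = a \<odot>\<^bsub>ob Z m\<^esub> u m x" if a: "a \<in> carrier R" for a
          using hh(2)[OF \<alpha> a] u[OF \<alpha>] u[OF \<alpha>(1) Y_smult[OF G a \<alpha>(2)]] by simp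
        show "u m (x \<oplus>\<^bsub>ob (subcplx S) m\<^esub> y) = u m x \<oplus>\<^bsub>ob Z m\<^esub> u m y"
          if "y \<in> carrier (ob (subcplx S) m)" for y
        proof -
          obtain \<beta> where \<beta>: "\<beta> \<in> J" "x \<in> Y (G \<beta>) m" "y \<in> Y (G \<beta>) m"
            using joint[OF x, of y] \<open>y \<in> carrier (ob (subcplx S) m)\<close> by auto
          show ?thesis
            using hh(3)[OF \<beta>] u[OF \<beta>(1,2)] u[OF \<beta>(1,3)] u[OF \<beta>(1) Y_add[OF G \<beta>(2,3)]] by simp
        qed
      qed
      fix x assume "x \<in> carrier (ob (subcplx S) m)"
      then obtain \<alpha> where \<alpha>: "\<alpha> \<in> J" "x \<in> Y (G \<alpha>) m" using Y by auto
      show "u (m - 1) (bd (subcplx S) m x) = bd Z m (u m x)"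
        using hh(4)[OF \<alpha>] u[OF \<alpha>] u[OF \<alpha>(1) bd_Y[OF G \<alpha>(2)]] by simp
    qed
    moreover have "v m x = v' m x"
      if v: "\<forall>\<alpha>\<in>J. \<forall>m. \<forall>x\<in>Y (G \<alpha>) m. v m x = h \<alpha> m x"
        and v': "\<forall>\<alpha>\<in>J. \<forall>m. \<forall>x\<in>Y (G \<alpha>) m. v' m x = h \<alpha> m x" and x: "x \<in> Y S m" for v v' m x
      using v v' x Y by auto
    ultimately show ?thesis
      unfolding factors_uniquely_def Let_def using u by (intro conjI exI[of _ u]) auto
  qed
  moreover have "cocone R r J (\<lambda>\<alpha>. subcplx (G \<alpha>)) (\<lambda>_ _ _ x. x) (subcplx S) (\<lambda>_ _ x. x)"
    unfolding cocone_def using incl by simp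
  ultimately show ?thesis
    unfolding is_colimit_def using subcplx_complex[OF S] by (intro conjI allI impI) simp_all
qed

lemma Y_Union:
  assumes chain: "subset.chain UNIV \<C>" "\<C> \<noteq> {}"
  shows "Y (\<Union>\<C>) m = (\<Union>S\<in>\<C>. Y S m)"
proof
  show "Y (\<Union>\<C>) m \<subseteq> (\<Union>S\<in>\<C>. Y S m)"
  proof
    fix y assume "y \<in> Y (\<Union>\<C>) m"
    then obtain w where w: "w \<in> F (\<Union>\<C>) (m, 0)" "y = e m w" by (auto simp: Y_def)
    then show "y \<in> (\<Union>S\<in>\<C>. Y S m)" using F_Union[OF chain w(1)] by (auto simp: Y_def)
  qed
  show "(\<Union>S\<in>\<C>. Y S m) \<subseteq> Y (\<Union>\<C>) m"
    using Y_mono[of _ "\<Union>\<C>"] by blast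
qed

lemma good_B: "good B"
  by (auto simp: good_def)

lemma subcplx_B: "subcplx B = X"
proof -
  have "Y B m = carrier (ob X m)" for m by (simp add: Y_def e_surj)
  then show ?thesis by (simp add: subcplx_def)
qed

lemma has_filtration:
  fixes \<kappa> :: "'k rel"
  assumes \<kappa>: "Card_order \<kappa>" "infinite (Field \<kappa>)" and R\<kappa>: "|carrier R| \<le>o \<kappa>"
  shows "has_filtration R (ex_tilde R (Proj_dim_card R n \<kappa>)) X"
proof -
  \<comment> \<open>The elements of \<open>X\<close> serve as indices: stage \<open>(m, x)\<close>
    is followed by one whose subcomplex contains \<open>x\<close> in degree \<open>m\<close>. As a
    subset of \<open>int \<times> 'm\<close> this is also of the type prescribed for the
    ordinal.\<close>
  define \<Sigma> where "\<Sigma> = {(m, x). x \<in> carrier (ob X m)}"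
  let ?r = "|\<Sigma>|"
  have r: "Well_order ?r" by (rule card_of_Well_order)
  have fld: "Field ?r = \<Sigma>" by (rule Field_card_of)
  \<comment> \<open>The zeros of all degrees make \<Sigma> infinite, so its cardinal order has no
    last element and every index has a successor at which its element is reached.\<close>
  have inf: "infinite (Field ?r)"
  proof
    assume "finite (Field ?r)"
    moreover have "range (\<lambda>m. (m, \<zero>\<^bsub>ob X m\<^esub>)) \<subseteq> \<Sigma>"
      using Y_zero Y_carrier[OF good_B] by (auto simp: \<Sigma>_def)
    ultimately have "finite (range (\<lambda>m. (m, \<zero>\<^bsub>ob X m\<^esub>)))" unfolding fld by (rule rev_finite_subset)
    then have "finite (UNIV :: int set)" by (rule finite_imageD) (auto intro: injI)
    then show False using infinite_UNIV_int by simp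
  qed
  have step: "\<exists>S'. good S' \<and> S \<subseteq> S' \<and> |S' - S| \<le>o \<kappa> \<and> snd \<alpha> \<in> Y S' (fst \<alpha>)"
    if S: "good S" and "\<alpha> \<in> Field ?r" for S \<alpha>
  proof -
    obtain m x where \<alpha>: "\<alpha> = (m, x)" "x \<in> carrier (ob X m)" using \<open>\<alpha> \<in> Field ?r\<close> fld by (auto simp: \<Sigma>_def)
    then obtain w where w: "w \<in> carrier (free_on R (Bs m 0))" "x = e m w" unfolding e_surj[symmetric] by auto
    let ?A = "{(m, 0 :: nat)} \<times> {b. w b \<noteq> \<zero>\<^bsub>R\<^esub>}"
    have "finite ?A" "?A \<subseteq> B" using w(1) by (auto simp: free_on_carrier B_def)
    then obtain T where T: "?A \<subseteq> T" "|T| \<le>o \<kappa>" "good (S \<union> T)"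
      using good_extend[OF \<kappa> R\<kappa> S _ card_of_finite_ordLeq[OF \<kappa>]] by blast
    have "w \<in> F (S \<union> T) (m, 0)" using w(1) T(1) by (auto simp: free_on_carrier slice_def)
    then have "x \<in> Y (S \<union> T) m" using w(2) by (auto simp: Y_def)
    moreover have "|S \<union> T - S| \<le>o |T|" by (rule card_of_mono1) blast
    then have "|S \<union> T - S| \<le>o \<kappa>" using T(2) by (rule ordLeq_transitive)
    ultimately show ?thesis using T(3) \<alpha>(1) by (intro exI[of _ "S \<union> T"]) auto
  qed
  have "\<exists>G. (\<forall>\<alpha>. good (G \<alpha>)) \<and> (\<forall>\<alpha>. underS ?r \<alpha> = {} \<longrightarrow> G \<alpha> = {}) \<and>
    (\<forall>\<alpha> \<beta>. (\<alpha>, \<beta>) \<in> ?r \<longrightarrow> G \<alpha> \<subseteq> G \<beta>) \<and>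
    (\<forall>\<alpha> \<beta>. succ_in ?r \<alpha> \<beta> \<longrightarrow> |G \<beta> - G \<alpha>| \<le>o \<kappa> \<and> snd \<alpha> \<in> Y (G \<beta>) (fst \<alpha>)) \<and>
    (\<forall>\<beta>. limit_in ?r \<beta> \<longrightarrow> G \<beta> = \<Union>(G ` underS ?r \<beta>))"
    by (rule transfinite_union_chain[OF r, of good
          "\<lambda>\<alpha> S S'. |S' - S| \<le>o \<kappa> \<and> snd \<alpha> \<in> Y S' (fst \<alpha>)"]) (fact good_Union step)+
  then obtain G where G: "(\<forall>\<alpha>. good (G \<alpha>)) \<and> (\<forall>\<alpha>. underS ?r \<alpha> = {} \<longrightarrow> G \<alpha> = {}) \<and>
    (\<forall>\<alpha> \<beta>. (\<alpha>, \<beta>) \<in> ?r \<longrightarrow> G \<alpha> \<subseteq> G \<beta>) \<and>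
    (\<forall>\<alpha> \<beta>. succ_in ?r \<alpha> \<beta> \<longrightarrow> |G \<beta> - G \<alpha>| \<le>o \<kappa> \<and> snd \<alpha> \<in> Y (G \<beta>) (fst \<alpha>)) \<and>
    (\<forall>\<beta>. limit_in ?r \<beta> \<longrightarrow> G \<beta> = \<Union>(G ` underS ?r \<beta>))" ..
  have good: "good (G \<alpha>)" for \<alpha> by (rule G[THEN conjunct1, THEN spec])
  note G = G[THEN conjunct2]
  have bot: "G \<alpha> = {}" if "underS ?r \<alpha> = {}" for \<alpha>
    by (rule G[THEN conjunct1, THEN spec, THEN mp, OF that])
  note G = G[THEN conjunct2]
  have mono: "G \<alpha> \<subseteq> G \<beta>" if "(\<alpha>, \<beta>) \<in> ?r" for \<alpha> \<beta>
    by (rule G[THEN conjunct1, THEN spec, THEN spec, THEN mp, OF that])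
  note G = G[THEN conjunct2]
  have succ: "|G \<beta> - G \<alpha>| \<le>o \<kappa>" "snd \<alpha> \<in> Y (G \<beta>) (fst \<alpha>)" if "succ_in ?r \<alpha> \<beta>" for \<alpha> \<beta>
    using G[THEN conjunct1, THEN spec, THEN spec, THEN mp, OF that] by simp_all
  have lim: "G \<beta> = \<Union>(G ` underS ?r \<beta>)" if "limit_in ?r \<beta>" for \<beta>
    by (rule G[THEN conjunct2, THEN spec, THEN mp, OF that])
  let ?F = "\<lambda>\<alpha>. subcplx (G \<alpha>)" and ?t = "\<lambda>_ _ _ x. x"
  have incl: "chain_map R (?F \<alpha>) (?F \<beta>) (\<lambda>m x. x)" if "(\<alpha>, \<beta>) \<in> ?r" for \<alpha> \<beta>
    by (rule subcplx_inclusion[OF Y_mono[OF mono[OF that]]])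
  have total: "Y B m = (\<Union>\<alpha>\<in>Field ?r. Y (G \<alpha>) m)" for m
  proof (intro equalityI subsetI)
    fix x assume "x \<in> Y B m"
    then have "(m, x) \<in> Field ?r" using Y_carrier[OF good_B] fld by (auto simp: \<Sigma>_def)
    then obtain \<beta> where "(m, x) \<in> underS ?r \<beta>"
      using infinite_Card_order_limit[OF card_of_Card_order inf] unfolding underS_def by blast
    then obtain \<gamma> where \<gamma>: "succ_in ?r (m, x) \<gamma>" using succ_exists[OF r] by blast
    then have "\<gamma> \<in> Field ?r" by (simp add: succ_in_def)
    then show "x \<in> (\<Union>\<alpha>\<in>Field ?r. Y (G \<alpha>) m)" using succ(2)[OF \<gamma>] by auto
  next
    fix x assume "x \<in> (\<Union>\<alpha>\<in>Field ?r. Y (G \<alpha>) m)"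
    then show "x \<in> Y B m" using good Y_mono[of _ B] unfolding good_def by blast
  qed
  have fctr: "cplx_functor R ?r ?F ?t"
    unfolding cplx_functor_def
  proof (intro conjI)
    show "\<forall>(\<alpha>, \<beta>)\<in>?r. chain_map R (?F \<alpha>) (?F \<beta>) (\<lambda>m x. x)"
    proof
      fix p assume "p \<in> ?r"
      then show "case p of (\<alpha>, \<beta>) \<Rightarrow> chain_map R (?F \<alpha>) (?F \<beta>) (\<lambda>m x. x)"
        by (cases p) (simp only: prod.case incl)
    qed
    show "\<forall>\<alpha>\<in>Field ?r. chain_complex R (?F \<alpha>)" by (intro ballI subcplx_complex good)
  qed (rule ballI allI impI refl)+
  have ne: "Field ?r \<noteq> {}" using inf by (rule contrapos_nn) simp
  have colim: "is_colimit R ?r (Field ?r) ?F ?t X (\<lambda>_ _ x. x)"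
    using is_colimit_subcplx[OF r order_refl ne mono good good_B total] unfolding subcplx_B .
  have limit: "is_colimit R ?r (underS ?r \<beta>) ?F ?t (?F \<beta>) (\<lambda>\<alpha>. ?t \<alpha> \<beta>)" if l: "limit_in ?r \<beta>" for \<beta>
  proof (rule is_colimit_subcplx[OF r _ _ mono good good])
    show sub: "underS ?r \<beta> \<subseteq> Field ?r" by (auto simp: underS_def Field_def)
    show ne: "underS ?r \<beta> \<noteq> {}" using l by (simp add: limit_in_def)
    have "subset.chain UNIV (G ` underS ?r \<beta>)"
      unfolding subset_chain_def
    proof (intro conjI ballI)
      fix A A' assume "A \<in> G ` underS ?r \<beta>" "A' \<in> G ` underS ?r \<beta>"
      then obtain \<alpha> \<gamma> where *: "\<alpha> \<in> Field ?r" "\<gamma> \<in> Field ?r" "A = G \<alpha>" "A' = G \<gamma>" using sub by blast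
      then have "(\<alpha>, \<gamma>) \<in> ?r \<or> (\<gamma>, \<alpha>) \<in> ?r"
        using wo_rel.TOTALS[of ?r] r unfolding wo_rel_def by blast
      then show "A \<subseteq> A' \<or> A' \<subseteq> A" using mono *(3,4) by blast
    qed simp
    then show "Y (G \<beta>) m = (\<Union>\<alpha>\<in>underS ?r \<beta>. Y (G \<alpha>) m)" for m
      using Y_Union[of "G ` underS ?r \<beta>" m] ne lim[OF l] by simp
  qed
  \<comment> \<open>The first stage is the zero complex, treated as the subquotient for
    \<open>S = S' = {}\<close> with the identity as quotient map.\<close>
  have first: "?F \<alpha> \<in> ex_tilde R (Proj_dim_card R n \<kappa>)" if "underS ?r \<alpha> = {}" for \<alpha>
  proof -
    have g: "good {}" using good[of \<alpha>] bot[OF that] by simp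
    have "F {} (m, 0) = {\<lambda>_. \<zero>\<^bsub>R\<^esub>}" for m by (simp add: slice_def free_on_empty[OF R])
    then have "Y {} m = {\<zero>\<^bsub>ob X m\<^esub>}" for m
      using lmod_hom_zero[OF free_module X_module e_hom, of m] by (simp add: Y_def)
    then have "subcplx {} \<in> ex_tilde R (Proj_dim_card R n \<kappa>)"
      using subcplx_inclusion[of "{}" "{}"]
      by (intro subquotient_class[OF \<kappa>(1) g g _ _ subcplx_complex[OF g], of "\<lambda>m x. x"]
          card_of_finite_ordLeq[OF \<kappa>]) (auto simp: lmod_kernel_def)
    then show ?thesis by (simp add: bot[OF that])
  qed
  have quot: "\<exists>C\<in>(ex_tilde R (Proj_dim_card R n \<kappa>) :: ('r, 'm) cplx set).
      \<exists>q. mono_with_cokernel R (?F \<alpha>) (?t \<alpha> \<beta>) (?F \<beta>) q C"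
    if s: "succ_in ?r \<alpha> \<beta>" for \<alpha> \<beta>
  proof -
    have "(\<alpha>, \<beta>) \<in> ?r"
    proof -
      have "\<alpha> \<in> under ?r \<alpha>" using s wo_rel.REFL[of ?r] r by (auto simp: wo_rel_def succ_in_def refl_on_def under_def)
      then show ?thesis using s by (auto simp: succ_in_def underS_def)
    qed
    note GG = mono[OF this] and i = incl[OF this]
    have "\<exists>(C :: ('r, 'm) cplx) q. chain_complex R C \<and> chain_map R (?F \<beta>) C q \<and>
      (\<forall>m. q m ` carrier (ob (?F \<beta>) m) = carrier (ob C m) \<and>
        lmod_kernel (ob (?F \<beta>) m) (ob C m) (q m) = Y (G \<alpha>) m)"
      by (rule quotient_complex[OF subcplx_complex[OF good]])
        (simp_all add: Y_mono[OF GG] Y_zero Y_add[OF good] Y_smult[OF good] bd_Y[OF good])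
    then obtain C :: "('r, 'm) cplx" and q where Cq: "chain_complex R C \<and> chain_map R (?F \<beta>) C q \<and>
      (\<forall>m. q m ` carrier (ob (?F \<beta>) m) = carrier (ob C m) \<and>
        lmod_kernel (ob (?F \<beta>) m) (ob C m) (q m) = Y (G \<alpha>) m)"
      by (elim exE)
    then have C: "chain_complex R C" "chain_map R (?F \<beta>) C q"
      "q m ` Y (G \<beta>) m = carrier (ob C m)"
      "lmod_kernel (ob (?F \<beta>) m) (ob C m) (q m) = Y (G \<alpha>) m" for m
      by simp_all
    have cls: "C \<in> ex_tilde R (Proj_dim_card R n \<kappa>)"
      by (rule subquotient_class[OF \<kappa>(1) good good GG succ(1)[OF s] C])
    have "mono_with_cokernel R (?F \<alpha>) (\<lambda>m x. x) (?F \<beta>) q C"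
      unfolding mono_with_cokernel_def using i C(1,2) Cq by simp
    then show ?thesis using cls by blast
  qed
  have "is_filtration R (ex_tilde R (Proj_dim_card R n \<kappa>)) X ?r ?F ?t (\<lambda>_ _ x. x)"
    unfolding is_filtration_def by (intro conjI allI ballI impI r ne fctr colim limit first quot)
  then show ?thesis unfolding has_filtration_def by (intro exI)
qed

end

theorem theorem5p3:
  fixes R :: "('r, 'z) ring_scheme"
    and n :: nat
    and \<kappa> :: "'k rel"
    and X :: "('r, 'm) cplx"
  assumes "ring R"
    and "n > 0"
    and "Card_order \<kappa>" and "infinite (Field \<kappa>)" and "regularCard \<kappa>"
    and "|carrier R| <o \<kappa>"
    and "X \<in> ex_tilde R (Proj_dim TYPE('p) R n)"
  shows "has_filtration R (ex_tilde R (Proj_dim_card R n \<kappa>)) X"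
proof -
  have X: "chain_complex R X" "exact_complex X" "\<And>m. ob X m \<in> Proj_dim TYPE('p) R n"
    using assms(7) by (simp_all add: ex_tilde_def)
  have "\<exists>(B :: nat \<Rightarrow> (nat \<times> nat \<times> 'p) set) D e. free_resolution R n B D e (ob X m)" for m
  proof -
    obtain Q :: "nat \<Rightarrow> ('r, 'p) module" and d e
      where "exact_resolution R n Q d e (ob X m) \<and> (\<forall>k\<le>n. projective R (Q k))"
      using X(3)[of m] unfolding Proj_dim_def by auto
    then show ?thesis using free_resolution_exists[OF assms(1,2)] by blast
  qed
  then obtain B :: "int \<Rightarrow> nat \<Rightarrow> (nat \<times> nat \<times> 'p) set" and D e
    where "\<And>m. free_resolution R n (B m) (D m) (e m) (ob X m)"
    by metis
  then interpret resolved_complex R X n B D e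
    by (intro resolved_complex.intro assms(1) X)
  show ?thesis
    by (rule has_filtration[OF assms(3,4) ordLess_imp_ordLeq[OF assms(6)]])
qed

end
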